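(* Let $T,K,r,\sigma>0$, $S_0>0$ and $g(S)=(K-S)^+$. With the stopping times $\tau^\lambda$ and $\tau^*$ defined in the context, as $\lambda\to0^+$, $$\mathbb E\big[e^{-r\tau^{\lambda}}g(S_{\tau^{\lambda}})\big]\ \ge\ \mathbb E\big[e^{-r\tau^{*}}g(S_{\tau^{*}})\big]-O\Big(\lambda\log\frac1\lambda\Big),$$ that is, there exist constants $C'>0$ and $\lambda_0\in(0,1)$ such that for all $0<\lambda<\lambda_0$ one has $\mathbb E[e^{-r\tau^{\lambda}}g(S_{\tau^{\lambda}})]\ge\mathbb E[e^{-r\tau^{*}}g(S_{\tau^{*}})]-C'\lambda\log\frac1\lambda$.
   Context: The stock price satisfies $dS_t=S_t(r\,dt+\sigma\,dW_t)$ with initial value $S_0$, where $W$ is a standard Brownian motion. Let $h(x)=g(e^x)=(K-e^x)^+$ and $\mathcal L_x=\frac12\sigma^2\partial_{xx}+(r-\frac12\sigma^2)\partial_x-r$. For $\lambda>0$, $u^\lambda$ is the classical solution on $\mathbb R\times[0,T]$, continuous up to $t=T$ and satisfying $0\le u^\lambda(x,t)\le K+\lambda(T-t)$, of $$\partial_tu^\lambda+\mathcal L_xu^\lambda+\lambda\exp\Big(-\frac{u^\lambda-h}{\lambda}\Big)=0,\qquad u^\lambda(x,T)=h(x),$$ and $V^\lambda(S,t)=u^\lambda(\log S,t)$. Define $$\tau^\lambda:=\inf\{t:\ V^\lambda(S_t,t)\le g(S_t)\}\wedge T .$$ The function $u^*$ is the American put price function: $u^*(\log S,t)=\sup_\tau\mathbb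 E[e^{-r(\tau-t)}g(S_\tau)\mid S_t=S]$ over stopping times $\tau$ with values in $[t,T]$; it is the solution of $\min\{-\partial_tu^*-\mathcal L_xu^*,\ u^*-h\}=0$, $u^*(x,T)=h(x)$. The optimal stopping time for the American put is $$\tau^*:=\inf\{t:\ u^*(\log S_t,t)\le g(S_t)\}\wedge T ,$$ and it attains $\sup_{\tau}\mathbb E[e^{-r\tau}g(S_\tau)]$ over stopping times $\tau$ with values in $[0,T]$. *)

theory Defs
  imports "HOL-Probability.Probability"
begin

section \<open>Brownian motion\<close>

text \<open>
  The filtration is indexed by all of \<open>real\<close>, as the library's \<open>filtration\<close> locale requires; only
  times \<open>t \<ge> 0\<close> carry information. Taking for \<open>F\<close> the filtration generated by \<open>W\<close>, or its usual
  augmentation, is allowed.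
\<close>

locale brownian_motion = prob_space M + filtration "space M" F
  for M :: "'a measure" and F :: "real \<Rightarrow> 'a measure" +
  fixes W :: "real \<Rightarrow> 'a \<Rightarrow> real"
  assumes subalg: "subalgebra M (F t)"
    and adapted: "0 \<le> t \<Longrightarrow> W t \<in> borel_measurable (F t)"
    and start: "AE \<omega> in M. W 0 \<omega> = 0"
    and continuous_paths: "\<omega> \<in> space M \<Longrightarrow> continuous_on {0..} (\<lambda>t. W t \<omega>)"
    and indep_increments: "0 \<le> s \<Longrightarrow> s < t \<Longrightarrow>
      indep_set (sets (F s)) {(\<lambda>\<omega>. W t \<omega> - W s \<omega>) -` A \<inter> space M | A. A \<in> sets borel}"
    and normal_increments: "0 \<le> s \<Longrightarrow> s < t \<Longrightarrow>
      distributed M lborel (\<lambda>\<omega>. W t \<omega> - W s \<omega>) (\<lambda>x. ennreal (normal_density 0 (sqrt (t - s)) x))"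

section \<open>The Ito integral\<close>

definition step_process ::
  "(real \<Rightarrow> 'a measure) \<Rightarrow> real \<Rightarrow> real \<Rightarrow> nat \<Rightarrow> (nat \<Rightarrow> real) \<Rightarrow> (nat \<Rightarrow> 'a \<Rightarrow> real) \<Rightarrow> bool" where
  "step_process F a b n p \<xi> \<longleftrightarrow>
     p 0 = a \<and> p n = b \<and> (\<forall>i<n. p i \<le> p (Suc i)) \<and> (\<forall>i<n. \<xi> i \<in> borel_measurable (F (p i)))"

definition step_value ::
  "nat \<Rightarrow> (nat \<Rightarrow> real) \<Rightarrow> (nat \<Rightarrow> 'a \<Rightarrow> real) \<Rightarrow> real \<Rightarrow> 'a \<Rightarrow> real" where
  "step_value n p \<xi> s \<omega> = (\<Sum>i<n. \<xi> i \<omega> * indicator {p i..<p (Suc i)} s)"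

definition step_integral ::
  "(real \<Rightarrow> 'a \<Rightarrow> real) \<Rightarrow> nat \<Rightarrow> (nat \<Rightarrow> real) \<Rightarrow> (nat \<Rightarrow> 'a \<Rightarrow> real) \<Rightarrow> 'a \<Rightarrow> real" where
  "step_integral W n p \<xi> \<omega> = (\<Sum>i<n. \<xi> i \<omega> * (W (p (Suc i)) \<omega> - W (p i) \<omega>))"

text \<open>
  Measurability is part of the definition because \<open>measure\<close> returns 0 on non-measurable sets.
\<close>

definition to_zero_in_prob :: "'a measure \<Rightarrow> (nat \<Rightarrow> 'a \<Rightarrow> ennreal) \<Rightarrow> bool" where
  "to_zero_in_prob M Y \<longleftrightarrow> (\<forall>k. Y k \<in> borel_measurable M) \<and>
     (\<forall>\<epsilon>>0. (\<lambda>k. measure M {\<omega> \<in> space M. ennreal \<epsilon> < Y k \<omega>}) \<longlonglongrightarrow> 0)"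

text \<open>
  \<open>I\<close> is (a version of) the Ito integral of the measurable adapted process \<open>H\<close> over \<open>[a, b]\<close> if
  there are step processes \<open>\<phi>\<^sub>k\<close> such that \<open>\<integral>\<^sub>a\<^sup>b (\<phi>\<^sub>k - H)\<^sup>2 ds\<close> tends to 0 in probability and
  \<open>\<integral>\<^sub>a\<^sup>b \<phi>\<^sub>k dW\<close> tends to \<open>I\<close> in probability. The existence of the \<open>\<phi>\<^sub>k\<close> forces
  \<open>\<integral>\<^sub>a\<^sup>b H\<^sup>2 ds < \<infinity>\<close> almost surely.
\<close>

definition has_ito_integral ::
  "'a measure \<Rightarrow> (real \<Rightarrow> 'a measure) \<Rightarrow> (real \<Rightarrow> 'a \<Rightarrow> real) \<Rightarrow>
   (real \<Rightarrow> 'a \<Rightarrow> real) \<Rightarrow> real \<Rightarrow> real \<Rightarrow> ('a \<Rightarrow> real) \<Rightarrow> bool" where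
  "has_ito_integral M F W H a b I \<longleftrightarrow>
     I \<in> borel_measurable M \<and>
     (\<forall>t\<in>{a..b}. H t \<in> borel_measurable (F t)) \<and>
     (\<lambda>(t, \<omega>). H t \<omega>) \<in> borel_measurable (restrict_space borel {a..b} \<Otimes>\<^sub>M M) \<and>
     (\<exists>n p \<xi>. (\<forall>k. step_process F a b (n k) (p k) (\<xi> k)) \<and>
        to_zero_in_prob M
          (\<lambda>k \<omega>. \<integral>\<^sup>+ s \<in> {a..b}. ennreal ((step_value (n k) (p k) (\<xi> k) s \<omega> - H s \<omega>)\<^sup>2) \<partial>lborel) \<and>
        to_zero_in_prob M
          (\<lambda>k \<omega>. ennreal \<bar>step_integral W (n k) (p k) (\<xi> k) \<omega> - I \<omega>\<bar>))"

section \<open>The stock price\<close>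

text \<open>
  \<open>X\<close> is a stock price on \<open>[a, T]\<close> with value \<open>x\<^sub>0\<close> at time \<open>a\<close>: a positive continuous process with
  \<open>dX\<^sub>t = X\<^sub>t (r dt + \<sigma> dW\<^sub>t)\<close>. Adaptedness is contained in \<open>has_ito_integral\<close>. Almost
  sure positivity follows from the equation; it is required for all \<open>\<omega>\<close> so that \<open>ln X\<^sub>t\<close> makes sense.
\<close>

definition stock_price ::
  "'a measure \<Rightarrow> (real \<Rightarrow> 'a measure) \<Rightarrow> (real \<Rightarrow> 'a \<Rightarrow> real) \<Rightarrow> real \<Rightarrow> real \<Rightarrow>
   real \<Rightarrow> real \<Rightarrow> real \<Rightarrow> (real \<Rightarrow> 'a \<Rightarrow> real) \<Rightarrow> bool" where
  "stock_price M F W r \<sigma> T a x0 X \<longleftrightarrow>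
     (\<forall>\<omega>\<in>space M. continuous_on {a..T} (\<lambda>t. X t \<omega>) \<and> (\<forall>t\<in>{a..T}. X t \<omega> > 0)) \<and>
     (AE \<omega> in M. X a \<omega> = x0) \<and>
     (\<forall>t\<in>{a..T}. \<exists>I. has_ito_integral M F W (\<lambda>s \<omega>. \<sigma> * X s \<omega>) a t I \<and>
        (AE \<omega> in M. X t \<omega> = X a \<omega> + integral {a..t} (\<lambda>s. r * X s \<omega>) + I \<omega>))"

section \<open>The American put\<close>

definition put_payoff :: "real \<Rightarrow> real \<Rightarrow> real" where
  "put_payoff K s = max (K - s) 0"

text \<open>
  The value at time \<open>t\<close>, discounted to time \<open>t\<close>, of exercising the put on \<open>X\<close> at time \<open>\<tau>\<close>.
\<close>

definition exercise_value ::
  "'a measure \<Rightarrow> real \<Rightarrow> real \<Rightarrow> real \<Rightarrow> (real \<Rightarrow> 'a \<Rightarrow> real) \<Rightarrow> ('a \<Rightarrow> real) \<Rightarrow> real" where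
  "exercise_value M r K t X \<tau> =
     (\<integral>\<omega>. exp (- r * (\<tau> \<omega> - t)) * put_payoff K (X (\<tau> \<omega>) \<omega>) \<partial>M)"

text \<open>
  Conditioning on \<open>S\<^sub>t = s\<close> means that the stock price is started from \<open>s\<close> at time \<open>t\<close>. The solution
  of the stochastic differential equation is unique up to indistinguishability, so letting \<open>X\<close>
  range over all solutions does not enlarge the supremum. The set is bounded above by \<open>K\<close>.
\<close>

definition american_put ::
  "'a measure \<Rightarrow> (real \<Rightarrow> 'a measure) \<Rightarrow> (real \<Rightarrow> 'a \<Rightarrow> real) \<Rightarrow> real \<Rightarrow> real \<Rightarrow>
   real \<Rightarrow> real \<Rightarrow> real \<Rightarrow> real \<Rightarrow> real" where
  "american_put M F W r \<sigma> K T s t =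
     Sup {exercise_value M r K t X \<tau> | X \<tau>.
       stock_price M F W r \<sigma> T t s X \<and>
       stopping_time F \<tau> \<and> (\<forall>\<omega>\<in>space M. \<tau> \<omega> \<in> {t..T})}"

text \<open>The price as a function of the log-price.\<close>

definition u_star ::
  "'a measure \<Rightarrow> (real \<Rightarrow> 'a measure) \<Rightarrow> (real \<Rightarrow> 'a \<Rightarrow> real) \<Rightarrow> real \<Rightarrow> real \<Rightarrow>
   real \<Rightarrow> real \<Rightarrow> real \<Rightarrow> real \<Rightarrow> real" where
  "u_star M F W r \<sigma> K T x t = american_put M F W r \<sigma> K T (exp x) t"

section \<open>The penalized equation\<close>

definition penalized_solution ::
  "real \<Rightarrow> real \<Rightarrow> real \<Rightarrow> real \<Rightarrow> real \<Rightarrow> (real \<Rightarrow> real \<Rightarrow> real) \<Rightarrow> bool" where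
  "penalized_solution r \<sigma> K T l u \<longleftrightarrow>
     continuous_on (UNIV \<times> {0..T}) (\<lambda>(x, t). u x t) \<and>
     (\<exists>ut ux uxx.
        continuous_on (UNIV \<times> {0..<T}) (\<lambda>(x, t). ut x t) \<and>
        continuous_on (UNIV \<times> {0..<T}) (\<lambda>(x, t). ux x t) \<and>
        continuous_on (UNIV \<times> {0..<T}) (\<lambda>(x, t). uxx x t) \<and>
        (\<forall>x. \<forall>t\<in>{0..<T}.
           ((\<lambda>s. u x s) has_real_derivative ut x t) (at t within {0..T}) \<and>
           ((\<lambda>y. u y t) has_real_derivative ux x t) (at x) \<and>
           ((\<lambda>y. ux y t) has_real_derivative uxx x t) (at x) \<and>
           ut x t
             + (\<sigma>\<^sup>2 / 2 * uxx x t + (r - \<sigma>\<^sup>2 / 2) * ux x t - r * u x t)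
             + l * exp (- (u x t - put_payoff K (exp x)) / l) = 0)) \<and>
     (\<forall>x. u x T = put_payoff K (exp x)) \<and>
     (\<forall>x. \<forall>t\<in>{0..T}. 0 \<le> u x t \<and> u x t \<le> K + l * (T - t))"

section \<open>Exercise times\<close>

text \<open>
  \<open>inf {t. v (ln S\<^sub>t, t) \<le> g S\<^sub>t} \<and> T\<close>. Inserting \<open>T\<close> implements both the truncation at \<open>T\<close>
  and the convention \<open>inf \<emptyset> = \<infinity>\<close>.
\<close>

definition exercise_time ::
  "real \<Rightarrow> real \<Rightarrow> (real \<Rightarrow> 'a \<Rightarrow> real) \<Rightarrow> (real \<Rightarrow> real \<Rightarrow> real) \<Rightarrow> 'a \<Rightarrow> real" where
  "exercise_time K T S v \<omega> =
     Inf (insert T {t \<in> {0..T}. v (ln (S t \<omega>)) t \<le> put_payoff K (S t \<omega>)})"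

end

theory Submission
  imports Defs
begin

text \<open>
  Write \<open>h\<close> for the payoff in the log-price and \<open>\<epsilon> l = l * max 0 (ln (r * K / l))\<close>, which is
  \<open>O(l ln (1 / l))\<close>. The theorem rests on two facts about the penalized solution \<open>u\<close> with parameter \<open>l\<close>.
  First, \<open>u \<ge> h - \<epsilon> l\<close>: for \<open>x < ln K\<close> one has \<open>L h = - r * K\<close>, so \<open>h - \<epsilon> l\<close> is a
  subsolution of the penalized equation there, while for \<open>x \<ge> ln K\<close> the payoff vanishes and \<open>u \<ge> 0\<close>;
  the maximum principle gives the bound (\<open>penalized_solution_ge_obstacle\<close>). Second, the discounted process
  \<open>exp (- r t) u (ln S\<^sub>t, t)\<close> is a supermartingale because the penalty is nonnegative, and as long as \<open>u > h\<close>
  its drift is at least \<open>- l\<close>. Hence the payoff of an arbitrary stopping time is at most \<open>u + \<epsilon> l\<close>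
  (\<open>exercise_value_le_penalized\<close>), and that of the first time at which \<open>u \<le> h\<close> is at least \<open>u - l * T\<close>
  (\<open>penalized_hitting_value\<close>). Comparing both with \<open>u (ln S0) 0\<close> proves the claim, the stopping time
  \<open>\<tau>\<^sup>*\<close> being one admissible competitor; its optimality plays no role.

  That \<open>\<tau>\<^sup>*\<close> is a stopping time needs an argument, since the American price is only given as a supremum.
  The two inequalities, applied from every starting point, show that it is the uniform limit of the penalized
  solutions and therefore continuous (\<open>u_star_continuous\<close>); the first entrance time of a continuous adapted
  process into a closed set is a stopping time, whether or not the filtration is right-continuous.

  The supermartingale estimates do not use an Ito formula. A solution of the stochastic
  differential equation is identified with the explicit geometric Brownian motion: by a localised isometry the Ito integral of
  a continuous adapted process is the limit in probability of its Riemann sums (\<open>ito_integral_riemann\<close>), hence the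
  exponential is a solution (\<open>gbm_stock_price\<close>) and the difference of two solutions vanishes by a Gronwall
  argument (\<open>stock_price_unique\<close>). For the explicit process a second-order Taylor expansion over one time step,
  uniform on compact sets, together with independence of the Gaussian increments and summation over a
  grid gives a one-sided Dynkin inequality at stopping times (\<open>dynkin_lower\<close>).
\<close>

section \<open>Gaussian increments\<close>

lemma power2_sum_le: "(x + y)\<^sup>2 \<le> 2 * x\<^sup>2 + 2 * (y::real)\<^sup>2"
  using sum_squares_bound[of x y] by (simp add: power2_sum)

text \<open>Completing the square: an exponential weight shifts the mean of a Gaussian density.\<close>

lemma normal_density_mult_exp:
  assumes "s > 0"
  shows "normal_density 0 s x * exp (c * x) = exp (c\<^sup>2 * s\<^sup>2 / 2) * normal_density (c * s\<^sup>2) s x"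
proof -
  have "- (x - 0)\<^sup>2 / (2 * s\<^sup>2) + c * x = c\<^sup>2 * s\<^sup>2 / 2 + (- (x - c * s\<^sup>2)\<^sup>2 / (2 * s\<^sup>2))"
    using assms by (simp add: field_simps power2_eq_square)
  then show ?thesis
    unfolding normal_density_def by (simp add: mult_exp_exp)
qed

lemma Int_stable_vimage: "Int_stable {V -` A \<inter> \<Omega> |A. A \<in> sets L}"
  unfolding Int_stable_def
proof safe
  fix A B assume "A \<in> sets L" "B \<in> sets L"
  then show "\<exists>C. V -` A \<inter> \<Omega> \<inter> (V -` B \<inter> \<Omega>) = V -` C \<inter> \<Omega> \<and> C \<in> sets L"
    by (intro exI[of _ "A \<inter> B"]) auto
qed

context brownian_motion
begin

lemma sets_F_subset: "sets (F t) \<subseteq> sets M"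
  using subalg[of t] by (simp add: subalgebra_def)

lemma measurable_F_mono:
  assumes "f \<in> measurable (F s) N" "s \<le> t"
  shows "f \<in> measurable (F t) N"
  using assms sets_F_mono[of s t] space_F by (auto simp: measurable_def)

lemma measurable_F_M:
  assumes "f \<in> measurable (F s) N" shows "f \<in> measurable M N"
  using assms sets_F_subset[of s] space_F by (auto simp: measurable_def)

lemma W_measurable_F: "0 \<le> s \<Longrightarrow> s \<le> t \<Longrightarrow> W s \<in> borel_measurable (F t)"
  using adapted measurable_F_mono by blast

lemma W_measurable_M: "0 \<le> s \<Longrightarrow> W s \<in> borel_measurable M"
  using adapted measurable_F_M by blast

lemma increment_indep_set:
  assumes "0 \<le> s" "s \<le> t"
  shows "indep_set (sets (F s)) {(\<lambda>\<omega>. W t \<omega> - W s \<omega>) -` A \<inter> space M | A. A \<in> sets borel}"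
proof (cases "s < t")
  case True then show ?thesis using indep_increments assms by auto
next
  case False
  then have st: "t = s" using assms by auto
  have *: "(\<lambda>\<omega>. W t \<omega> - W s \<omega>) -` A \<inter> space M = (if 0 \<in> A then space M else {})" for A
    by (auto simp: st)
  show ?thesis
    unfolding indep_sets2_eq *
    using sets_F_subset[of s] by (auto simp: prob_space Int_absorb2 dest: sets.sets_into_space)
qed

lemma increment_indep:
  assumes "0 \<le> s" "s \<le> t" and U: "U \<in> measurable (F s) N"
  shows "indep_var N U borel (\<lambda>\<omega>. W t \<omega> - W s \<omega>)"
proof -
  note [measurable] = measurable_F_M[OF U]
  have [measurable]: "W t \<in> borel_measurable M" "W s \<in> borel_measurable M"
    using assms W_measurable_M by auto
  note ind = increment_indep_set[OF assms(1,2)]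
  have sub: "{U -` A \<inter> space M | A. A \<in> sets N} \<subseteq> sets (F s)"
    using measurable_sets[OF U] space_F by auto
  have "indep_set {U -` A \<inter> space M | A. A \<in> sets N}
     {(\<lambda>\<omega>. W t \<omega> - W s \<omega>) -` A \<inter> space M | A. A \<in> sets borel}"
    using ind sub unfolding indep_sets2_eq by blast
  then have "indep_set (sigma_sets (space M) {U -` A \<inter> space M | A. A \<in> sets N})
     (sigma_sets (space M) {(\<lambda>\<omega>. W t \<omega> - W s \<omega>) -` A \<inter> space M | A. A \<in> sets borel})"
    by (rule indep_set_sigma_sets) (rule Int_stable_vimage)+
  then show ?thesis
    unfolding indep_var_eq by simp
qed

lemma increment_exp_moment:
  assumes "0 \<le> s" "s \<le> t"
  shows "integrable M (\<lambda>\<omega>. exp (c * (W t \<omega> - W s \<omega>)))" (is ?A)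
    and "expectation (\<lambda>\<omega>. exp (c * (W t \<omega> - W s \<omega>))) = exp (c\<^sup>2 * (t - s) / 2)" (is ?B)
    and "integrable M (\<lambda>\<omega>. (W t \<omega> - W s \<omega>) * exp (c * (W t \<omega> - W s \<omega>)))" (is ?C)
    and "expectation (\<lambda>\<omega>. (W t \<omega> - W s \<omega>) * exp (c * (W t \<omega> - W s \<omega>)))
       = c * (t - s) * exp (c\<^sup>2 * (t - s) / 2)" (is ?D)
proof -
  have "?A \<and> ?B \<and> ?C \<and> ?D"
  proof (cases "s < t")
    case False
    then have "t = s" using assms by auto
    then show ?thesis by (simp add: prob_space)
  next
    case True
    let ?q = "sqrt (t - s)"
    have q: "?q > 0" "?q\<^sup>2 = t - s" using True by auto
    have D: "distributed M lborel (\<lambda>\<omega>. W t \<omega> - W s \<omega>) (\<lambda>x. ennreal (normal_density 0 ?q x))"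
      using normal_increments True assms by auto
    have 1: "normal_density 0 ?q x * exp (c * x)
        = exp (c\<^sup>2 * (t - s) / 2) * normal_density (c * (t - s)) ?q x" for x
      using normal_density_mult_exp[OF q(1), of x c] q(2) by simp
    have 2: "normal_density 0 ?q x * (x * exp (c * x))
        = exp (c\<^sup>2 * (t - s) / 2) * (normal_density (c * (t - s)) ?q x * x)" for x
      using 1[of x] by (simp add: algebra_simps)
    have "?A"
      by (subst distributed_integrable[OF D, of "\<lambda>x. exp (c * x)", symmetric]) (use q in \<open>auto simp: 1 intro!: integrable_normal_density\<close>)
    moreover have "?B"
      by (subst distributed_integral[OF D, of "\<lambda>x. exp (c * x)", symmetric])
        (use q(1) in \<open>auto simp: 1\<close>)
    moreover have "?C"
      by (subst distributed_integrable[OF D, of "\<lambda>x. x * exp (c * x)", symmetric])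
        (use integrable_normal_moment_nz_1[OF q(1)] in \<open>auto simp: 2\<close>)
    moreover have "?D"
      by (subst distributed_integral[OF D, of "\<lambda>x. x * exp (c * x)", symmetric])
        (use integral_normal_moment_nz_1[OF q(1)] in \<open>auto simp: 2\<close>)
    ultimately show ?thesis by blast
  qed
  then show ?A ?B ?C ?D by auto
qed

lemma increment_moments:
  assumes "0 \<le> s" "s \<le> t"
  shows "integrable M (\<lambda>\<omega>. W t \<omega> - W s \<omega>)" (is ?A)
    and "expectation (\<lambda>\<omega>. W t \<omega> - W s \<omega>) = 0" (is ?B)
    and "integrable M (\<lambda>\<omega>. (W t \<omega> - W s \<omega>)\<^sup>2)" (is ?C)
    and "expectation (\<lambda>\<omega>. (W t \<omega> - W s \<omega>)\<^sup>2) = t - s" (is ?D)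
proof -
  show ?A ?B using increment_exp_moment(3,4)[OF assms, of 0] by auto
  have "?C \<and> ?D"
  proof (cases "s < t")
    case False
    then have "t = s" using assms by auto
    then show ?thesis by simp
  next
    case True
    let ?q = "sqrt (t - s)"
    have q: "?q > 0" "?q\<^sup>2 = t - s" using True by auto
    have D: "distributed M lborel (\<lambda>\<omega>. W t \<omega> - W s \<omega>) (\<lambda>x. ennreal (normal_density 0 ?q x))"
      using normal_increments True assms by auto
    have m: "has_bochner_integral lborel (\<lambda>x. normal_density 0 ?q x * x ^ 2) (t - s)"
      using normal_moment_even[OF q(1), of 0 1] q(2) True by (simp add: diff_divide_distrib)
    have "?C"
      by (subst distributed_integrable[OF D, of "\<lambda>x. x^2", symmetric])
        (use m in \<open>auto simp: has_bochner_integral_iff\<close>)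
    moreover have "?D"
      by (subst distributed_integral[OF D, of "\<lambda>x. x^2", symmetric])
        (use m in \<open>auto simp: has_bochner_integral_iff\<close>)
    ultimately show ?thesis by blast
  qed
  then show ?C ?D by auto
qed

section \<open>Orthogonality of martingale differences\<close>

text \<open>Terms \<open>\<psi>\<^sub>i \<eta>\<^sub>i\<close> with \<open>\<psi>\<^sub>i\<close> known at time \<open>p\<^sub>i\<close> and \<open>\<eta>\<^sub>i\<close> centred and independent of the past
  up to \<open>p\<^sub>i\<close> are orthogonal. This is the Ito isometry when \<open>\<eta>\<^sub>i\<close> is a Brownian increment; it is also applied to
  other functions of the increments.\<close>

lemma orthogonal_sum:
  fixes p :: "nat \<Rightarrow> real" and \<psi> \<eta> :: "nat \<Rightarrow> 'a \<Rightarrow> real"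
  assumes mono: "\<And>i. i < n \<Longrightarrow> p i \<le> p (Suc i)"
    and \<psi>: "\<And>i. i < n \<Longrightarrow> \<psi> i \<in> borel_measurable (F (p i))"
    and \<psi>2: "\<And>i. i < n \<Longrightarrow> integrable M (\<lambda>\<omega>. (\<psi> i \<omega>)\<^sup>2)"
    and \<eta>: "\<And>i. i < n \<Longrightarrow> \<eta> i \<in> borel_measurable (F (p (Suc i)))"
    and \<eta>2: "\<And>i. i < n \<Longrightarrow> integrable M (\<lambda>\<omega>. (\<eta> i \<omega>)\<^sup>2)"
    and \<eta>0: "\<And>i. i < n \<Longrightarrow> expectation (\<eta> i) = 0"
    and ind: "\<And>i U. i < n \<Longrightarrow> U \<in> borel_measurable (F (p i)) \<Longrightarrow> indep_var borel U borel (\<eta> i)"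
  shows "integrable M (\<lambda>\<omega>. (\<Sum>i<n. \<psi> i \<omega> * \<eta> i \<omega>)\<^sup>2) \<and>
    (\<lambda>\<omega>. \<Sum>i<n. \<psi> i \<omega> * \<eta> i \<omega>) \<in> borel_measurable (F (p n)) \<and>
    expectation (\<lambda>\<omega>. (\<Sum>i<n. \<psi> i \<omega> * \<eta> i \<omega>)\<^sup>2)
      = (\<Sum>i<n. expectation (\<lambda>\<omega>. (\<psi> i \<omega>)\<^sup>2) * expectation (\<lambda>\<omega>. (\<eta> i \<omega>)\<^sup>2))"
  using assms
proof (induction n)
  case 0
  then show ?case by simp
next
  case (Suc n)
  define A where "A \<omega> = (\<Sum>i<n. \<psi> i \<omega> * \<eta> i \<omega>)" for \<omega>
  have A: "integrable M (\<lambda>\<omega>. (A \<omega>)\<^sup>2)" "A \<in> borel_measurable (F (p n))"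
    "expectation (\<lambda>\<omega>. (A \<omega>)\<^sup>2)
       = (\<Sum>i<n. expectation (\<lambda>\<omega>. (\<psi> i \<omega>)\<^sup>2) * expectation (\<lambda>\<omega>. (\<eta> i \<omega>)\<^sup>2))"
  proof -
    show "integrable M (\<lambda>\<omega>. (A \<omega>)\<^sup>2)" "A \<in> borel_measurable (F (p n))"
    "expectation (\<lambda>\<omega>. (A \<omega>)\<^sup>2)
       = (\<Sum>i<n. expectation (\<lambda>\<omega>. (\<psi> i \<omega>)\<^sup>2) * expectation (\<lambda>\<omega>. (\<eta> i \<omega>)\<^sup>2))"
      using Suc.IH Suc.prems by (simp_all add: A_def[abs_def])
  qed
  have \<psi>n: "\<psi> n \<in> borel_measurable (F (p n))" and \<psi>n2: "integrable M (\<lambda>\<omega>. (\<psi> n \<omega>)\<^sup>2)"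
    and \<eta>n: "\<eta> n \<in> borel_measurable (F (p (Suc n)))" and \<eta>n2: "integrable M (\<lambda>\<omega>. (\<eta> n \<omega>)\<^sup>2)"
    and \<eta>n0: "expectation (\<eta> n) = 0" and pn: "p n \<le> p (Suc n)"
    using Suc.prems by auto
  note [measurable] = measurable_F_M[OF A(2)] measurable_F_M[OF \<psi>n] measurable_F_M[OF \<eta>n]
  have \<eta>n1: "integrable M (\<eta> n)"
    by (rule square_integrable_imp_integrable[OF _ \<eta>n2]) measurable
  have A\<psi>: "integrable M (\<lambda>\<omega>. A \<omega> * \<psi> n \<omega>)"
  proof (rule Bochner_Integration.integrable_bound)
    show "integrable M (\<lambda>\<omega>. (A \<omega>)\<^sup>2 + (\<psi> n \<omega>)\<^sup>2)" using A \<psi>n2 by auto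
    show "AE x in M. norm (A x * \<psi> n x) \<le> norm ((A x)\<^sup>2 + (\<psi> n x)\<^sup>2)"
    proof (rule AE_I2)
      fix x
      have "2 * \<bar>A x\<bar> * \<bar>\<psi> n x\<bar> \<le> (A x)\<^sup>2 + (\<psi> n x)\<^sup>2"
        using sum_squares_bound[of "\<bar>A x\<bar>" "\<bar>\<psi> n x\<bar>"] by simp
      moreover have "0 \<le> \<bar>A x\<bar> * \<bar>\<psi> n x\<bar>" by simp
      ultimately have "\<bar>A x\<bar> * \<bar>\<psi> n x\<bar> \<le> (A x)\<^sup>2 + (\<psi> n x)\<^sup>2" by linarith
      then show "norm (A x * \<psi> n x) \<le> norm ((A x)\<^sup>2 + (\<psi> n x)\<^sup>2)"
        by (simp add: abs_mult)
    qed
  qed measurable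
  have i1: "indep_var borel (\<lambda>\<omega>. A \<omega> * \<psi> n \<omega>) borel (\<eta> n)"
    using A(2) \<psi>n by (intro Suc.prems(7)) auto
  have c: "integrable M (\<lambda>\<omega>. A \<omega> * \<psi> n \<omega> * \<eta> n \<omega>)"
    "expectation (\<lambda>\<omega>. A \<omega> * \<psi> n \<omega> * \<eta> n \<omega>) = 0"
    using indep_var_integrable[OF i1 A\<psi> \<eta>n1] indep_var_lebesgue_integral[OF i1 A\<psi> \<eta>n1] \<eta>n0 by auto
  have "indep_var borel (\<psi> n) borel (\<eta> n)" using \<psi>n by (intro Suc.prems(7)) auto
  then have "indep_var borel ((\<lambda>x. x\<^sup>2) \<circ> \<psi> n) borel ((\<lambda>x. x\<^sup>2) \<circ> \<eta> n)"
    by (rule indep_var_compose) auto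
  then have i2: "indep_var borel (\<lambda>\<omega>. (\<psi> n \<omega>)\<^sup>2) borel (\<lambda>\<omega>. (\<eta> n \<omega>)\<^sup>2)" by (simp add: o_def)
  have d: "integrable M (\<lambda>\<omega>. (\<psi> n \<omega>)\<^sup>2 * (\<eta> n \<omega>)\<^sup>2)"
    "expectation (\<lambda>\<omega>. (\<psi> n \<omega>)\<^sup>2 * (\<eta> n \<omega>)\<^sup>2)
       = expectation (\<lambda>\<omega>. (\<psi> n \<omega>)\<^sup>2) * expectation (\<lambda>\<omega>. (\<eta> n \<omega>)\<^sup>2)"
    using indep_var_integrable[OF i2 \<psi>n2 \<eta>n2] indep_var_lebesgue_integral[OF i2 \<psi>n2 \<eta>n2] by auto
  have eq: "(\<Sum>i<Suc n. \<psi> i \<omega> * \<eta> i \<omega>)\<^sup>2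
     = (A \<omega>)\<^sup>2 + 2 * (A \<omega> * \<psi> n \<omega> * \<eta> n \<omega>) + (\<psi> n \<omega>)\<^sup>2 * (\<eta> n \<omega>)\<^sup>2" for \<omega>
    by (simp add: A_def power2_sum power_mult_distrib algebra_simps)
  have "(\<lambda>\<omega>. A \<omega> + \<psi> n \<omega> * \<eta> n \<omega>) \<in> borel_measurable (F (p (Suc n)))"
    using measurable_F_mono[OF A(2) pn] measurable_F_mono[OF \<psi>n pn] \<eta>n by auto
  then show ?case
    unfolding eq using A c d by (simp add: A_def)
qed

end

section \<open>Convergence in probability\<close>

context prob_space
begin

lemma to_zero_in_prob_mono_AE:
  assumes "to_zero_in_prob M Y" "\<And>k. Z k \<in> borel_measurable M"
    and "\<And>k. AE \<omega> in M. Z k \<omega> \<le> Y k \<omega>"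
  shows "to_zero_in_prob M Z"
  unfolding to_zero_in_prob_def
proof safe
  fix \<epsilon> :: real assume "0 < \<epsilon>"
  have [measurable]: "Y k \<in> borel_measurable M" "Z k \<in> borel_measurable M" for k
    using assms by (auto simp: to_zero_in_prob_def)
  have "(\<lambda>k. prob {\<omega> \<in> space M. ennreal \<epsilon> < Y k \<omega>}) \<longlonglongrightarrow> 0"
    using assms(1) \<open>0 < \<epsilon>\<close> by (auto simp: to_zero_in_prob_def)
  then show "(\<lambda>k. prob {\<omega> \<in> space M. ennreal \<epsilon> < Z k \<omega>}) \<longlonglongrightarrow> 0"
  proof (rule Lim_null_comparison[rotated], intro always_eventually allI)
    fix k
    have "prob {\<omega> \<in> space M. ennreal \<epsilon> < Z k \<omega>} \<le> prob {\<omega> \<in> space M. ennreal \<epsilon> < Y k \<omega>}"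
      using assms(3)[of k] by (intro finite_measure_mono_AE) (auto elim!: eventually_mono intro: less_le_trans)
    then show "norm (prob {\<omega> \<in> space M. ennreal \<epsilon> < Z k \<omega>}) \<le> prob {\<omega> \<in> space M. ennreal \<epsilon> < Y k \<omega>}"
      by simp
  qed
qed (use assms in auto)

lemma to_zero_in_prob_mono:
  assumes "to_zero_in_prob M Y" "\<And>k. Z k \<in> borel_measurable M"
    and "\<And>k \<omega>. \<omega> \<in> space M \<Longrightarrow> Z k \<omega> \<le> Y k \<omega>"
  shows "to_zero_in_prob M Z"
  using assms by (intro to_zero_in_prob_mono_AE[of Y Z] AE_I2)

lemma to_zero_in_prob_add:
  assumes "to_zero_in_prob M Y" "to_zero_in_prob M Z"
  shows "to_zero_in_prob M (\<lambda>k \<omega>. Y k \<omega> + Z k \<omega>)"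
  unfolding to_zero_in_prob_def
proof safe
  have [measurable]: "Y k \<in> borel_measurable M" "Z k \<in> borel_measurable M" for k
    using assms by (auto simp: to_zero_in_prob_def)
  show "(\<lambda>\<omega>. Y k \<omega> + Z k \<omega>) \<in> borel_measurable M" for k by measurable
  fix \<epsilon> :: real assume "0 < \<epsilon>"
  then have "(\<lambda>k. prob {\<omega> \<in> space M. ennreal (\<epsilon>/2) < Y k \<omega>}
      + prob {\<omega> \<in> space M. ennreal (\<epsilon>/2) < Z k \<omega>}) \<longlonglongrightarrow> 0 + 0"
    using assms by (intro tendsto_add) (auto simp: to_zero_in_prob_def)
  then have "(\<lambda>k. prob {\<omega> \<in> space M. ennreal (\<epsilon>/2) < Y k \<omega>}
      + prob {\<omega> \<in> space M. ennreal (\<epsilon>/2) < Z k \<omega>}) \<longlonglongrightarrow> 0" by simp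
  then show "(\<lambda>k. prob {\<omega> \<in> space M. ennreal \<epsilon> < Y k \<omega> + Z k \<omega>}) \<longlonglongrightarrow> 0"
  proof (rule Lim_null_comparison[rotated], intro always_eventually allI)
    fix k
    have "prob {\<omega> \<in> space M. ennreal \<epsilon> < Y k \<omega> + Z k \<omega>} \<le>
      prob ({\<omega> \<in> space M. ennreal (\<epsilon>/2) < Y k \<omega>} \<union> {\<omega> \<in> space M. ennreal (\<epsilon>/2) < Z k \<omega>})"
    proof (intro finite_measure_mono)
      have "y + z \<le> ennreal \<epsilon>" if "y \<le> ennreal (\<epsilon>/2)" "z \<le> ennreal (\<epsilon>/2)" for y z
        using add_mono[OF that] \<open>0 < \<epsilon>\<close> by (simp flip: ennreal_plus)
      then show "{\<omega> \<in> space M. ennreal \<epsilon> < Y k \<omega> + Z k \<omega>} \<subseteq>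
        {\<omega> \<in> space M. ennreal (\<epsilon>/2) < Y k \<omega>} \<union> {\<omega> \<in> space M. ennreal (\<epsilon>/2) < Z k \<omega>}"
        by (auto simp: not_less[symmetric])
    qed measurable
    also have "\<dots> \<le> prob {\<omega> \<in> space M. ennreal (\<epsilon>/2) < Y k \<omega>} + prob {\<omega> \<in> space M. ennreal (\<epsilon>/2) < Z k \<omega>}"
      by (intro measure_Un_le) measurable
    finally show "norm (prob {\<omega> \<in> space M. ennreal \<epsilon> < Y k \<omega> + Z k \<omega>})
      \<le> prob {\<omega> \<in> space M. ennreal (\<epsilon>/2) < Y k \<omega>} + prob {\<omega> \<in> space M. ennreal (\<epsilon>/2) < Z k \<omega>}"
      by simp
  qed
qed

lemma to_zero_in_prob_pointwise:
  assumes "\<And>k. Y k \<in> borel_measurable M"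
    and "\<And>\<omega> \<epsilon>. \<omega> \<in> space M \<Longrightarrow> 0 < \<epsilon> \<Longrightarrow> eventually (\<lambda>k. Y k \<omega> \<le> ennreal \<epsilon>) sequentially"
  shows "to_zero_in_prob M Y"
  unfolding to_zero_in_prob_def
proof safe
  note [measurable] = assms(1)
  show "Y k \<in> borel_measurable M" for k by measurable
  fix \<epsilon> :: real assume "0 < \<epsilon>"
  let ?A = "\<lambda>k. {\<omega> \<in> space M. ennreal \<epsilon> < Y k \<omega>}"
  have "(\<lambda>k. \<integral>\<omega>. indicator (?A k) \<omega> \<partial>M) \<longlonglongrightarrow> (\<integral>\<omega>. (0::real) \<partial>M)"
  proof (rule integral_dominated_convergence[where w = "\<lambda>_. 1"])
    show "AE x in M. (\<lambda>k. indicator (?A k) x) \<longlonglongrightarrow> (0::real)"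
    proof (rule AE_I2)
      fix x assume "x \<in> space M"
      show "(\<lambda>k. indicator (?A k) x) \<longlonglongrightarrow> (0::real)"
        by (rule tendsto_eventually, rule eventually_mono[OF assms(2)[OF \<open>x \<in> space M\<close> \<open>0 < \<epsilon>\<close>]])
           (auto simp: indicator_def)
    qed
  qed (auto simp: indicator_def)
  then show "(\<lambda>k. prob (?A k)) \<longlonglongrightarrow> 0" by simp
qed

lemma to_zero_in_prob_L2:
  fixes Z :: "nat \<Rightarrow> 'a \<Rightarrow> real"
  assumes [measurable]: "\<And>k. Z k \<in> borel_measurable M"
    and int: "\<And>k. integrable M (\<lambda>\<omega>. (Z k \<omega>)\<^sup>2)"
    and lim: "(\<lambda>k. expectation (\<lambda>\<omega>. (Z k \<omega>)\<^sup>2)) \<longlonglongrightarrow> 0"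
  shows "to_zero_in_prob M (\<lambda>k \<omega>. ennreal \<bar>Z k \<omega>\<bar>)"
  unfolding to_zero_in_prob_def
proof safe
  show "(\<lambda>\<omega>. ennreal \<bar>Z k \<omega>\<bar>) \<in> borel_measurable M" for k by measurable
  fix \<epsilon> :: real assume e: "0 < \<epsilon>"
  have "(\<lambda>k. expectation (\<lambda>\<omega>. (Z k \<omega>)\<^sup>2) / \<epsilon>\<^sup>2) \<longlonglongrightarrow> 0 / \<epsilon>\<^sup>2"
    by (intro tendsto_divide lim) (use e in auto)
  then have "(\<lambda>k. expectation (\<lambda>\<omega>. (Z k \<omega>)\<^sup>2) / \<epsilon>\<^sup>2) \<longlonglongrightarrow> 0" by simp
  then show "(\<lambda>k. prob {\<omega> \<in> space M. ennreal \<epsilon> < ennreal \<bar>Z k \<omega>\<bar>}) \<longlonglongrightarrow> 0"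
  proof (rule Lim_null_comparison[rotated], intro always_eventually allI)
    fix k
    have "prob {\<omega> \<in> space M. ennreal \<epsilon> < ennreal \<bar>Z k \<omega>\<bar>} \<le> prob {\<omega> \<in> space M. \<epsilon>\<^sup>2 \<le> (Z k \<omega>)\<^sup>2}"
      using e by (intro finite_measure_mono) (auto simp: ennreal_less_iff abs_le_square_iff[symmetric])
    also have "\<dots> \<le> expectation (\<lambda>\<omega>. (Z k \<omega>)\<^sup>2) / \<epsilon>\<^sup>2"
      using e by (intro integral_Markov_inequality_measure[OF int, of "space M"]) auto
    finally show "norm (prob {\<omega> \<in> space M. ennreal \<epsilon> < ennreal \<bar>Z k \<omega>\<bar>})
      \<le> expectation (\<lambda>\<omega>. (Z k \<omega>)\<^sup>2) / \<epsilon>\<^sup>2" by simp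
  qed
qed

end

section \<open>Riemann sums of the Ito integral\<close>

text \<open>The \<open>j\<close>-th point of the uniform partition of \<open>[a, b]\<close> into \<open>k + 1\<close> pieces; the shift by one avoids an
  empty partition.\<close>

definition grid :: "real \<Rightarrow> real \<Rightarrow> nat \<Rightarrow> nat \<Rightarrow> real" where
  "grid a b k j = a + (b - a) * (real j / real (Suc k))"

lemma grid_0 [simp]: "grid a b k 0 = a"
  by (simp add: grid_def)

lemma grid_end [simp]: "grid a b k (Suc k) = b"
proof -
  have "real (Suc k) / real (Suc k) = 1" by (intro divide_self) simp
  then show ?thesis unfolding grid_def by simp
qed

lemma grid_diff: "grid a b k (Suc j) - grid a b k j = (b - a) / real (Suc k)"
proof -
  have "real (Suc j) / real (Suc k) - real j / real (Suc k) = 1 / real (Suc k)"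
    by (simp add: diff_divide_distrib[symmetric])
  then show ?thesis
    unfolding grid_def add_diff_add diff_self right_diff_distrib[symmetric] by simp
qed

lemma grid_mono: "a \<le> b \<Longrightarrow> i \<le> j \<Longrightarrow> grid a b k i \<le> grid a b k j"
  unfolding grid_def by (intro add_left_mono mult_left_mono divide_right_mono) auto

lemma grid_bounds: "a \<le> b \<Longrightarrow> j \<le> Suc k \<Longrightarrow> grid a b k j \<in> {a..b}"
  using grid_mono[of a b 0 j k] grid_mono[of a b j "Suc k" k] by auto

lemma step_value_eq:
  assumes mono: "\<And>i j. i \<le> j \<Longrightarrow> j \<le> n \<Longrightarrow> p i \<le> p j"
    and j: "j < n" "p j \<le> s" "s < p (Suc j)"
  shows "step_value n p \<xi> s \<omega> = \<xi> j \<omega>"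
proof -
  have "\<xi> i \<omega> * indicator {p i..<p (Suc i)} s = (if i = j then \<xi> j \<omega> else 0)" if "i < n" for i
  proof (cases i j rule: linorder_cases)
    case less
    then have "p (Suc i) \<le> p j" using mono j by auto
    then show ?thesis using j less by auto
  next
    case greater
    then have "p (Suc j) \<le> p i" using mono that by auto
    then show ?thesis using j greater by auto
  qed (use j in auto)
  then have "step_value n p \<xi> s \<omega> = (\<Sum>i<n. if i = j then \<xi> j \<omega> else 0)"
    unfolding step_value_def by (intro sum.cong) auto
  then show ?thesis using j by simp
qed

lemma partition_interval:
  fixes p :: "nat \<Rightarrow> real"
  assumes "p 0 \<le> s" "s < p n"
  obtains j where "j < n" "p j \<le> s" "s < p (Suc j)"
proof -
  define j where "j = (LEAST j. s < p j)"
  have j: "s < p j" unfolding j_def by (rule LeastI) (fact assms(2))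
  with assms obtain i where i: "j = Suc i" by (cases j) auto
  have "j \<le> n" unfolding j_def by (rule Least_le) (fact assms(2))
  moreover have "\<not> s < p i" using i not_less_Least[of i "\<lambda>j. s < p j"] by (auto simp: j_def)
  ultimately show ?thesis using that[of i] i j by auto
qed

lemma continuous_grid_oscillation:
  fixes f :: "real \<Rightarrow> real"
  assumes "continuous_on {a..b} f" "a \<le> b" "0 < e"
  shows "eventually (\<lambda>k. \<forall>j<Suc k. \<forall>s\<in>{grid a b k j..grid a b k (Suc j)}.
    \<bar>f s - f (grid a b k j)\<bar> \<le> e) sequentially"
proof -
  have "uniformly_continuous_on {a..b} f"
    using assms by (auto intro: compact_uniformly_continuous)
  then obtain d where d: "d > 0" "\<And>x y. x \<in> {a..b} \<Longrightarrow> y \<in> {a..b} \<Longrightarrow> dist y x < d \<Longrightarrow> dist (f y) (f x) < e"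
    using assms(3) unfolding uniformly_continuous_on_def by metis
  have "(\<lambda>k. (b - a) / real (Suc k)) \<longlonglongrightarrow> 0"
    using LIMSEQ_inverse_real_of_nat by (auto intro!: tendsto_mult_right_zero simp: divide_inverse)
  then have "eventually (\<lambda>k. (b - a) / real (Suc k) < d) sequentially"
    using d(1) by (rule order_tendstoD)
  then show ?thesis
  proof eventually_elim
    case (elim k)
    show ?case
    proof safe
      fix j s assume j: "j < Suc k" and s: "s \<in> {grid a b k j..grid a b k (Suc j)}"
      have "grid a b k j \<in> {a..b}" "grid a b k (Suc j) \<in> {a..b}"
        using j assms by (auto intro!: grid_bounds simp del: atLeastAtMost_iff)
      moreover have "s - grid a b k j < d"
        using s elim grid_diff[of a b k j] by auto
      ultimately have "dist (f s) (f (grid a b k j)) < e"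
        using s by (intro d(2)) (auto simp: dist_real_def)
      then show "\<bar>f s - f (grid a b k j)\<bar> \<le> e" by (simp add: dist_real_def)
    qed
  qed
qed

lemma riemann_sum_tendsto:
  fixes f :: "real \<Rightarrow> real"
  assumes f: "continuous_on {a..b} f" and ab: "a \<le> b"
  shows "(\<lambda>k. \<Sum>j<Suc k. f (grid a b k j) * ((b - a) / real (Suc k))) \<longlonglongrightarrow> integral {a..b} f"
proof (rule LIMSEQ_I)
  fix r :: real assume r: "0 < r"
  define e where "e = r / (2 * (b - a + 1))"
  have e: "e > 0" using r ab by (auto simp: e_def)
  have "eventually (\<lambda>k. norm ((\<Sum>j<Suc k. f (grid a b k j) * ((b - a) / real (Suc k))) - integral {a..b} f) < r) sequentially"
    using continuous_grid_oscillation[OF f ab e]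
  proof eventually_elim
    case (elim k)
    let ?h = "(b - a) / real (Suc k)"
    have h: "?h \<ge> 0" using ab by auto
    have "m \<le> Suc k \<Longrightarrow> \<bar>(\<Sum>j<m. f (grid a b k j) * ?h) - integral {a..grid a b k m} f\<bar> \<le> e * ?h * real m" for m
    proof (induction m)
      case 0 then show ?case by simp
    next
      case (Suc m)
      let ?p = "grid a b k m" and ?q = "grid a b k (Suc m)"
      have pq: "a \<le> ?p" "?p \<le> ?q" "?q \<le> b"
        using grid_bounds[OF ab, of m k] grid_bounds[OF ab, of "Suc m" k] Suc.prems
          grid_mono[OF ab, of m "Suc m" k] by auto
      have int: "f integrable_on {a..?q}" "f integrable_on {?p..?q}"
        using pq by (auto intro!: integrable_continuous_real continuous_on_subset[OF f])
      have "integral {a..?p} f + integral {?p..?q} f = integral {a..?q} f"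
        using pq by (intro Henstock_Kurzweil_Integration.integral_combine int) auto
      moreover have "\<bar>f ?p * ?h - integral {?p..?q} f\<bar> \<le> e * ?h"
      proof -
        have c: "((\<lambda>s. f ?p) has_integral f ?p * ?h) {?p..?q}"
          using has_integral_const_real[of "f ?p" ?p ?q] pq(2) grid_diff[of a b k m]
          by (simp add: mult.commute)
        have "((\<lambda>s. f ?p - f s) has_integral (f ?p * ?h - integral {?p..?q} f)) {?p..?q}"
          by (intro has_integral_diff c integrable_integral int)
        then have "norm (f ?p * ?h - integral {?p..?q} f) \<le> e * measure lborel (cbox ?p ?q)"
          unfolding cbox_interval[symmetric]
        proof (rule has_integral_bound[rotated])
          show "norm (f ?p - f x) \<le> e" if "x \<in> cbox ?p ?q" for x
            using elim Suc.prems that by (auto simp: abs_minus_commute)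
        qed (use e in auto)
        then show ?thesis using pq(2) grid_diff[of a b k m] by simp
      qed
      ultimately have "\<bar>(\<Sum>j<Suc m. f (grid a b k j) * ?h) - integral {a..?q} f\<bar> \<le> e * ?h * real m + e * ?h"
        using Suc by simp
      also have "\<dots> = e * ?h * real (Suc m)" by (simp add: distrib_left)
      finally show ?case .
    qed
    from this[of "Suc k"]
    have "\<bar>(\<Sum>j<Suc k. f (grid a b k j) * ?h) - integral {a..b} f\<bar> \<le> e * (b - a)"
      by (simp del: of_nat_Suc sum.lessThan_Suc)
    also have "\<dots> < r"
    proof -
      have "r * (b - a) < r * (2 * (b - a + 1))" using r ab by (intro mult_strict_left_mono) auto
      then show ?thesis using ab by (simp add: e_def divide_less_eq)
    qed
    finally show ?case by (simp only: real_norm_def)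
  qed
  then show "\<exists>no. \<forall>k\<ge>no. norm ((\<Sum>j<Suc k. f (grid a b k j) * ((b - a) / real (Suc k))) - integral {a..b} f) < r"
    by (simp only: eventually_sequentially)
qed

lemma grid_step_value_bound:
  assumes "a \<le> b" "s \<in> {a..<b}"
    and osc: "\<forall>j<Suc k. \<forall>s\<in>{grid a b k j..grid a b k (Suc j)}. \<bar>H s \<omega> - H (grid a b k j) \<omega>\<bar> \<le> e"
  shows "\<bar>step_value (Suc k) (grid a b k) (\<lambda>j. H (grid a b k j)) s \<omega> - H s \<omega>\<bar> \<le> e"
proof -
  obtain j where j: "j < Suc k" "grid a b k j \<le> s" "s < grid a b k (Suc j)"
    using assms partition_interval[of "grid a b k" s "Suc k"] by auto
  have "step_value (Suc k) (grid a b k) (\<lambda>j. H (grid a b k j)) s \<omega> = H (grid a b k j) \<omega>"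
    using j assms by (intro step_value_eq grid_mono) auto
  then show ?thesis using osc j by (auto simp: abs_minus_commute)
qed

lemma step_value_end:
  assumes "a \<le> b"
  shows "step_value (Suc k) (grid a b k) \<xi> b \<omega> = 0"
  unfolding step_value_def
proof (intro sum.neutral ballI)
  fix i assume "i \<in> {..<Suc k}"
  then have "grid a b k (Suc i) \<le> b" using assms grid_bounds[of a b "Suc i" k] by auto
  then show "\<xi> i \<omega> * indicator {grid a b k i..<grid a b k (Suc i)} b = 0" by auto
qed

lemma continuous_process_jointly_measurable:
  fixes X :: "real \<Rightarrow> 'a \<Rightarrow> real"
  assumes ab: "a \<le> b" and X: "\<And>t. t \<in> {a..b} \<Longrightarrow> X t \<in> borel_measurable M"
    and cont: "\<And>\<omega>. \<omega> \<in> space M \<Longrightarrow> continuous_on {a..b} (\<lambda>t. X t \<omega>)"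
  shows "(\<lambda>(t, \<omega>). X t \<omega>) \<in> borel_measurable (restrict_space borel {a..b} \<Otimes>\<^sub>M M)"
proof (rule borel_measurable_LIMSEQ_real)
  let ?f = "\<lambda>k (t, \<omega>). step_value (Suc k) (grid a b k) (\<lambda>j. X (grid a b k j)) t \<omega> + X b \<omega> * indicator {b} t"
  show "?f k \<in> borel_measurable (restrict_space borel {a..b} \<Otimes>\<^sub>M M)" for k
  proof -
    have [measurable]: "X (grid a b k j) \<in> borel_measurable M" if "j \<in> {..<Suc k}" for j
      using that grid_bounds[OF ab, of j k] by (intro X) auto
    have [measurable]: "X b \<in> borel_measurable M" using ab by (intro X) auto
    have [measurable]: "(\<lambda>t. t) \<in> measurable (restrict_space borel {a..b}) (borel :: real measure)"
      by (rule measurable_restrict_space1) simp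
    have [measurable]: "fst \<in> measurable (restrict_space borel {a..b} \<Otimes>\<^sub>M M) (borel :: real measure)"
      by (rule measurable_compose[OF measurable_fst]) simp
    show ?thesis
      unfolding step_value_def split_beta by (intro borel_measurable_add borel_measurable_sum borel_measurable_times) auto
  qed
  fix z assume "z \<in> space (restrict_space borel {a..b} \<Otimes>\<^sub>M M)"
  then obtain t \<omega> where z: "z = (t, \<omega>)" "t \<in> {a..b}" "\<omega> \<in> space M"
    by (auto simp: space_pair_measure)
  show "(\<lambda>k. ?f k z) \<longlonglongrightarrow> (case z of (t, \<omega>) \<Rightarrow> X t \<omega>)"
  proof (cases "t = b")
    case True
    then show ?thesis by (simp add: z step_value_end[OF ab])
  next
    case False
    then have t: "t \<in> {a..<b}" using z by auto
    show ?thesis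
    proof (rule tendstoI)
      fix e :: real assume "0 < e"
      then have "0 < e / 2" by simp
      from continuous_grid_oscillation[OF cont[OF z(3)] ab this]
      show "\<forall>\<^sub>F k in sequentially. dist (?f k z) (case z of (t, \<omega>) \<Rightarrow> X t \<omega>) < e"
      proof eventually_elim
        case (elim k)
        have "\<bar>step_value (Suc k) (grid a b k) (\<lambda>j. X (grid a b k j)) t \<omega> - X t \<omega>\<bar> \<le> e / 2"
          using ab t elim by (rule grid_step_value_bound)
        then show ?case using False \<open>0 < e\<close> by (simp add: z dist_real_def)
      qed
    qed
  qed
qed

lemma telescoping_interval:
  fixes r :: "nat \<Rightarrow> real" and w :: "real \<Rightarrow> real"
  assumes mono: "\<And>i j. i < j \<Longrightarrow> j \<le> N \<Longrightarrow> r i < r j" and kl: "k \<le> l" "l \<le> N"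
  shows "(\<Sum>j<N. indicator {r k..<r l} (r j) * (w (r (Suc j)) - w (r j))) = w (r l) - w (r k)"
proof -
  have le: "r i \<le> r j \<longleftrightarrow> i \<le> j" if "i \<le> N" "j \<le> N" for i j
    using mono[of i j] mono[of j i] that by (cases i j rule: linorder_cases) (auto simp: not_le)
  have "(\<Sum>j<N. indicator {r k..<r l} (r j) * (w (r (Suc j)) - w (r j)))
     = (\<Sum>j<N. if j \<in> {k..<l} then w (r (Suc j)) - w (r j) else 0)"
    using le kl by (intro sum.cong) (auto simp: indicator_def not_le[symmetric])
  also have "\<dots> = (\<Sum>j\<in>{..<N} \<inter> {k..<l}. w (r (Suc j)) - w (r j))"
    by (simp add: sum.inter_restrict)
  also have "{..<N} \<inter> {k..<l} = {k..<l}" using kl by auto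
  also have "(\<Sum>j\<in>{k..<l}. w (r (Suc j)) - w (r j)) = w (r l) - w (r k)"
    using kl by (intro sum_Suc_diff')
  finally show ?thesis .
qed

text \<open>Two step processes are compared on a common refinement of their partitions, enumerated strictly
  increasingly.\<close>

lemma common_partition:
  fixes R :: "real set"
  assumes "finite R" "R \<noteq> {}"
  shows "\<exists>(r :: nat \<Rightarrow> real) N. (\<forall>i j. i < j \<longrightarrow> j \<le> N \<longrightarrow> r i < r j) \<and> r ` {..N} = R"
proof -
  define xs where "xs = sorted_list_of_set R"
  have xs: "set xs = R" "sorted_wrt (<) xs" "xs \<noteq> []"
    using assms by (auto simp: xs_def)
  have "{..length xs - 1} = {..<length xs}" using xs(3) by (cases xs) auto
  then have 1: "(\<lambda>i. xs ! i) ` {..length xs - 1} = R"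
    using xs(1) by (auto simp: set_conv_nth)
  have 2: "xs ! i < xs ! j" if "i < j" "j \<le> length xs - 1" for i j
  proof -
    have "length xs > 0" using xs(3) by simp
    then have "j < length xs" using that by linarith
    then show ?thesis using sorted_wrt_nth_less[OF xs(2) that(1)] by simp
  qed
  show ?thesis
    by (intro exI[of _ "\<lambda>i. xs ! i"] exI[of _ "length xs - 1"] conjI allI impI 1 2)
qed

lemma step_value_refine:
  fixes r :: "nat \<Rightarrow> real"
  assumes mono: "\<And>i j. i < j \<Longrightarrow> j \<le> N \<Longrightarrow> r i < r j"
    and sub: "p ` {..n} \<subseteq> r ` {..N}" and j: "j < N" "r j \<le> s" "s < r (Suc j)"
  shows "step_value n p \<xi> s \<omega> = step_value n p \<xi> (r j) \<omega>"
proof -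
  have eq: "p i \<le> s \<longleftrightarrow> p i \<le> r j" if i: "i \<le> n" for i
  proof -
    from sub i have "p i \<in> r ` {..N}" by auto
    then obtain m where m: "m \<le> N" "p i = r m" by auto
    show ?thesis
    proof
      assume "p i \<le> s"
      then have "r m < r (Suc j)" using m j by auto
      then have "m < Suc j" using mono[of "Suc j" m] m by (cases m "Suc j" rule: linorder_cases) auto
      then show "p i \<le> r j" using mono[of m j] m j by (cases m j rule: linorder_cases) auto
    qed (use j in auto)
  qed
  show ?thesis
    unfolding step_value_def
  proof (intro sum.cong refl)
    fix i assume "i \<in> {..<n}"
    then show "\<xi> i \<omega> * indicator {p i..<p (Suc i)} s = \<xi> i \<omega> * indicator {p i..<p (Suc i)} (r j)"
      using eq[of i] eq[of "Suc i"] by (auto simp: indicator_def not_le[symmetric])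
  qed
qed

lemma step_integral_refine:
  fixes r :: "nat \<Rightarrow> real"
  assumes mono: "\<And>i j. i < j \<Longrightarrow> j \<le> N \<Longrightarrow> r i < r j"
    and sub: "p ` {..n} \<subseteq> r ` {..N}" and p: "\<And>i. i < n \<Longrightarrow> p i \<le> p (Suc i)"
  shows "step_integral W n p \<xi> \<omega>
    = (\<Sum>j<N. step_value n p \<xi> (r j) \<omega> * (W (r (Suc j)) \<omega> - W (r j) \<omega>))"
proof -
  have "\<xi> i \<omega> * (W (p (Suc i)) \<omega> - W (p i) \<omega>)
     = (\<Sum>j<N. \<xi> i \<omega> * indicator {p i..<p (Suc i)} (r j) * (W (r (Suc j)) \<omega> - W (r j) \<omega>))" if i: "i < n" for i
  proof -
    have "p i \<in> r ` {..N}" "p (Suc i) \<in> r ` {..N}" using sub i by auto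
    then obtain k l where kl: "k \<le> N" "l \<le> N" "p i = r k" "p (Suc i) = r l" by auto
    have "k \<le> l" using mono[of l k] kl p[OF i] by (cases k l rule: linorder_cases) auto
    then have "W (p (Suc i)) \<omega> - W (p i) \<omega>
      = (\<Sum>j<N. indicator {p i..<p (Suc i)} (r j) * (W (r (Suc j)) \<omega> - W (r j) \<omega>))"
      unfolding kl using telescoping_interval[where r = r and N = N and k = k and l = l and w = "\<lambda>s. W s \<omega>", OF mono] kl by simp
    then show ?thesis by (simp only: sum_distrib_left mult.assoc)
  qed
  then have "step_integral W n p \<xi> \<omega>
     = (\<Sum>i<n. \<Sum>j<N. \<xi> i \<omega> * indicator {p i..<p (Suc i)} (r j) * (W (r (Suc j)) \<omega> - W (r j) \<omega>))"
    unfolding step_integral_def by (intro sum.cong) auto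
  then show ?thesis
    unfolding step_value_def sum_distrib_right by (subst (asm) sum.swap)
qed

context prob_space
begin

lemma grid_step_approximation:
  assumes ab: "a \<le> b" and H: "\<And>t. t \<in> {a..b} \<Longrightarrow> H t \<in> borel_measurable M"
    and HM: "(\<lambda>(t, \<omega>). H t \<omega>) \<in> borel_measurable (restrict_space borel {a..b} \<Otimes>\<^sub>M M)"
    and cont: "\<And>\<omega>. \<omega> \<in> space M \<Longrightarrow> continuous_on {a..b} (\<lambda>t. H t \<omega>)"
  shows "to_zero_in_prob M (\<lambda>k \<omega>. \<integral>\<^sup>+ s \<in> {a..b}.
    ennreal ((step_value (Suc k) (grid a b k) (\<lambda>j. H (grid a b k j)) s \<omega> - H s \<omega>)\<^sup>2) \<partial>lborel)"
proof (rule to_zero_in_prob_pointwise)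
  fix k
  define c where "c t = max a (min b t)" for t
  have c: "c \<in> measurable borel (restrict_space borel {a..b})"
    unfolding c_def[abs_def] using ab by (intro measurable_restrict_space2) auto
  have "(\<lambda>(t, \<omega>). (c t, \<omega>)) \<in> measurable (borel \<Otimes>\<^sub>M M) (restrict_space borel {a..b} \<Otimes>\<^sub>M M)"
    unfolding split_beta by (intro measurable_Pair measurable_compose[OF measurable_fst c]) auto
  from measurable_compose[OF this HM]
  have Hc[measurable]: "(\<lambda>z. H (c (fst z)) (snd z)) \<in> borel_measurable (borel \<Otimes>\<^sub>M M)"
    by (simp add: split_beta)
  have [measurable]: "H (grid a b k j) \<in> borel_measurable M" if "j \<in> {..<Suc k}" for j
    using that grid_bounds[OF ab, of j k] by (intro H) auto
  have [measurable]: "(\<lambda>z. step_value (Suc k) (grid a b k) (\<lambda>j. H (grid a b k j)) (fst z) (snd z))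
    \<in> borel_measurable (borel \<Otimes>\<^sub>M M)"
    unfolding step_value_def by (intro borel_measurable_sum borel_measurable_times) auto
  let ?f = "\<lambda>s \<omega>. ennreal ((step_value (Suc k) (grid a b k) (\<lambda>j. H (grid a b k j)) s \<omega> - H (c s) \<omega>)\<^sup>2) * indicator {a..b} s"
  have "(\<lambda>\<omega>. \<integral>\<^sup>+ s. ?f s \<omega> \<partial>lborel) \<in> borel_measurable M"
  proof (rule lborel.borel_measurable_nn_integral)
    have "(\<lambda>z. ?f (fst z) (snd z)) \<in> borel_measurable (borel \<Otimes>\<^sub>M M)" by measurable
    from measurable_pair_swap[OF this]
    show "(\<lambda>(\<omega>, s). ?f s \<omega>) \<in> borel_measurable (M \<Otimes>\<^sub>M lborel)"
      by (simp only: fst_conv snd_conv measurable_lborel1 sets_lborel cong: measurable_cong_sets sets_pair_measure_cong)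
  qed
  also have "(\<lambda>\<omega>. \<integral>\<^sup>+ s. ?f s \<omega> \<partial>lborel) = (\<lambda>\<omega>. \<integral>\<^sup>+ s \<in> {a..b}.
    ennreal ((step_value (Suc k) (grid a b k) (\<lambda>j. H (grid a b k j)) s \<omega> - H s \<omega>)\<^sup>2) \<partial>lborel)"
    by (intro ext nn_integral_cong) (auto simp: c_def indicator_def)
  finally show "(\<lambda>\<omega>. \<integral>\<^sup>+ s \<in> {a..b}.
    ennreal ((step_value (Suc k) (grid a b k) (\<lambda>j. H (grid a b k j)) s \<omega> - H s \<omega>)\<^sup>2) \<partial>lborel) \<in> borel_measurable M" .
next
  fix \<omega> \<epsilon> assume \<omega>: "\<omega> \<in> space M" and \<epsilon>: "(0::real) < \<epsilon>"
  define e where "e = sqrt (\<epsilon> / (b - a + 1))"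
  have e: "0 < e" "e\<^sup>2 = \<epsilon> / (b - a + 1)" using \<epsilon> ab by (auto simp: e_def)
  show "\<forall>\<^sub>F k in sequentially. (\<integral>\<^sup>+ s \<in> {a..b}.
    ennreal ((step_value (Suc k) (grid a b k) (\<lambda>j. H (grid a b k j)) s \<omega> - H s \<omega>)\<^sup>2) \<partial>lborel) \<le> ennreal \<epsilon>"
    using continuous_grid_oscillation[OF cont[OF \<omega>] ab e(1)]
  proof eventually_elim
    case (elim k)
    let ?f = "\<lambda>s. ennreal ((step_value (Suc k) (grid a b k) (\<lambda>j. H (grid a b k j)) s \<omega> - H s \<omega>)\<^sup>2)"
    have "(\<integral>\<^sup>+ s \<in> {a..b}. ?f s \<partial>lborel) = (\<integral>\<^sup>+ s \<in> {a..<b}. ?f s \<partial>lborel)"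
      by (intro nn_integral_cong_AE eventually_mono[OF AE_lborel_singleton[of b]]) 
        (auto simp: indicator_def)
    also have "\<dots> \<le> (\<integral>\<^sup>+ s. ennreal (e\<^sup>2) * indicator {a..<b} s \<partial>lborel)"
    proof (intro nn_integral_mono)
      fix s
      have "?f s \<le> ennreal (e\<^sup>2)" if "s \<in> {a..<b}"
        using grid_step_value_bound[where H = H and \<omega> = \<omega>, OF ab that elim] e(1)
        by (intro ennreal_leI) (simp add: abs_le_square_iff[symmetric])
      then show "?f s * indicator {a..<b} s \<le> ennreal (e\<^sup>2) * indicator {a..<b} s"
        by (auto simp: indicator_def)
    qed
    also have "\<dots> = ennreal (e\<^sup>2 * (b - a))"
      using ab by (simp add: nn_integral_cmult_indicator ennreal_mult)
    also have "\<dots> \<le> ennreal \<epsilon>"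
      using ab \<epsilon> by (intro ennreal_leI) (simp add: e(2) field_simps)
    finally show ?case .
  qed
qed

end

context brownian_motion
begin

lemma step_value_measurable_F:
  assumes "step_process F a b n p \<xi>"
  shows "step_value n p \<xi> s \<in> borel_measurable (F s)"
proof -
  have "(\<lambda>\<omega>. \<xi> i \<omega> * indicator {p i..<p (Suc i)} s) \<in> borel_measurable (F s)" if "i < n" for i
  proof (cases "p i \<le> s")
    case True
    have "\<xi> i \<in> borel_measurable (F (p i))" using assms that by (simp add: step_process_def)
    then have "\<xi> i \<in> borel_measurable (F s)" using True by (rule measurable_F_mono)
    then show ?thesis by (rule borel_measurable_times) (rule borel_measurable_const)
  next
    case False
    then have "(\<lambda>\<omega>. \<xi> i \<omega> * indicator {p i..<p (Suc i)} s) = (\<lambda>\<omega>. 0)" by auto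
    then show ?thesis by simp
  qed
  then show ?thesis
    unfolding step_value_def[abs_def] by (intro borel_measurable_sum) (simp only: lessThan_iff)
qed

lemma step_process_mono:
  assumes "step_process F a b n p \<xi>" "i \<le> j" "j \<le> n"
  shows "p i \<le> p j"
  using assms(2,3)
proof (induction j rule: dec_induct)
  case (step m)
  then have "p i \<le> p m" "p m \<le> p (Suc m)" using assms(1) by (auto simp: step_process_def)
  then show ?case by (rule order_trans)
qed simp

lemma step_process_bounds:
  assumes "step_process F a b n p \<xi>" "i \<le> n"
  shows "a \<le> p i" "p i \<le> b"
  using step_process_mono[OF assms(1), of 0 i] step_process_mono[OF assms(1), of i n] assms
  by (auto simp: step_process_def)

lemma step_integral_measurable:
  assumes "step_process F a b n p \<xi>" "0 \<le> a"
  shows "step_integral W n p \<xi> \<in> borel_measurable M"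
  unfolding step_integral_def[abs_def]
proof (intro borel_measurable_sum borel_measurable_times borel_measurable_diff)
  fix i assume "i \<in> {..<n}"
  then have i: "i < n" by auto
  then show "\<xi> i \<in> borel_measurable M"
    using assms measurable_F_M[of "\<xi> i" "p i" borel] by (auto simp: step_process_def)
  show "W (p (Suc i)) \<in> borel_measurable M" "W (p i) \<in> borel_measurable M"
    using i step_process_bounds[OF assms(1)] assms(2) 
    by (auto intro!: W_measurable_M intro: order_trans)
qed

text \<open>The localised Ito isometry: truncating the sum when its quadratic variation exceeds
  \<open>\<delta>\<close> changes nothing off the event that the total quadratic variation exceeds \<open>\<delta>\<close>.\<close>

lemma elementary_integral_tail:
  fixes p :: "nat \<Rightarrow> real"
  assumes p0: "0 \<le> p 0" and mono: "\<And>i. i < n \<Longrightarrow> p i < p (Suc i)"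
    and \<xi>: "\<And>i. i < n \<Longrightarrow> \<xi> i \<in> borel_measurable (F (p i))"
    and \<delta>: "0 < \<delta>" and \<epsilon>: "0 < \<epsilon>"
  shows "prob {\<omega> \<in> space M. \<epsilon> < \<bar>\<Sum>i<n. \<xi> i \<omega> * (W (p (Suc i)) \<omega> - W (p i) \<omega>)\<bar>}
    \<le> \<delta> / \<epsilon>\<^sup>2 + prob {\<omega> \<in> space M. \<delta> < (\<Sum>i<n. (\<xi> i \<omega>)\<^sup>2 * (p (Suc i) - p i))}"
proof -
  have pm: "i \<le> j \<Longrightarrow> j \<le> n \<Longrightarrow> p i \<le> p j" for i j
  proof (induction j rule: dec_induct)
    case (step m) then show ?case using mono[of m] by simp
  qed simp
  have pos: "0 \<le> p i" if "i \<le> n" for i using pm[of 0 i] p0 that by auto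
  have pd: "0 \<le> p (Suc i) - p i" if "i < n" for i using mono[OF that] by simp
  define Z where "Z m \<omega> = (\<Sum>i<m. (\<xi> i \<omega>)\<^sup>2 * (p (Suc i) - p i))" for m \<omega>
  have Z_mono: "Z i \<omega> \<le> Z j \<omega>" if "i \<le> j" "j \<le> n" for i j \<omega>
    unfolding Z_def using that by (intro sum_mono2) (auto intro!: mult_nonneg_nonneg pd)
  define \<theta> where "\<theta> i \<omega> = (if Z (Suc i) \<omega> \<le> \<delta> then \<xi> i \<omega> else 0)" for i \<omega>
  define \<eta> where "\<eta> i \<omega> = W (p (Suc i)) \<omega> - W (p i) \<omega>" for i \<omega>
  have Z_meas: "Z m \<in> borel_measurable (F (p i))" if "m \<le> Suc i" "i < n" for m i
    unfolding Z_def[abs_def]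
  proof (intro borel_measurable_sum borel_measurable_times borel_measurable_power)
    fix j assume "j \<in> {..<m}"
    then show "\<xi> j \<in> borel_measurable (F (p i))"
      using that by (intro measurable_F_mono[OF \<xi>[of j]] pm) auto
  qed auto
  have \<theta>_meas: "\<theta> i \<in> borel_measurable (F (p i))" if "i < n" for i
  proof -
    note [measurable] = \<xi>[OF that] Z_meas[OF order_refl that]
    show ?thesis unfolding \<theta>_def[abs_def] by measurable
  qed
  have "(\<Sum>i<m. (\<theta> i \<omega>)\<^sup>2 * (p (Suc i) - p i)) \<le> \<delta>" if "m \<le> n" for m \<omega>
    using that
  proof (induction m)
    case 0 then show ?case using \<delta> by simp
  next
    case (Suc m)
    show ?case
    proof (cases "Z (Suc m) \<omega> \<le> \<delta>")
      case True
      have "(\<Sum>i<Suc m. (\<theta> i \<omega>)\<^sup>2 * (p (Suc i) - p i)) \<le> Z (Suc m) \<omega>"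
        unfolding Z_def using Suc.prems
        by (intro sum_mono mult_right_mono pd) (auto simp: \<theta>_def)
      then show ?thesis using True by simp
    next
      case False
      then show ?thesis using Suc by (simp add: \<theta>_def)
    qed
  qed
  then have \<theta>_le: "(\<Sum>i<n. (\<theta> i \<omega>)\<^sup>2 * (p (Suc i) - p i)) \<le> \<delta>" for \<omega> by simp
  have \<theta>_int: "integrable M (\<lambda>\<omega>. (\<theta> i \<omega>)\<^sup>2)" if "i < n" for i
  proof (rule integrable_const_bound)
    show "AE \<omega> in M. norm ((\<theta> i \<omega>)\<^sup>2) \<le> \<delta> / (p (Suc i) - p i)"
    proof (rule AE_I2)
      fix \<omega>
      have "(\<theta> i \<omega>)\<^sup>2 * (p (Suc i) - p i) \<le> (\<Sum>i<n. (\<theta> i \<omega>)\<^sup>2 * (p (Suc i) - p i))"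
        using that by (intro member_le_sum) (auto intro!: mult_nonneg_nonneg pd)
      also have "\<dots> \<le> \<delta>" by (rule \<theta>_le)
      finally show "norm ((\<theta> i \<omega>)\<^sup>2) \<le> \<delta> / (p (Suc i) - p i)"
        using mono[OF that] by (simp add: pos_le_divide_eq)
    qed
  qed (use measurable_F_M[OF \<theta>_meas[OF that]] in measurable)
  have os: "integrable M (\<lambda>\<omega>. (\<Sum>i<n. \<theta> i \<omega> * \<eta> i \<omega>)\<^sup>2) \<and>
    (\<lambda>\<omega>. \<Sum>i<n. \<theta> i \<omega> * \<eta> i \<omega>) \<in> borel_measurable (F (p n)) \<and>
    expectation (\<lambda>\<omega>. (\<Sum>i<n. \<theta> i \<omega> * \<eta> i \<omega>)\<^sup>2)
      = (\<Sum>i<n. expectation (\<lambda>\<omega>. (\<theta> i \<omega>)\<^sup>2) * expectation (\<lambda>\<omega>. (\<eta> i \<omega>)\<^sup>2))"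
  proof (rule orthogonal_sum)
    fix i assume i: "i < n"
    then have i': "0 \<le> p i" "p i \<le> p (Suc i)" using pos[of i] pd[OF i] by auto
    show "p i \<le> p (Suc i)" by fact
    show "\<theta> i \<in> borel_measurable (F (p i))" "integrable M (\<lambda>\<omega>. (\<theta> i \<omega>)\<^sup>2)"
      using \<theta>_meas \<theta>_int i by auto
    have [measurable]: "W (p (Suc i)) \<in> borel_measurable (F (p (Suc i)))"
      "W (p i) \<in> borel_measurable (F (p (Suc i)))"
      using i' by (auto intro!: W_measurable_F)
    show "\<eta> i \<in> borel_measurable (F (p (Suc i)))" unfolding \<eta>_def[abs_def] by measurable
    show "integrable M (\<lambda>\<omega>. (\<eta> i \<omega>)\<^sup>2)" "expectation (\<eta> i) = 0"
      unfolding \<eta>_def[abs_def] using increment_moments[OF i'] by auto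
    show "indep_var borel U borel (\<eta> i)" if "U \<in> borel_measurable (F (p i))" for U
      unfolding \<eta>_def[abs_def] using increment_indep[OF i' that] .
  qed
  have [measurable]: "(\<lambda>\<omega>. \<Sum>i<n. \<theta> i \<omega> * \<eta> i \<omega>) \<in> borel_measurable M"
    using os measurable_F_M by blast
  have [measurable]: "Z n \<in> borel_measurable M"
    unfolding Z_def[abs_def] 
    by (intro borel_measurable_sum borel_measurable_times borel_measurable_power)
      (auto intro: measurable_F_M[OF \<xi>])
  have "expectation (\<lambda>\<omega>. (\<Sum>i<n. \<theta> i \<omega> * \<eta> i \<omega>)\<^sup>2)
     = (\<Sum>i<n. expectation (\<lambda>\<omega>. (\<theta> i \<omega>)\<^sup>2 * (p (Suc i) - p i)))"
  proof -
    have "expectation (\<lambda>\<omega>. (\<eta> i \<omega>)\<^sup>2) = p (Suc i) - p i" if "i < n" for i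
      unfolding \<eta>_def using that pos[of i] pd[OF that] by (intro increment_moments(4)) auto
    then show ?thesis using os by (simp add: mult.commute)
  qed
  also have "\<dots> = expectation (\<lambda>\<omega>. \<Sum>i<n. (\<theta> i \<omega>)\<^sup>2 * (p (Suc i) - p i))"
    using \<theta>_int by (intro Bochner_Integration.integral_sum[symmetric]) auto
  also have "\<dots> \<le> expectation (\<lambda>\<omega>. \<delta>)"
    using \<theta>_int by (intro integral_mono \<theta>_le Bochner_Integration.integrable_sum integrable_mult_left) auto
  also have "\<dots> = \<delta>" by (simp add: prob_space)
  finally have E: "expectation (\<lambda>\<omega>. (\<Sum>i<n. \<theta> i \<omega> * \<eta> i \<omega>)\<^sup>2) \<le> \<delta>" .
  have "prob {\<omega> \<in> space M. \<epsilon>\<^sup>2 \<le> (\<Sum>i<n. \<theta> i \<omega> * \<eta> i \<omega>)\<^sup>2}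
    \<le> expectation (\<lambda>\<omega>. (\<Sum>i<n. \<theta> i \<omega> * \<eta> i \<omega>)\<^sup>2) / \<epsilon>\<^sup>2"
    using \<epsilon> os by (intro integral_Markov_inequality_measure[of _ _ "space M"]) auto
  also have "\<dots> \<le> \<delta> / \<epsilon>\<^sup>2" using E by (intro divide_right_mono) auto
  finally have 1: "prob {\<omega> \<in> space M. \<epsilon>\<^sup>2 \<le> (\<Sum>i<n. \<theta> i \<omega> * \<eta> i \<omega>)\<^sup>2} \<le> \<delta> / \<epsilon>\<^sup>2" .
  have "{\<omega> \<in> space M. \<epsilon> < \<bar>\<Sum>i<n. \<xi> i \<omega> * (W (p (Suc i)) \<omega> - W (p i) \<omega>)\<bar>}
    \<subseteq> {\<omega> \<in> space M. \<epsilon>\<^sup>2 \<le> (\<Sum>i<n. \<theta> i \<omega> * \<eta> i \<omega>)\<^sup>2} \<union> {\<omega> \<in> space M. \<delta> < Z n \<omega>}"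
  proof safe
    fix \<omega> assume \<omega>: "\<omega> \<in> space M" "\<epsilon> < \<bar>\<Sum>i<n. \<xi> i \<omega> * (W (p (Suc i)) \<omega> - W (p i) \<omega>)\<bar>" "\<not> \<delta> < Z n \<omega>"
    have "\<theta> i \<omega> = \<xi> i \<omega>" if "i < n" for i
      using \<omega>(3) Z_mono[of "Suc i" n \<omega>] that by (auto simp: \<theta>_def)
    then have "(\<Sum>i<n. \<theta> i \<omega> * \<eta> i \<omega>) = (\<Sum>i<n. \<xi> i \<omega> * (W (p (Suc i)) \<omega> - W (p i) \<omega>))"
      by (intro sum.cong) (auto simp: \<eta>_def)
    with \<omega>(2) have "\<bar>\<epsilon>\<bar> \<le> \<bar>\<Sum>i<n. \<theta> i \<omega> * \<eta> i \<omega>\<bar>" using \<epsilon> by simp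
    then show "\<epsilon>\<^sup>2 \<le> (\<Sum>i<n. \<theta> i \<omega> * \<eta> i \<omega>)\<^sup>2" by (simp only: abs_le_square_iff)
  qed
  then have "prob {\<omega> \<in> space M. \<epsilon> < \<bar>\<Sum>i<n. \<xi> i \<omega> * (W (p (Suc i)) \<omega> - W (p i) \<omega>)\<bar>}
    \<le> prob ({\<omega> \<in> space M. \<epsilon>\<^sup>2 \<le> (\<Sum>i<n. \<theta> i \<omega> * \<eta> i \<omega>)\<^sup>2} \<union> {\<omega> \<in> space M. \<delta> < Z n \<omega>})"
    by (intro finite_measure_mono) auto
  also have "\<dots> \<le> prob {\<omega> \<in> space M. \<epsilon>\<^sup>2 \<le> (\<Sum>i<n. \<theta> i \<omega> * \<eta> i \<omega>)\<^sup>2} + prob {\<omega> \<in> space M. \<delta> < Z n \<omega>}"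
    by (intro measure_Un_le) measurable
  finally show ?thesis using 1 by (simp add: Z_def)
qed

text \<open>The same estimate for the difference of two step integrals with different partitions.\<close>

lemma step_integral_diff_tail:
  assumes a: "0 \<le> a" "a \<le> b"
    and sp: "step_process F a b n p \<xi>" "step_process F a b n' p' \<xi>'"
    and Y: "Y \<in> borel_measurable M"
    and le: "\<And>\<omega>. \<omega> \<in> space M \<Longrightarrow>
      (\<integral>\<^sup>+ s \<in> {a..b}. ennreal ((step_value n p \<xi> s \<omega> - step_value n' p' \<xi>' s \<omega>)\<^sup>2) \<partial>lborel) \<le> Y \<omega>"
    and \<delta>: "0 < \<delta>" and \<epsilon>: "0 < \<epsilon>"
  shows "prob {\<omega> \<in> space M. \<epsilon> < \<bar>step_integral W n p \<xi> \<omega> - step_integral W n' p' \<xi>' \<omega>\<bar>}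
    \<le> \<delta> / \<epsilon>\<^sup>2 + prob {\<omega> \<in> space M. ennreal \<delta> < Y \<omega>}"
proof -
  let ?R = "p ` {..n} \<union> p' ` {..n'}"
  have "finite ?R" "?R \<noteq> {}" by auto
  then obtain r N where r': "\<forall>i j. i < j \<longrightarrow> j \<le> N \<longrightarrow> r i < (r :: nat \<Rightarrow> real) j" "r ` {..N} = ?R"
    using common_partition by meson
  have r: "\<And>i j. i < j \<Longrightarrow> j \<le> N \<Longrightarrow> r i < r j" "r ` {..N} = ?R" using r' by auto
  have r_in: "a \<le> r j" "r j \<le> b" if "j \<le> N" for j
  proof -
    have "r j \<in> p ` {..n} \<union> p' ` {..n'}" using r(2) that by blast
    then show "a \<le> r j" "r j \<le> b"
      using step_process_bounds[OF sp(1)] step_process_bounds[OF sp(2)] by auto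
  qed
  have sub: "p ` {..n} \<subseteq> r ` {..N}" "p' ` {..n'} \<subseteq> r ` {..N}" using r(2) by auto
  define D where "D s \<omega> = step_value n p \<xi> s \<omega> - step_value n' p' \<xi>' s \<omega>" for s \<omega>
  have D_meas: "D s \<in> borel_measurable (F s)" for s
    unfolding D_def[abs_def] using step_value_measurable_F sp by (intro borel_measurable_diff)
  have D_const: "D s \<omega> = D (r j) \<omega>" if "j < N" "r j \<le> s" "s < r (Suc j)" for j s \<omega>
    unfolding D_def using step_value_refine[OF r(1) sub(1) that, of \<xi> \<omega>] step_value_refine[OF r(1) sub(2) that, of \<xi>' \<omega>]
    by (simp only:)
  have int: "step_integral W n p \<xi> \<omega> - step_integral W n' p' \<xi>' \<omega>
    = (\<Sum>j<N. D (r j) \<omega> * (W (r (Suc j)) \<omega> - W (r j) \<omega>))" for \<omega>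
    using step_integral_refine[OF r(1) sub(1), of W \<xi> \<omega>] step_integral_refine[OF r(1) sub(2), of W \<xi>' \<omega>] sp
    by (simp add: step_process_def D_def left_diff_distrib sum_subtractf)
  have rr: "r j < r (Suc j)" if "j < N" for j using r(1)[of j "Suc j"] that by auto
  have qv: "ennreal (\<Sum>j<N. (D (r j) \<omega>)\<^sup>2 * (r (Suc j) - r j)) \<le> Y \<omega>" if "\<omega> \<in> space M" for \<omega>
  proof -
    have "ennreal (\<Sum>j<N. (D (r j) \<omega>)\<^sup>2 * (r (Suc j) - r j))
       = (\<Sum>j<N. ennreal ((D (r j) \<omega>)\<^sup>2) * emeasure lborel {r j..<r (Suc j)})"
      using rr by (subst sum_ennreal[symmetric]) 
        (auto intro!: sum.cong mult_nonneg_nonneg simp: ennreal_mult[symmetric] less_imp_le)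
    also have "\<dots> = (\<Sum>j<N. \<integral>\<^sup>+ s. ennreal ((D (r j) \<omega>)\<^sup>2) * indicator {r j..<r (Suc j)} s \<partial>lborel)"
      by (simp add: nn_integral_cmult_indicator)
    also have "\<dots> = (\<integral>\<^sup>+ s. (\<Sum>j<N. ennreal ((D (r j) \<omega>)\<^sup>2) * indicator {r j..<r (Suc j)} s) \<partial>lborel)"
      by (intro nn_integral_sum[symmetric]) auto
    also have "\<dots> \<le> (\<integral>\<^sup>+ s \<in> {a..b}. ennreal ((D s \<omega>)\<^sup>2) \<partial>lborel)"
    proof (intro nn_integral_mono)
      fix s
      show "(\<Sum>j<N. ennreal ((D (r j) \<omega>)\<^sup>2) * indicator {r j..<r (Suc j)} s)
        \<le> ennreal ((D s \<omega>)\<^sup>2) * indicator {a..b} s"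
      proof (cases "\<exists>j<N. r j \<le> s \<and> s < r (Suc j)")
        case True
        then obtain j where j: "j < N" "r j \<le> s" "s < r (Suc j)" by auto
        have "(indicator {r i..<r (Suc i)} s :: ennreal) = (if i = j then 1 else 0)" if "i < N" for i
        proof (cases i j rule: linorder_cases)
          case less
          then have "r (Suc i) \<le> r j" using r(1)[of "Suc i" j] j by (cases "Suc i = j") auto
          then show ?thesis using j less by auto
        next
          case greater
          then have "r (Suc j) \<le> r i" using r(1)[of "Suc j" i] that by (cases "Suc j = i") auto
          then show ?thesis using j greater by auto
        qed (use j in auto)
        then have "(\<Sum>i<N. ennreal ((D (r i) \<omega>)\<^sup>2) * indicator {r i..<r (Suc i)} s)
          = (\<Sum>i<N. if i = j then ennreal ((D (r j) \<omega>)\<^sup>2) else 0)"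
          by (intro sum.cong) auto
        moreover have "s \<in> {a..b}" using j r_in[of j] r_in[of "Suc j"] by auto
        ultimately show ?thesis using j D_const[OF j] by simp
      next
        case False
        then have "(\<Sum>j<N. ennreal ((D (r j) \<omega>)\<^sup>2) * indicator {r j..<r (Suc j)} s) = 0"
          by (intro sum.neutral) (auto simp: indicator_def)
        then show ?thesis by simp
      qed
    qed
    also have "\<dots> \<le> Y \<omega>" using le[OF that] by (simp add: D_def)
    finally show ?thesis .
  qed
  have "prob {\<omega> \<in> space M. \<epsilon> < \<bar>\<Sum>j<N. D (r j) \<omega> * (W (r (Suc j)) \<omega> - W (r j) \<omega>)\<bar>}
    \<le> \<delta> / \<epsilon>\<^sup>2 + prob {\<omega> \<in> space M. \<delta> < (\<Sum>j<N. (D (r j) \<omega>)\<^sup>2 * (r (Suc j) - r j))}"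
    using r_in[of 0] a rr D_meas \<delta> \<epsilon> by (intro elementary_integral_tail) auto
  also have "prob {\<omega> \<in> space M. \<delta> < (\<Sum>j<N. (D (r j) \<omega>)\<^sup>2 * (r (Suc j) - r j))}
    \<le> prob {\<omega> \<in> space M. ennreal \<delta> < Y \<omega>}"
  proof (intro finite_measure_mono subsetI CollectI conjI)
    fix \<omega> assume "\<omega> \<in> {\<omega> \<in> space M. \<delta> < (\<Sum>j<N. (D (r j) \<omega>)\<^sup>2 * (r (Suc j) - r j))}"
    then have \<omega>: "\<omega> \<in> space M" "\<delta> < (\<Sum>j<N. (D (r j) \<omega>)\<^sup>2 * (r (Suc j) - r j))" by auto
    then have "ennreal \<delta> < ennreal (\<Sum>j<N. (D (r j) \<omega>)\<^sup>2 * (r (Suc j) - r j))"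
      using \<delta> by (subst ennreal_less_iff) auto
    also have "\<dots> \<le> Y \<omega>" using \<omega>(1) by (rule qv)
    finally show "ennreal \<delta> < Y \<omega>" .
  qed (use Y in auto)
  finally show ?thesis by (simp add: int)
qed

text \<open>Every sequence of step processes that approximates the integrand computes the same Ito integral.\<close>

lemma ito_integral_limit:
  assumes a: "0 \<le> a" "a \<le> b"
    and H: "has_ito_integral M F W H a b I"
    and sp: "\<And>k. step_process F a b (n k) (p k) (\<xi> k)"
    and lim: "to_zero_in_prob M
      (\<lambda>k \<omega>. \<integral>\<^sup>+ s \<in> {a..b}. ennreal ((step_value (n k) (p k) (\<xi> k) s \<omega> - H s \<omega>)\<^sup>2) \<partial>lborel)"
  shows "to_zero_in_prob M (\<lambda>k \<omega>. ennreal \<bar>step_integral W (n k) (p k) (\<xi> k) \<omega> - I \<omega>\<bar>)"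
proof -
  obtain n' p' \<xi>' where sp': "\<And>k. step_process F a b (n' k) (p' k) (\<xi>' k)"
    and lim': "to_zero_in_prob M
      (\<lambda>k \<omega>. \<integral>\<^sup>+ s \<in> {a..b}. ennreal ((step_value (n' k) (p' k) (\<xi>' k) s \<omega> - H s \<omega>)\<^sup>2) \<partial>lborel)"
    and I: "to_zero_in_prob M (\<lambda>k \<omega>. ennreal \<bar>step_integral W (n' k) (p' k) (\<xi>' k) \<omega> - I \<omega>\<bar>)"
    and [measurable]: "I \<in> borel_measurable M"
    and HM: "(\<lambda>(t, \<omega>). H t \<omega>) \<in> borel_measurable (restrict_space borel {a..b} \<Otimes>\<^sub>M M)"
    using H unfolding has_ito_integral_def by blast
  define A where "A k \<omega> = (\<integral>\<^sup>+ s \<in> {a..b}. ennreal ((step_value (n k) (p k) (\<xi> k) s \<omega> - H s \<omega>)\<^sup>2) \<partial>lborel)" for k \<omega>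
  define B where "B k \<omega> = (\<integral>\<^sup>+ s \<in> {a..b}. ennreal ((step_value (n' k) (p' k) (\<xi>' k) s \<omega> - H s \<omega>)\<^sup>2) \<partial>lborel)" for k \<omega>
  define Y where "Y k \<omega> = (A k \<omega> + A k \<omega>) + (B k \<omega> + B k \<omega>)" for k \<omega>
  have Y: "to_zero_in_prob M Y"
    unfolding Y_def[abs_def] using lim lim'
    by (intro to_zero_in_prob_add) (simp_all add: A_def[abs_def] B_def[abs_def])
  have [measurable]: "Y k \<in> borel_measurable M" for k using Y by (auto simp: to_zero_in_prob_def)
  note [measurable] = step_integral_measurable[OF sp a(1)] step_integral_measurable[OF sp' a(1)]
  have le: "(\<integral>\<^sup>+ s \<in> {a..b}. ennreal ((step_value (n k) (p k) (\<xi> k) s \<omega> - step_value (n' k) (p' k) (\<xi>' k) s \<omega>)\<^sup>2) \<partial>lborel)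
      \<le> Y k \<omega>" if \<omega>: "\<omega> \<in> space M" for k \<omega>
  proof -
    have "(\<lambda>s. (s, \<omega>)) \<in> measurable (restrict_space borel {a..b}) (restrict_space borel {a..b} \<Otimes>\<^sub>M M)"
      using \<omega> by (intro measurable_Pair) auto
    from measurable_compose[OF this HM]
    have "(\<lambda>s. H s \<omega>) \<in> borel_measurable (restrict_space borel {a..b})" by simp
    then have [measurable]: "(\<lambda>s. H s \<omega> * indicator {a..b} s) \<in> borel_measurable borel"
      by (subst (asm) borel_measurable_restrict_space_iff) (auto simp: mult.commute)
    let ?f = "\<lambda>s. step_value (n k) (p k) (\<xi> k) s \<omega>" and ?g = "\<lambda>s. step_value (n' k) (p' k) (\<xi>' k) s \<omega>"
    have [measurable]: "?f \<in> borel_measurable borel" "?g \<in> borel_measurable borel"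
      unfolding step_value_def by measurable
    have m: "(\<lambda>s. ennreal ((u s - H s \<omega>)\<^sup>2) * indicator {a..b} s) \<in> borel_measurable lborel"
      if [measurable]: "u \<in> borel_measurable borel" for u
    proof -
      have eq: "(\<lambda>s. ennreal ((u s - H s \<omega>)\<^sup>2) * indicator {a..b} s)
        = (\<lambda>s. ennreal ((u s - H s \<omega> * indicator {a..b} s)\<^sup>2) * indicator {a..b} s)"
        by (auto simp: fun_eq_iff indicator_def)
      show ?thesis unfolding eq by measurable
    qed
    note [measurable] = m[of ?f, simplified] m[of ?g, simplified]
    have "(\<integral>\<^sup>+ s \<in> {a..b}. ennreal ((?f s - ?g s)\<^sup>2) \<partial>lborel)
      \<le> (\<integral>\<^sup>+ s. (ennreal ((?f s - H s \<omega>)\<^sup>2) * indicator {a..b} s + ennreal ((?f s - H s \<omega>)\<^sup>2) * indicator {a..b} s)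
          + (ennreal ((?g s - H s \<omega>)\<^sup>2) * indicator {a..b} s + ennreal ((?g s - H s \<omega>)\<^sup>2) * indicator {a..b} s) \<partial>lborel)"
    proof (intro nn_integral_mono)
      fix s
      have "(?f s - ?g s)\<^sup>2 \<le> 2 * (?f s - H s \<omega>)\<^sup>2 + 2 * (?g s - H s \<omega>)\<^sup>2"
        using power2_sum_le[of "?f s - H s \<omega>" "- (?g s - H s \<omega>)"] by (simp add: power2_commute)
      then have "ennreal ((?f s - ?g s)\<^sup>2) \<le>
        ennreal (((?f s - H s \<omega>)\<^sup>2 + (?f s - H s \<omega>)\<^sup>2) + ((?g s - H s \<omega>)\<^sup>2 + (?g s - H s \<omega>)\<^sup>2))"
        by (intro ennreal_leI) linarith
      then have "ennreal ((?f s - ?g s)\<^sup>2) \<le> (ennreal ((?f s - H s \<omega>)\<^sup>2) + ennreal ((?f s - H s \<omega>)\<^sup>2))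
         + (ennreal ((?g s - H s \<omega>)\<^sup>2) + ennreal ((?g s - H s \<omega>)\<^sup>2))"
        by (simp only: ennreal_plus add_nonneg_nonneg zero_le_power2)
      then show "ennreal ((?f s - ?g s)\<^sup>2) * indicator {a..b} s
        \<le> (ennreal ((?f s - H s \<omega>)\<^sup>2) * indicator {a..b} s + ennreal ((?f s - H s \<omega>)\<^sup>2) * indicator {a..b} s)
          + (ennreal ((?g s - H s \<omega>)\<^sup>2) * indicator {a..b} s + ennreal ((?g s - H s \<omega>)\<^sup>2) * indicator {a..b} s)"
        by (auto simp: indicator_def)
    qed
    also have "\<dots> = Y k \<omega>"
      unfolding Y_def A_def B_def by (simp add: nn_integral_add)
    finally show ?thesis .
  qed
  define J where "J k \<omega> = step_integral W (n k) (p k) (\<xi> k) \<omega> - step_integral W (n' k) (p' k) (\<xi>' k) \<omega>" for k \<omega>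
  have [measurable]: "J k \<in> borel_measurable M" for k unfolding J_def[abs_def] by measurable
  have J: "to_zero_in_prob M (\<lambda>k \<omega>. ennreal \<bar>J k \<omega>\<bar>)"
    unfolding to_zero_in_prob_def
  proof safe
    show "(\<lambda>\<omega>. ennreal \<bar>J k \<omega>\<bar>) \<in> borel_measurable M" for k by measurable
    fix \<epsilon> :: real assume \<epsilon>: "0 < \<epsilon>"
    show "(\<lambda>k. prob {\<omega> \<in> space M. ennreal \<epsilon> < ennreal \<bar>J k \<omega>\<bar>}) \<longlonglongrightarrow> 0"
    proof (rule LIMSEQ_I)
      fix \<eta> :: real assume \<eta>: "0 < \<eta>"
      define \<delta> where "\<delta> = \<eta> * \<epsilon>\<^sup>2 / 2"
      have \<delta>: "0 < \<delta>" "\<delta> / \<epsilon>\<^sup>2 = \<eta> / 2" using \<eta> \<epsilon> by (auto simp: \<delta>_def)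
      have "(\<lambda>k. prob {\<omega> \<in> space M. ennreal \<delta> < Y k \<omega>}) \<longlonglongrightarrow> 0"
        using Y \<delta>(1) by (simp add: to_zero_in_prob_def)
      then have "eventually (\<lambda>k. prob {\<omega> \<in> space M. ennreal \<delta> < Y k \<omega>} < \<eta> / 2) sequentially"
        by (rule order_tendstoD) (use \<eta> in simp)
      then have "eventually (\<lambda>k. norm (prob {\<omega> \<in> space M. ennreal \<epsilon> < ennreal \<bar>J k \<omega>\<bar>} - 0) < \<eta>) sequentially"
      proof eventually_elim
        case (elim k)
        have Yk: "Y k \<in> borel_measurable M" by measurable
        have "prob {\<omega> \<in> space M. ennreal \<epsilon> < ennreal \<bar>J k \<omega>\<bar>} = prob {\<omega> \<in> space M. \<epsilon> < \<bar>J k \<omega>\<bar>}"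
          using \<epsilon> by (simp add: ennreal_less_iff)
        also have "\<dots> \<le> \<delta> / \<epsilon>\<^sup>2 + prob {\<omega> \<in> space M. ennreal \<delta> < Y k \<omega>}"
          unfolding J_def by (rule step_integral_diff_tail[OF a sp sp' Yk le \<delta>(1) \<epsilon>])
        also have "\<dots> < \<eta>" using elim \<delta>(2) by simp
        finally show ?case by simp
      qed
      then show "\<exists>no. \<forall>k\<ge>no. norm (prob {\<omega> \<in> space M. ennreal \<epsilon> < ennreal \<bar>J k \<omega>\<bar>} - 0) < \<eta>"
        by (simp only: eventually_sequentially)
    qed
  qed
  have "to_zero_in_prob M (\<lambda>k \<omega>. ennreal \<bar>J k \<omega>\<bar> + ennreal \<bar>step_integral W (n' k) (p' k) (\<xi>' k) \<omega> - I \<omega>\<bar>)"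
    by (rule to_zero_in_prob_add[OF J I])
  then show ?thesis
  proof (rule to_zero_in_prob_mono)
    fix k \<omega>
    have "\<bar>step_integral W (n k) (p k) (\<xi> k) \<omega> - I \<omega>\<bar>
      \<le> \<bar>J k \<omega>\<bar> + \<bar>step_integral W (n' k) (p' k) (\<xi>' k) \<omega> - I \<omega>\<bar>"
      unfolding J_def by linarith
    then show "ennreal \<bar>step_integral W (n k) (p k) (\<xi> k) \<omega> - I \<omega>\<bar>
      \<le> ennreal \<bar>J k \<omega>\<bar> + ennreal \<bar>step_integral W (n' k) (p' k) (\<xi>' k) \<omega> - I \<omega>\<bar>"
      using ennreal_leI ennreal_plus[of "\<bar>J k \<omega>\<bar>" "\<bar>step_integral W (n' k) (p' k) (\<xi>' k) \<omega> - I \<omega>\<bar>"]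
      by (metis abs_ge_zero)
  qed measurable
qed

lemma grid_step_process:
  assumes "a \<le> b" "\<And>t. t \<in> {a..b} \<Longrightarrow> H t \<in> borel_measurable (F t)"
  shows "step_process F a b (Suc k) (grid a b k) (\<lambda>j. H (grid a b k j))"
  unfolding step_process_def
proof (intro conjI allI impI)
  fix i assume "i < Suc k"
  then show "grid a b k i \<le> grid a b k (Suc i)" "H (grid a b k i) \<in> borel_measurable (F (grid a b k i))"
    using assms grid_bounds[OF assms(1), of i k] by (auto intro!: grid_mono assms(2))
qed auto

text \<open>For a continuous adapted integrand the Ito integral is the limit in probability of the Riemann
  sums along the uniform grids.\<close>

lemma ito_integral_riemann:
  assumes a: "0 \<le> a" "a \<le> b"
    and H: "has_ito_integral M F W H a b I"
    and cont: "\<And>\<omega>. \<omega> \<in> space M \<Longrightarrow> continuous_on {a..b} (\<lambda>t. H t \<omega>)"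
  shows "to_zero_in_prob M (\<lambda>k \<omega>. ennreal \<bar>(\<Sum>j<Suc k. H (grid a b k j) \<omega> *
    (W (grid a b k (Suc j)) \<omega> - W (grid a b k j) \<omega>)) - I \<omega>\<bar>)"
proof -
  have H1: "\<And>t. t \<in> {a..b} \<Longrightarrow> H t \<in> borel_measurable (F t)"
    and H2: "(\<lambda>(t, \<omega>). H t \<omega>) \<in> borel_measurable (restrict_space borel {a..b} \<Otimes>\<^sub>M M)"
    using H by (auto simp: has_ito_integral_def)
  have "to_zero_in_prob M (\<lambda>k \<omega>. ennreal \<bar>step_integral W (Suc k) (grid a b k) (\<lambda>j. H (grid a b k j)) \<omega> - I \<omega>\<bar>)"
  proof (rule ito_integral_limit[OF a H])
    show "step_process F a b (Suc k) (grid a b k) (\<lambda>j. H (grid a b k j))" for k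
      using a(2) H1 by (rule grid_step_process)
    show "to_zero_in_prob M (\<lambda>k \<omega>. \<integral>\<^sup>+ s \<in> {a..b}.
      ennreal ((step_value (Suc k) (grid a b k) (\<lambda>j. H (grid a b k j)) s \<omega> - H s \<omega>)\<^sup>2) \<partial>lborel)"
      using a(2) measurable_F_M[OF H1] H2 cont by (rule grid_step_approximation)
  qed
  then show ?thesis by (simp only: step_integral_def)
qed

end

section \<open>Geometric Brownian motion\<close>

text \<open>Along a continuous path the uniform grids see everything that happens on the interval; this
  reduces events about whole paths to countably many times.\<close>

lemma grid_dense:
  fixes f :: "real \<Rightarrow> real"
  assumes f: "continuous_on {a..b} f" and ab: "a \<le> b" and u: "u \<in> {a..b}" and e: "0 < e"
  shows "\<exists>k. \<exists>j\<le>Suc k. \<bar>f u - f (grid a b k j)\<bar> \<le> e"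
proof (cases "u = b")
  case True
  then show ?thesis using e by (intro exI[of _ 0] exI[of _ "Suc 0"]) simp
next
  case False
  obtain k where k: "\<forall>j<Suc k. \<forall>s\<in>{grid a b k j..grid a b k (Suc j)}. \<bar>f s - f (grid a b k j)\<bar> \<le> e"
    using eventually_happens'[OF sequentially_bot continuous_grid_oscillation[OF f ab e]] by blast
  obtain j where j: "j < Suc k" "grid a b k j \<le> u" "u < grid a b k (Suc j)"
    using False u partition_interval[of "grid a b k" u "Suc k"] by auto
  show ?thesis
    using k j by (intro exI[of _ k] exI[of _ j]) auto
qed

text \<open>If one step contributes \<open>o(h)\<close>, then all steps of size \<open>h\<close> together contribute nothing in the limit.\<close>

lemma vanishing_derivative_sum:
  fixes f :: "real \<Rightarrow> real"
  assumes D: "(f has_real_derivative 0) (at 0)" and f0: "f 0 = 0" and L: "0 \<le> L"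
  shows "(\<lambda>k. real (Suc k) * f (L / real (Suc k))) \<longlonglongrightarrow> 0"
proof (cases "L = 0")
  case True then show ?thesis by (simp add: f0)
next
  case False
  have h: "filterlim (\<lambda>k. L / real (Suc k)) (at 0) sequentially"
  proof (rule filterlim_atI)
    show "(\<lambda>k. L / real (Suc k)) \<longlonglongrightarrow> 0"
      using LIMSEQ_inverse_real_of_nat by (auto intro!: tendsto_mult_right_zero simp: divide_inverse)
    show "\<forall>\<^sub>F k in sequentially. L / real (Suc k) \<noteq> 0" using False by simp
  qed
  have "((\<lambda>h. (f (0 + h) - f 0) / h) \<longlongrightarrow> 0) (at 0)" using D by (simp only: DERIV_def)
  then have "((\<lambda>h. f h / h) \<longlongrightarrow> 0) (at 0)" by (simp add: f0)
  from filterlim_compose[OF this h]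
  have "(\<lambda>k. L * (f (L / real (Suc k)) / (L / real (Suc k)))) \<longlonglongrightarrow> L * 0"
    by (intro tendsto_mult tendsto_const)
  moreover have "L * (f (L / real (Suc k)) / (L / real (Suc k))) = real (Suc k) * f (L / real (Suc k))" for k
    using False by (simp del: of_nat_Suc)
  ultimately show ?thesis by simp
qed

lemma riemann_integral_measurable:
  fixes X :: "real \<Rightarrow> 'a \<Rightarrow> real"
  assumes "a \<le> b" "\<And>t. t \<in> {a..b} \<Longrightarrow> X t \<in> borel_measurable M"
    and "\<And>\<omega>. \<omega> \<in> space M \<Longrightarrow> continuous_on {a..b} (\<lambda>t. X t \<omega>)"
  shows "(\<lambda>\<omega>. integral {a..b} (\<lambda>s. X s \<omega>)) \<in> borel_measurable M"
proof (rule borel_measurable_LIMSEQ_real)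
  show "(\<lambda>k. \<Sum>j<Suc k. X (grid a b k j) \<omega> * ((b - a) / real (Suc k))) \<longlonglongrightarrow> integral {a..b} (\<lambda>s. X s \<omega>)"
    if "\<omega> \<in> space M" for \<omega>
    by (rule riemann_sum_tendsto[OF assms(3)[OF that] assms(1)])
  show "(\<lambda>\<omega>. \<Sum>j<Suc k. X (grid a b k j) \<omega> * ((b - a) / real (Suc k))) \<in> borel_measurable M" for k
    using grid_bounds[OF assms(1), of _ k] 
    by (intro borel_measurable_sum borel_measurable_times borel_measurable_const assms(2)) auto
qed

context prob_space
begin

lemma riemann_sum_to_zero_in_prob:
  fixes X :: "real \<Rightarrow> 'a \<Rightarrow> real"
  assumes "a \<le> b" "\<And>t. t \<in> {a..b} \<Longrightarrow> X t \<in> borel_measurable M"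
    and "\<And>\<omega>. \<omega> \<in> space M \<Longrightarrow> continuous_on {a..b} (\<lambda>t. X t \<omega>)"
  shows "to_zero_in_prob M (\<lambda>k \<omega>. ennreal \<bar>(\<Sum>j<Suc k. X (grid a b k j) \<omega> * ((b - a) / real (Suc k)))
    - integral {a..b} (\<lambda>s. X s \<omega>)\<bar>)"
proof (rule to_zero_in_prob_pointwise)
  have [measurable]: "(\<lambda>\<omega>. \<Sum>j<Suc k. X (grid a b k j) \<omega> * ((b - a) / real (Suc k))) \<in> borel_measurable M" for k
    using grid_bounds[OF assms(1), of _ k] 
    by (intro borel_measurable_sum borel_measurable_times borel_measurable_const assms(2)) auto
  note [measurable] = riemann_integral_measurable[OF assms]
  show "(\<lambda>\<omega>. ennreal \<bar>(\<Sum>j<Suc k. X (grid a b k j) \<omega> * ((b - a) / real (Suc k)))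
    - integral {a..b} (\<lambda>s. X s \<omega>)\<bar>) \<in> borel_measurable M" for k
    by measurable
  fix \<omega> \<epsilon> assume "\<omega> \<in> space M" "0 < (\<epsilon> :: real)"
  from tendstoD[OF riemann_sum_tendsto[OF assms(3)[OF this(1)] assms(1)] this(2)]
  show "\<forall>\<^sub>F k in sequentially. ennreal \<bar>(\<Sum>j<Suc k. X (grid a b k j) \<omega> * ((b - a) / real (Suc k)))
    - integral {a..b} (\<lambda>s. X s \<omega>)\<bar> \<le> ennreal \<epsilon>"
    by eventually_elim (auto intro!: ennreal_leI simp: dist_real_def)
qed

end

text \<open>The geometric Brownian motion with value \<open>x\<close> at time \<open>a\<close>.\<close>

definition gbm :: "(real \<Rightarrow> 'a \<Rightarrow> real) \<Rightarrow> real \<Rightarrow> real \<Rightarrow> real \<Rightarrow> real \<Rightarrow> real \<Rightarrow> 'a \<Rightarrow> real" where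
  "gbm W r \<sigma> a x t \<omega> = x * exp ((r - \<sigma>\<^sup>2 / 2) * (t - a) + \<sigma> * (W t \<omega> - W a \<omega>))"

context brownian_motion
begin

lemma gbm_start [simp]: "gbm W r \<sigma> a x a \<omega> = x"
  by (simp add: gbm_def)

lemma gbm_pos: "0 < x \<Longrightarrow> 0 < gbm W r \<sigma> a x t \<omega>"
  by (simp add: gbm_def)

lemma gbm_continuous:
  assumes "\<omega> \<in> space M" "0 \<le> a"
  shows "continuous_on {a..T} (\<lambda>t. gbm W r \<sigma> a x t \<omega>)"
proof -
  have "continuous_on {a..T} (\<lambda>t. W t \<omega>)"
    by (rule continuous_on_subset[OF continuous_paths[OF assms(1)]]) (use assms in auto)
  then show ?thesis unfolding gbm_def by (intro continuous_intros)
qed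

lemma gbm_measurable:
  assumes "0 \<le> a" "a \<le> t"
  shows "gbm W r \<sigma> a x t \<in> borel_measurable (F t)"
proof -
  have [measurable]: "W t \<in> borel_measurable (F t)" "W a \<in> borel_measurable (F t)"
    using assms by (auto intro!: W_measurable_F)
  show ?thesis unfolding gbm_def[abs_def] by measurable
qed

lemma gbm_second_moment:
  assumes "0 \<le> a" "a \<le> t"
  shows "integrable M (\<lambda>\<omega>. (gbm W r \<sigma> a x t \<omega>)\<^sup>2)"
    and "expectation (\<lambda>\<omega>. (gbm W r \<sigma> a x t \<omega>)\<^sup>2) = x\<^sup>2 * exp ((2 * r + \<sigma>\<^sup>2) * (t - a))"
proof -
  have eq: "(gbm W r \<sigma> a x t \<omega>)\<^sup>2 = x\<^sup>2 * exp (2 * (r - \<sigma>\<^sup>2 / 2) * (t - a)) * exp (2 * \<sigma> * (W t \<omega> - W a \<omega>))" for \<omega>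
    unfolding gbm_def power_mult_distrib exp_double[symmetric] by (simp add: exp_add[symmetric] field_simps)
  show "integrable M (\<lambda>\<omega>. (gbm W r \<sigma> a x t \<omega>)\<^sup>2)"
    unfolding eq using increment_exp_moment(1)[OF assms] by simp
  have "2 * (r - \<sigma>\<^sup>2 / 2) * (t - a) + (2 * \<sigma>)\<^sup>2 * (t - a) / 2 = (2 * r + \<sigma>\<^sup>2) * (t - a)"
    by (simp add: power2_eq_square field_simps)
  then have e: "exp (2 * (r - \<sigma>\<^sup>2 / 2) * (t - a)) * exp ((2 * \<sigma>)\<^sup>2 * (t - a) / 2) = exp ((2 * r + \<sigma>\<^sup>2) * (t - a))"
    by (simp only: mult_exp_exp)
  have "expectation (\<lambda>\<omega>. (gbm W r \<sigma> a x t \<omega>)\<^sup>2)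
    = x\<^sup>2 * (exp (2 * (r - \<sigma>\<^sup>2 / 2) * (t - a)) * exp ((2 * \<sigma>)\<^sup>2 * (t - a) / 2))"
    unfolding eq integral_mult_right_zero increment_exp_moment(2)[OF assms] by (simp only: mult.assoc)
  then show "expectation (\<lambda>\<omega>. (gbm W r \<sigma> a x t \<omega>)\<^sup>2) = x\<^sup>2 * exp ((2 * r + \<sigma>\<^sup>2) * (t - a))"
    by (simp only: e)
qed

text \<open>The one-step remainder of the exponential: both its mean and its second moment are of
  smaller order than the step.\<close>

lemma gbm_remainder:
  fixes r \<sigma> :: real
  assumes st: "0 \<le> s" "s \<le> t"
  defines "h \<equiv> t - s"
  defines "m \<equiv> exp (r * h) - 1 - r * h"
  defines "\<eta> \<equiv> \<lambda>\<omega>. exp ((r - \<sigma>\<^sup>2 / 2) * h + \<sigma> * (W t \<omega> - W s \<omega>)) - 1 - r * h - \<sigma> * (W t \<omega> - W s \<omega>) - m"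
  shows "integrable M (\<lambda>\<omega>. (\<eta> \<omega>)\<^sup>2)" "expectation \<eta> = 0"
    "expectation (\<lambda>\<omega>. (\<eta> \<omega>)\<^sup>2) = exp ((2 * r + \<sigma>\<^sup>2) * h) + (exp (r * h))\<^sup>2 + \<sigma>\<^sup>2 * h
       - 2 * (exp (r * h))\<^sup>2 - 2 * \<sigma>\<^sup>2 * h * exp (r * h)"
proof -
  define A where "A \<omega> = exp ((r - \<sigma>\<^sup>2 / 2) * h) * exp (\<sigma> * (W t \<omega> - W s \<omega>))" for \<omega>
  define d where "d \<omega> = W t \<omega> - W s \<omega>" for \<omega>
  define R where "R = exp (r * h)"
  have \<eta>: "\<eta> \<omega> = A \<omega> - R - \<sigma> * d \<omega>" for \<omega>
    by (simp add: \<eta>_def A_def m_def d_def R_def exp_add)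
  have e1: "(r - \<sigma>\<^sup>2 / 2) * h + \<sigma>\<^sup>2 * h / 2 = r * h" by (simp add: algebra_simps)
  have e2: "2 * ((r - \<sigma>\<^sup>2 / 2) * h) + (2 * \<sigma>)\<^sup>2 * h / 2 = (2 * r + \<sigma>\<^sup>2) * h"
    by (simp add: algebra_simps power2_eq_square)
  have A: "integrable M A" "expectation A = R"
  proof -
    show "integrable M A"
      unfolding A_def[abs_def] using increment_exp_moment(1)[OF st] by (intro integrable_mult_right)
    have "expectation A = exp ((r - \<sigma>\<^sup>2 / 2) * h) * exp (\<sigma>\<^sup>2 * h / 2)"
      unfolding A_def[abs_def] integral_mult_right_zero increment_exp_moment(2)[OF st] h_def ..
    then show "expectation A = R" by (simp only: mult_exp_exp e1 R_def)
  qed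
  have A2: "integrable M (\<lambda>\<omega>. (A \<omega>)\<^sup>2)" "expectation (\<lambda>\<omega>. (A \<omega>)\<^sup>2) = exp ((2 * r + \<sigma>\<^sup>2) * h)"
  proof -
    have eq: "(A \<omega>)\<^sup>2 = exp (2 * ((r - \<sigma>\<^sup>2 / 2) * h)) * exp (2 * \<sigma> * (W t \<omega> - W s \<omega>))" for \<omega>
      unfolding A_def power_mult_distrib exp_double[symmetric] by (simp add: algebra_simps)
    show "integrable M (\<lambda>\<omega>. (A \<omega>)\<^sup>2)"
      unfolding eq using increment_exp_moment(1)[OF st] by (intro integrable_mult_right)
    show "expectation (\<lambda>\<omega>. (A \<omega>)\<^sup>2) = exp ((2 * r + \<sigma>\<^sup>2) * h)"
      unfolding eq integral_mult_right_zero increment_exp_moment(2)[OF st] h_def[symmetric]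
      by (simp only: mult_exp_exp e2)
  qed
  have dA: "integrable M (\<lambda>\<omega>. d \<omega> * A \<omega>)" "expectation (\<lambda>\<omega>. d \<omega> * A \<omega>) = \<sigma> * h * R"
  proof -
    have eq: "d \<omega> * A \<omega> = exp ((r - \<sigma>\<^sup>2 / 2) * h) * ((W t \<omega> - W s \<omega>) * exp (\<sigma> * (W t \<omega> - W s \<omega>)))" for \<omega>
      by (simp add: A_def d_def)
    show "integrable M (\<lambda>\<omega>. d \<omega> * A \<omega>)"
      unfolding eq using increment_exp_moment(3)[OF st, of \<sigma>] by (intro integrable_mult_right)
    have "expectation (\<lambda>\<omega>. d \<omega> * A \<omega>) = exp ((r - \<sigma>\<^sup>2 / 2) * h) * (\<sigma> * h * exp (\<sigma>\<^sup>2 * h / 2))"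
      unfolding eq using increment_exp_moment(4)[OF st, of \<sigma>] by (simp add: h_def[symmetric])
    also have "\<dots> = \<sigma> * h * exp ((r - \<sigma>\<^sup>2 / 2) * h + \<sigma>\<^sup>2 * h / 2)" by (simp only: exp_add mult_ac)
    finally show "expectation (\<lambda>\<omega>. d \<omega> * A \<omega>) = \<sigma> * h * R" by (simp only: e1 R_def)
  qed
  have d: "integrable M d" "expectation d = 0" "integrable M (\<lambda>\<omega>. (d \<omega>)\<^sup>2)" "expectation (\<lambda>\<omega>. (d \<omega>)\<^sup>2) = h"
    unfolding d_def[abs_def] h_def using increment_moments[OF st] by auto
  have sq: "(\<lambda>\<omega>. (\<eta> \<omega>)\<^sup>2) = (\<lambda>\<omega>. (A \<omega>)\<^sup>2 + R\<^sup>2 + \<sigma>\<^sup>2 * (d \<omega>)\<^sup>2 - 2 * R * A \<omega> - 2 * \<sigma> * (d \<omega> * A \<omega>) + 2 * R * \<sigma> * d \<omega>)"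
    unfolding \<eta> by (auto simp: fun_eq_iff power2_eq_square algebra_simps)
  show "integrable M (\<lambda>\<omega>. (\<eta> \<omega>)\<^sup>2)"
    unfolding sq using A(1) A2(1) dA(1) d(1,3) by auto
  show "expectation \<eta> = 0"
    unfolding \<eta> using A d by (simp add: prob_space)
  have "expectation (\<lambda>\<omega>. (\<eta> \<omega>)\<^sup>2) = exp ((2 * r + \<sigma>\<^sup>2) * h) + R\<^sup>2 + \<sigma>\<^sup>2 * h - 2 * R * R - 2 * \<sigma> * (\<sigma> * h * R)"
    unfolding sq using A A2 dA d by (simp add: prob_space)
  then show "expectation (\<lambda>\<omega>. (\<eta> \<omega>)\<^sup>2) = exp ((2 * r + \<sigma>\<^sup>2) * h) + (exp (r * h))\<^sup>2 + \<sigma>\<^sup>2 * h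
       - 2 * (exp (r * h))\<^sup>2 - 2 * \<sigma>\<^sup>2 * h * exp (r * h)"
    by (simp add: R_def power2_eq_square)
qed

text \<open>The geometric Brownian motion \<open>Y\<close> solves its equation in the sense of Riemann sums: over one step,
  \<open>\<Delta>Y - r Y h - \<sigma> Y \<Delta>W\<close> is \<open>Y\<close> times the remainder of the previous lemma, whose mean \<open>m\<close> and centred part
  \<open>\<eta>\<close> are summed separately.\<close>

lemma gbm_ito_sum:
  fixes r \<sigma> a x t :: real
  assumes a: "0 \<le> a" "a \<le> t"
  defines "Y \<equiv> gbm W r \<sigma> a x"
  shows "to_zero_in_prob M (\<lambda>k \<omega>. ennreal \<bar>(\<Sum>j<Suc k. \<sigma> * Y (grid a t k j) \<omega> *
    (W (grid a t k (Suc j)) \<omega> - W (grid a t k j) \<omega>))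
      - (Y t \<omega> - x - integral {a..t} (\<lambda>s. r * Y s \<omega>))\<bar>)"
proof -
  define h where "h k = (t - a) / real (Suc k)" for k
  define m where "m k = exp (r * h k) - 1 - r * h k" for k
  define \<eta> where "\<eta> k j \<omega> = exp ((r - \<sigma>\<^sup>2 / 2) * h k + \<sigma> * (W (grid a t k (Suc j)) \<omega> - W (grid a t k j) \<omega>))
    - 1 - r * h k - \<sigma> * (W (grid a t k (Suc j)) \<omega> - W (grid a t k j) \<omega>) - m k" for k j \<omega>
  define A where "A k \<omega> = (\<Sum>j<Suc k. Y (grid a t k j) \<omega> * \<eta> k j \<omega>)" for k \<omega>
  define B where "B k \<omega> = (\<Sum>j<Suc k. Y (grid a t k j) \<omega> * m k)" for k \<omega>
  have gr: "a \<le> grid a t k j" "grid a t k j \<le> t" if "j \<le> Suc k" for k j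
    using grid_bounds[OF a(2) that] by auto
  have Y_F: "Y s \<in> borel_measurable (F s)" if "a \<le> s" for s
    unfolding Y_def using a that by (intro gbm_measurable) auto
  have Y_M: "Y s \<in> borel_measurable M" if "a \<le> s" for s
    using measurable_F_M[OF Y_F[OF that]] .
  have Y_cont: "continuous_on {a..t} (\<lambda>s. Y s \<omega>)" if "\<omega> \<in> space M" for \<omega>
    unfolding Y_def using that a(1) by (rule gbm_continuous)
  have \<eta>: "integrable M (\<lambda>\<omega>. (\<eta> k j \<omega>)\<^sup>2)" "expectation (\<eta> k j) = 0"
    "expectation (\<lambda>\<omega>. (\<eta> k j \<omega>)\<^sup>2) = exp ((2 * r + \<sigma>\<^sup>2) * h k) + (exp (r * h k))\<^sup>2 + \<sigma>\<^sup>2 * h k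
       - 2 * (exp (r * h k))\<^sup>2 - 2 * \<sigma>\<^sup>2 * h k * exp (r * h k)"
    if "j < Suc k" for k j
  proof -
    have s: "0 \<le> grid a t k j" "grid a t k j \<le> grid a t k (Suc j)"
      using gr[of j k] a that by (auto intro!: grid_mono)
    show "integrable M (\<lambda>\<omega>. (\<eta> k j \<omega>)\<^sup>2)" "expectation (\<eta> k j) = 0"
      "expectation (\<lambda>\<omega>. (\<eta> k j \<omega>)\<^sup>2) = exp ((2 * r + \<sigma>\<^sup>2) * h k) + (exp (r * h k))\<^sup>2 + \<sigma>\<^sup>2 * h k
       - 2 * (exp (r * h k))\<^sup>2 - 2 * \<sigma>\<^sup>2 * h k * exp (r * h k)"
      using gbm_remainder[OF s, of r \<sigma>] unfolding grid_diff \<eta>_def[abs_def] m_def h_def by auto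
  qed
  have os: "integrable M (\<lambda>\<omega>. (A k \<omega>)\<^sup>2) \<and> A k \<in> borel_measurable (F (grid a t k (Suc k))) \<and>
    expectation (\<lambda>\<omega>. (A k \<omega>)\<^sup>2) = (\<Sum>j<Suc k. expectation (\<lambda>\<omega>. (Y (grid a t k j) \<omega>)\<^sup>2) * expectation (\<lambda>\<omega>. (\<eta> k j \<omega>)\<^sup>2))" for k
    unfolding A_def[abs_def]
  proof (rule orthogonal_sum)
    fix j assume j: "j < Suc k"
    have s: "0 \<le> grid a t k j" "grid a t k j \<le> grid a t k (Suc j)"
      using gr[of j k] a j by (auto intro!: grid_mono)
    show "grid a t k j \<le> grid a t k (Suc j)" by fact
    show "Y (grid a t k j) \<in> borel_measurable (F (grid a t k j))" using gr[of j k] j by (intro Y_F) auto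
    show "integrable M (\<lambda>\<omega>. (Y (grid a t k j) \<omega>)\<^sup>2)"
      unfolding Y_def using gr[of j k] j a by (intro gbm_second_moment) auto
    have [measurable]: "W (grid a t k (Suc j)) \<in> borel_measurable (F (grid a t k (Suc j)))"
      "W (grid a t k j) \<in> borel_measurable (F (grid a t k (Suc j)))"
      using s by (auto intro!: W_measurable_F)
    show "\<eta> k j \<in> borel_measurable (F (grid a t k (Suc j)))" unfolding \<eta>_def[abs_def] by measurable
    show "integrable M (\<lambda>\<omega>. (\<eta> k j \<omega>)\<^sup>2)" "expectation (\<eta> k j) = 0" using \<eta> j by auto
    fix U :: "'a \<Rightarrow> real" assume U: "U \<in> borel_measurable (F (grid a t k j))"
    have "indep_var borel ((\<lambda>x. x) \<circ> U) borel ((\<lambda>x. exp ((r - \<sigma>\<^sup>2 / 2) * h k + \<sigma> * x) - 1 - r * h k - \<sigma> * x - m k)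
      \<circ> (\<lambda>\<omega>. W (grid a t k (Suc j)) \<omega> - W (grid a t k j) \<omega>))"
      by (rule indep_var_compose[OF increment_indep[OF s U]]) auto
    then show "indep_var borel U borel (\<eta> k j)" by (simp add: o_def \<eta>_def[abs_def])
  qed
  have A_M[measurable]: "A k \<in> borel_measurable M" for k using os measurable_F_M by blast
  let ?q = "\<lambda>h. exp ((2 * r + \<sigma>\<^sup>2) * h) + (exp (r * h))\<^sup>2 + \<sigma>\<^sup>2 * h
       - 2 * (exp (r * h))\<^sup>2 - 2 * \<sigma>\<^sup>2 * h * exp (r * h)"
  define C where "C = x\<^sup>2 * exp (\<bar>2 * r + \<sigma>\<^sup>2\<bar> * (t - a))"
  have "to_zero_in_prob M (\<lambda>k \<omega>. ennreal \<bar>A k \<omega>\<bar>)"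
  proof (rule to_zero_in_prob_L2)
    have "(?q has_real_derivative 0) (at 0)"
      by (auto intro!: derivative_eq_intros)
    then have "(\<lambda>k. real (Suc k) * ?q ((t - a) / real (Suc k))) \<longlonglongrightarrow> 0"
      by (rule vanishing_derivative_sum) (use a in auto)
    then have "(\<lambda>k. C * (real (Suc k) * ?q (h k))) \<longlonglongrightarrow> 0"
      unfolding h_def by (rule tendsto_mult_right_zero)
    then show "(\<lambda>k. expectation (\<lambda>\<omega>. (A k \<omega>)\<^sup>2)) \<longlonglongrightarrow> 0"
    proof (rule Lim_null_comparison[rotated], intro always_eventually allI)
      fix k
      have q: "0 \<le> ?q (h k)" unfolding \<eta>(3)[of 0 k, symmetric, OF zero_less_Suc] by simp
      have "expectation (\<lambda>\<omega>. (A k \<omega>)\<^sup>2) = (\<Sum>j<Suc k. expectation (\<lambda>\<omega>. (Y (grid a t k j) \<omega>)\<^sup>2) * ?q (h k))"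
        using os[of k] \<eta>(3) by auto
      also have "\<dots> \<le> (\<Sum>j<Suc k. C * ?q (h k))"
      proof (intro sum_mono mult_right_mono q)
        fix j assume "j \<in> {..<Suc k}"
        then have g: "a \<le> grid a t k j" "grid a t k j \<le> t" using gr[of j k] by auto
        have "(2 * r + \<sigma>\<^sup>2) * (grid a t k j - a) \<le> \<bar>2 * r + \<sigma>\<^sup>2\<bar> * (t - a)"
          using g by (intro mult_mono) auto
        then show "expectation (\<lambda>\<omega>. (Y (grid a t k j) \<omega>)\<^sup>2) \<le> C"
          unfolding Y_def C_def using gbm_second_moment(2)[OF a(1) g(1), of r \<sigma> x]
          by (auto intro!: mult_left_mono)
      qed
      also have "\<dots> = C * (real (Suc k) * ?q (h k))" by (simp only: sum_constant card_lessThan mult_ac)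
      finally show "norm (expectation (\<lambda>\<omega>. (A k \<omega>)\<^sup>2)) \<le> C * (real (Suc k) * ?q (h k))" by simp
    qed
  qed (use os in auto)
  moreover have "to_zero_in_prob M (\<lambda>k \<omega>. ennreal \<bar>B k \<omega>\<bar>)"
  proof (rule to_zero_in_prob_pointwise)
    have [measurable]: "B k \<in> borel_measurable M" for k
      unfolding B_def[abs_def] using gr[of _ k]
      by (intro borel_measurable_sum borel_measurable_times borel_measurable_const Y_M) auto
    show "(\<lambda>\<omega>. ennreal \<bar>B k \<omega>\<bar>) \<in> borel_measurable M" for k by measurable
    fix \<omega> and \<epsilon> :: real assume \<omega>: "\<omega> \<in> space M" and \<epsilon>: "0 < \<epsilon>"
    have "bounded ((\<lambda>s. Y s \<omega>) ` {a..t})"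
      using Y_cont[OF \<omega>] by (intro compact_imp_bounded compact_continuous_image) auto
    then obtain b where "\<forall>s\<in>{a..t}. \<bar>Y s \<omega>\<bar> \<le> b" unfolding bounded_iff by auto
    then have b: "\<And>s. s \<in> {a..t} \<Longrightarrow> \<bar>Y s \<omega>\<bar> \<le> b" by blast
    have "((\<lambda>h. exp (r * h) - 1 - r * h) has_real_derivative 0) (at 0)"
      by (auto intro!: derivative_eq_intros)
    then have "(\<lambda>k. real (Suc k) * m k) \<longlonglongrightarrow> 0"
      unfolding m_def h_def by (rule vanishing_derivative_sum) (use a in auto)
    then have "(\<lambda>k. b * \<bar>real (Suc k) * m k\<bar>) \<longlonglongrightarrow> 0"
      by (intro tendsto_mult_right_zero tendsto_rabs_zero)
    then have "\<forall>\<^sub>F k in sequentially. b * \<bar>real (Suc k) * m k\<bar> < \<epsilon>" using \<epsilon> by (rule order_tendstoD)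
    then show "\<forall>\<^sub>F k in sequentially. ennreal \<bar>B k \<omega>\<bar> \<le> ennreal \<epsilon>"
    proof eventually_elim
      case (elim k)
      have "\<bar>B k \<omega>\<bar> \<le> (\<Sum>j<Suc k. \<bar>Y (grid a t k j) \<omega> * m k\<bar>)" unfolding B_def by (rule sum_abs)
      also have "\<dots> \<le> (\<Sum>j<Suc k. b * \<bar>m k\<bar>)"
        unfolding abs_mult using gr[of _ k] by (intro sum_mono mult_right_mono b) auto
      also have "\<dots> = b * \<bar>real (Suc k) * m k\<bar>" by (simp add: abs_mult)
      finally show ?case using elim by (intro ennreal_leI) simp
    qed
  qed
  moreover have "to_zero_in_prob M (\<lambda>k \<omega>. ennreal \<bar>(\<Sum>j<Suc k. r * Y (grid a t k j) \<omega> * ((t - a) / real (Suc k)))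
    - integral {a..t} (\<lambda>s. r * Y s \<omega>)\<bar>)"
    by (rule riemann_sum_to_zero_in_prob[where X = "\<lambda>s \<omega>. r * Y s \<omega>"])
      (use a Y_M Y_cont in \<open>auto intro!: borel_measurable_times continuous_intros\<close>)
  ultimately have "to_zero_in_prob M (\<lambda>k \<omega>. ennreal \<bar>A k \<omega>\<bar> + ennreal \<bar>B k \<omega>\<bar> + ennreal \<bar>(\<Sum>j<Suc k. r * Y (grid a t k j) \<omega> * ((t - a) / real (Suc k)))
    - integral {a..t} (\<lambda>s. r * Y s \<omega>)\<bar>)"
    by (intro to_zero_in_prob_add)
  then show ?thesis
  proof (rule to_zero_in_prob_mono)
    fix k
    have "(\<lambda>\<omega>. integral {a..t} (\<lambda>s. r * Y s \<omega>)) \<in> borel_measurable M"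
      by (rule riemann_integral_measurable[where X = "\<lambda>s \<omega>. r * Y s \<omega>"])
        (use a Y_M Y_cont in \<open>auto intro!: borel_measurable_times continuous_intros\<close>)
    moreover have "(\<lambda>\<omega>. \<Sum>j<Suc k. \<sigma> * Y (grid a t k j) \<omega> *
      (W (grid a t k (Suc j)) \<omega> - W (grid a t k j) \<omega>)) \<in> borel_measurable M"
      using gr[of _ k] a by (intro borel_measurable_sum borel_measurable_times borel_measurable_diff borel_measurable_const Y_M W_measurable_M)
        (auto intro: order_trans[OF a(1)])
    ultimately show "(\<lambda>\<omega>. ennreal \<bar>(\<Sum>j<Suc k. \<sigma> * Y (grid a t k j) \<omega> *
      (W (grid a t k (Suc j)) \<omega> - W (grid a t k j) \<omega>)) - (Y t \<omega> - x - integral {a..t} (\<lambda>s. r * Y s \<omega>))\<bar>) \<in> borel_measurable M"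
      using Y_M[OF a(2)] by measurable
    fix \<omega>
    have step: "Y (grid a t k (Suc j)) \<omega> - Y (grid a t k j) \<omega> = Y (grid a t k j) \<omega> * \<eta> k j \<omega> + Y (grid a t k j) \<omega> * m k
      + r * Y (grid a t k j) \<omega> * h k + \<sigma> * Y (grid a t k j) \<omega> * (W (grid a t k (Suc j)) \<omega> - W (grid a t k j) \<omega>)" for j
    proof -
      have "Y (grid a t k (Suc j)) \<omega> = Y (grid a t k j) \<omega> *
        exp ((r - \<sigma>\<^sup>2 / 2) * h k + \<sigma> * (W (grid a t k (Suc j)) \<omega> - W (grid a t k j) \<omega>))"
        unfolding Y_def gbm_def h_def grid_diff[of a t k j, symmetric] mult.assoc mult_exp_exp
        by (simp add: field_simps)
      then show ?thesis by (simp add: \<eta>_def algebra_simps)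
    qed
    have "Y t \<omega> - x = (\<Sum>j<Suc k. Y (grid a t k (Suc j)) \<omega> - Y (grid a t k j) \<omega>)"
      using sum_lessThan_telescope[of "\<lambda>j. Y (grid a t k j) \<omega>" "Suc k"] by (simp add: Y_def)
    also have "\<dots> = A k \<omega> + B k \<omega> + (\<Sum>j<Suc k. r * Y (grid a t k j) \<omega> * h k)
      + (\<Sum>j<Suc k. \<sigma> * Y (grid a t k j) \<omega> * (W (grid a t k (Suc j)) \<omega> - W (grid a t k j) \<omega>))"
      unfolding step A_def B_def sum.distrib ..
    finally have eq: "Y t \<omega> - x = A k \<omega> + B k \<omega> + (\<Sum>j<Suc k. r * Y (grid a t k j) \<omega> * ((t - a) / real (Suc k)))
      + (\<Sum>j<Suc k. \<sigma> * Y (grid a t k j) \<omega> * (W (grid a t k (Suc j)) \<omega> - W (grid a t k j) \<omega>))"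
      unfolding h_def .
    have "\<bar>(\<Sum>j<Suc k. \<sigma> * Y (grid a t k j) \<omega> * (W (grid a t k (Suc j)) \<omega> - W (grid a t k j) \<omega>))
       - (Y t \<omega> - x - integral {a..t} (\<lambda>s. r * Y s \<omega>))\<bar>
      \<le> \<bar>A k \<omega>\<bar> + \<bar>B k \<omega>\<bar> + \<bar>(\<Sum>j<Suc k. r * Y (grid a t k j) \<omega> * ((t - a) / real (Suc k))) - integral {a..t} (\<lambda>s. r * Y s \<omega>)\<bar>"
      unfolding eq by linarith
    then have "ennreal \<bar>(\<Sum>j<Suc k. \<sigma> * Y (grid a t k j) \<omega> * (W (grid a t k (Suc j)) \<omega> - W (grid a t k j) \<omega>))
       - (Y t \<omega> - x - integral {a..t} (\<lambda>s. r * Y s \<omega>))\<bar>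
      \<le> ennreal (\<bar>A k \<omega>\<bar> + \<bar>B k \<omega>\<bar> + \<bar>(\<Sum>j<Suc k. r * Y (grid a t k j) \<omega> * ((t - a) / real (Suc k))) - integral {a..t} (\<lambda>s. r * Y s \<omega>)\<bar>)"
      by (rule ennreal_leI)
    then show "ennreal \<bar>(\<Sum>j<Suc k. \<sigma> * Y (grid a t k j) \<omega> * (W (grid a t k (Suc j)) \<omega> - W (grid a t k j) \<omega>))
       - (Y t \<omega> - x - integral {a..t} (\<lambda>s. r * Y s \<omega>))\<bar>
      \<le> ennreal \<bar>A k \<omega>\<bar> + ennreal \<bar>B k \<omega>\<bar> + ennreal \<bar>(\<Sum>j<Suc k. r * Y (grid a t k j) \<omega> * ((t - a) / real (Suc k))) - integral {a..t} (\<lambda>s. r * Y s \<omega>)\<bar>"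
      by (simp only: ennreal_plus add_nonneg_nonneg abs_ge_zero)
  qed
qed

lemma gbm_stock_price:
  assumes a: "0 \<le> a" and x: "0 < x"
  shows "stock_price M F W r \<sigma> T a x (gbm W r \<sigma> a x)"
  unfolding stock_price_def
proof (intro conjI ballI)
  let ?Y = "gbm W r \<sigma> a x"
  show "continuous_on {a..T} (\<lambda>t. ?Y t \<omega>)" if "\<omega> \<in> space M" for \<omega>
    using that a by (rule gbm_continuous)
  show "0 < ?Y t \<omega>" for t \<omega> using x by (rule gbm_pos)
  show "AE \<omega> in M. ?Y a \<omega> = x" by simp
  fix t assume "t \<in> {a..T}"
  then have t: "a \<le> t" by simp
  let ?I = "\<lambda>\<omega>. ?Y t \<omega> - x - integral {a..t} (\<lambda>s. r * ?Y s \<omega>)"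
  let ?H = "\<lambda>s \<omega>. \<sigma> * ?Y s \<omega>"
  have Y_F: "?Y s \<in> borel_measurable (F s)" if "a \<le> s" for s using a that by (rule gbm_measurable)
  have Y_M: "?Y s \<in> borel_measurable M" if "a \<le> s" for s using measurable_F_M[OF Y_F[OF that]] .
  have c: "continuous_on {a..t} (\<lambda>s. c * ?Y s \<omega>)" if "\<omega> \<in> space M" for \<omega> c
    using gbm_continuous[OF that a] by (intro continuous_intros)
  have H_F: "?H s \<in> borel_measurable (F s)" if "s \<in> {a..t}" for s
    using Y_F[of s] that by (intro borel_measurable_times borel_measurable_const) auto
  have HM: "(\<lambda>(s, \<omega>). ?H s \<omega>) \<in> borel_measurable (restrict_space borel {a..t} \<Otimes>\<^sub>M M)"
    by (rule continuous_process_jointly_measurable[OF t measurable_F_M[OF H_F] c])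
  have I_M: "?I \<in> borel_measurable M"
  proof (intro borel_measurable_diff borel_measurable_const Y_M t)
    show "(\<lambda>\<omega>. integral {a..t} (\<lambda>s. r * ?Y s \<omega>)) \<in> borel_measurable M"
      by (rule riemann_integral_measurable[where X = "\<lambda>s \<omega>. r * ?Y s \<omega>", OF t _ c])
        (use Y_M in \<open>auto intro!: borel_measurable_times\<close>)
  qed
  have "has_ito_integral M F W ?H a t ?I"
    unfolding has_ito_integral_def
  proof (intro conjI ballI I_M HM exI allI)
    show "?H s \<in> borel_measurable (F s)" if "s \<in> {a..t}" for s using that by (rule H_F)
    show "step_process F a t (Suc k) (grid a t k) (\<lambda>j. ?H (grid a t k j))" for k
      using t H_F by (rule grid_step_process)
    show "to_zero_in_prob M (\<lambda>k \<omega>. \<integral>\<^sup>+ s \<in> {a..t}. 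
      ennreal ((step_value (Suc k) (grid a t k) (\<lambda>j. ?H (grid a t k j)) s \<omega> - ?H s \<omega>)\<^sup>2) \<partial>lborel)"
      by (rule grid_step_approximation[OF t measurable_F_M[OF H_F] HM c])
    show "to_zero_in_prob M (\<lambda>k \<omega>. ennreal \<bar>step_integral W (Suc k) (grid a t k) (\<lambda>j. ?H (grid a t k j)) \<omega> - ?I \<omega>\<bar>)"
      unfolding step_integral_def using a t by (rule gbm_ito_sum)
  qed
  then show "\<exists>I. has_ito_integral M F W ?H a t I \<and>
      (AE \<omega> in M. ?Y t \<omega> = ?Y a \<omega> + integral {a..t} (\<lambda>s. r * ?Y s \<omega>) + I \<omega>)"
    by (intro exI[of _ ?I] conjI) simp_all
qed

end

section \<open>Uniqueness of the stock price\<close>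

text \<open>A left Riemann sum of an increasing exponential is below its integral.\<close>

lemma exp_grid_sum_le:
  assumes ab: "a \<le> b" and \<beta>: "0 < \<beta>"
  shows "(\<Sum>j<Suc k. exp (\<beta> * grid a b k j) * ((b - a) / real (Suc k))) \<le> exp (\<beta> * b) / \<beta>"
proof -
  let ?h = "(b - a) / real (Suc k)"
  have "exp (\<beta> * grid a b k j) * ?h \<le> (exp (\<beta> * grid a b k (Suc j)) - exp (\<beta> * grid a b k j)) / \<beta>" for j
  proof -
    have e: "grid a b k (Suc j) = grid a b k j + ?h" using grid_diff[of a b k j] by linarith
    have "exp (\<beta> * grid a b k j) * (1 + \<beta> * ?h) \<le> exp (\<beta> * grid a b k j) * exp (\<beta> * ?h)"
      by (intro mult_left_mono exp_ge_add_one_self) simp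
    also have "\<dots> = exp (\<beta> * grid a b k (Suc j))" by (simp only: e distrib_left exp_add)
    finally have "exp (\<beta> * grid a b k j) * ?h * \<beta> \<le> exp (\<beta> * grid a b k (Suc j)) - exp (\<beta> * grid a b k j)"
      by (simp add: distrib_left mult_ac del: of_nat_Suc)
    then show ?thesis using \<beta> by (simp only: pos_le_divide_eq)
  qed
  then have "(\<Sum>j<Suc k. exp (\<beta> * grid a b k j) * ?h)
    \<le> (\<Sum>j<Suc k. (exp (\<beta> * grid a b k (Suc j)) - exp (\<beta> * grid a b k j)) / \<beta>)"
    by (intro sum_mono)
  also have "\<dots> = (exp (\<beta> * b) - exp (\<beta> * a)) / \<beta>"
    unfolding sum_divide_distrib[symmetric] sum_lessThan_telescope[of "\<lambda>j. exp (\<beta> * grid a b k j)"] by simp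
  also have "\<dots> \<le> exp (\<beta> * b) / \<beta>" using \<beta> by (intro divide_right_mono) auto
  finally show ?thesis .
qed

lemma grid_universal:
  fixes f :: "real \<Rightarrow> real"
  assumes f: "continuous_on {a..b} f" and ab: "a \<le> b"
  shows "(\<forall>u\<in>{a..b}. f u \<le> c) \<longleftrightarrow> (\<forall>k. \<forall>j\<in>{..Suc k}. f (grid a b k j) \<le> c)"
proof safe
  fix k j assume "\<forall>u\<in>{a..b}. f u \<le> c" "j \<le> Suc k"
  then show "f (grid a b k j) \<le> c" using grid_bounds[OF ab] by blast
next
  fix u assume *: "\<forall>k. \<forall>j\<in>{..Suc k}. f (grid a b k j) \<le> c" and u: "u \<in> {a..b}"
  show "f u \<le> c"
  proof (rule ccontr)
    assume "\<not> f u \<le> c"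
    then have "0 < (f u - c) / 2" by simp
    from grid_dense[OF f ab u this] obtain k j where "j \<le> Suc k" "\<bar>f u - f (grid a b k j)\<bar> \<le> (f u - c) / 2" by auto
    moreover from this have "f (grid a b k j) \<le> c" using * by auto
    moreover have "f u - f (grid a b k j) \<le> \<bar>f u - f (grid a b k j)\<bar>" by (rule abs_ge_self)
    ultimately have "f u - c \<le> (f u - c) / 2" by linarith
    then show False using \<open>\<not> f u \<le> c\<close> by simp
  qed
qed

context prob_space
begin

lemma integrable_affine:
  assumes "integrable M f" "integrable M g"
  shows "integrable M (\<lambda>\<omega>. f \<omega> + 2 * g \<omega> + (c :: real))"
  using assms by simp

lemma expectation_affine:
  assumes "integrable M f" "integrable M g"
  shows "expectation (\<lambda>\<omega>. f \<omega> + 2 * g \<omega> + c) = expectation f + 2 * expectation g + (c :: real)"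
  using assms by (simp add: prob_space)

end

context brownian_motion
begin

lemma stock_price_adapted:
  assumes "stock_price M F W r \<sigma> T a x X" "\<sigma> \<noteq> 0" "t \<in> {a..T}"
  shows "X t \<in> borel_measurable (F t)"
proof -
  have "T \<in> {a..T}" using assms(3) by auto
  then obtain I where "has_ito_integral M F W (\<lambda>s \<omega>. \<sigma> * X s \<omega>) a T I"
    using assms(1) unfolding stock_price_def by blast
  then have "(\<lambda>\<omega>. \<sigma> * X t \<omega>) \<in> borel_measurable (F t)"
    using assms(3) by (auto simp: has_ito_integral_def)
  then have "(\<lambda>\<omega>. (\<sigma> * X t \<omega>) / \<sigma>) \<in> borel_measurable (F t)"
    by (intro borel_measurable_divide borel_measurable_const)
  then show ?thesis using assms(2) by simp
qed

lemma stock_price_continuous: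
  assumes "stock_price M F W r \<sigma> T a x X" "\<omega> \<in> space M"
  shows "continuous_on {a..T} (\<lambda>t. X t \<omega>)"
  using assms by (auto simp: stock_price_def)

text \<open>The difference of two solutions solves the homogeneous linear equation, in the sense of
  Riemann sums.\<close>

lemma stock_price_difference:
  assumes a: "0 \<le> a" and \<sigma>: "\<sigma> \<noteq> 0"
    and X: "stock_price M F W r \<sigma> T a x X" and X': "stock_price M F W r \<sigma> T a x X'"
    and t: "t \<in> {a..T}"
  defines "D \<equiv> \<lambda>s \<omega>. X s \<omega> - X' s \<omega>"
  shows "to_zero_in_prob M (\<lambda>k \<omega>. ennreal \<bar>(\<Sum>j<Suc k. r * D (grid a t k j) \<omega> * ((t - a) / real (Suc k)))
    + (\<Sum>j<Suc k. \<sigma> * D (grid a t k j) \<omega> * (W (grid a t k (Suc j)) \<omega> - W (grid a t k j) \<omega>)) - D t \<omega>\<bar>)"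
proof -
  have at: "a \<le> t" "{a..t} \<subseteq> {a..T}" using t by auto
  have m: "X s \<in> borel_measurable M" "X' s \<in> borel_measurable M" if "s \<in> {a..t}" for s
    using that at stock_price_adapted[OF X \<sigma>] stock_price_adapted[OF X' \<sigma>] measurable_F_M by blast+
  have c: "continuous_on {a..t} (\<lambda>s. X s \<omega>)" "continuous_on {a..t} (\<lambda>s. X' s \<omega>)" if "\<omega> \<in> space M" for \<omega>
    using continuous_on_subset[OF stock_price_continuous[OF X that] at(2)] 
      continuous_on_subset[OF stock_price_continuous[OF X' that] at(2)] by auto
  obtain I where I: "has_ito_integral M F W (\<lambda>s \<omega>. \<sigma> * X s \<omega>) a t I"
    "AE \<omega> in M. X t \<omega> = X a \<omega> + integral {a..t} (\<lambda>s. r * X s \<omega>) + I \<omega>"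
    using X t unfolding stock_price_def by blast
  obtain I' where I': "has_ito_integral M F W (\<lambda>s \<omega>. \<sigma> * X' s \<omega>) a t I'"
    "AE \<omega> in M. X' t \<omega> = X' a \<omega> + integral {a..t} (\<lambda>s. r * X' s \<omega>) + I' \<omega>"
    using X' t unfolding stock_price_def by blast
  let ?dW = "\<lambda>k j \<omega>. W (grid a t k (Suc j)) \<omega> - W (grid a t k j) \<omega>"
  let ?h = "\<lambda>k. (t - a) / real (Suc k)"
  have 1: "to_zero_in_prob M (\<lambda>k \<omega>. ennreal \<bar>(\<Sum>j<Suc k. \<sigma> * X (grid a t k j) \<omega> * ?dW k j \<omega>) - I \<omega>\<bar>)"
    by (rule ito_integral_riemann[OF a at(1) I(1)]) (intro continuous_intros c)
  have 2: "to_zero_in_prob M (\<lambda>k \<omega>. ennreal \<bar>(\<Sum>j<Suc k. \<sigma> * X' (grid a t k j) \<omega> * ?dW k j \<omega>) - I' \<omega>\<bar>)"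
    by (rule ito_integral_riemann[OF a at(1) I'(1)]) (intro continuous_intros c)
  have 3: "to_zero_in_prob M (\<lambda>k \<omega>. ennreal \<bar>(\<Sum>j<Suc k. r * D (grid a t k j) \<omega> * ?h k)
    - integral {a..t} (\<lambda>s. r * D s \<omega>)\<bar>)"
    by (rule riemann_sum_to_zero_in_prob[where X = "\<lambda>s \<omega>. r * D s \<omega>", OF at(1)])
      (auto simp: D_def intro!: borel_measurable_times borel_measurable_diff continuous_intros m c)
  from to_zero_in_prob_add[OF to_zero_in_prob_add[OF 1 2] 3]
  show ?thesis
  proof (rule to_zero_in_prob_mono_AE)
    fix k
    have g: "grid a t k j \<in> {a..t}" if "j \<le> Suc k" for j using grid_bounds[OF at(1) that] .
    have D: "D s \<in> borel_measurable M" if "s \<in> {a..t}" for s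
      unfolding D_def using m[OF that] by (intro borel_measurable_diff)
    have "(\<lambda>\<omega>. (\<Sum>j<Suc k. r * D (grid a t k j) \<omega> * ?h k)
      + (\<Sum>j<Suc k. \<sigma> * D (grid a t k j) \<omega> * ?dW k j \<omega>) - D t \<omega>) \<in> borel_measurable M"
      using g at(1) a by (intro borel_measurable_add borel_measurable_sum borel_measurable_times 
        borel_measurable_diff borel_measurable_const D W_measurable_M) (auto intro: order_trans[OF a])
    then show "(\<lambda>\<omega>. ennreal \<bar>(\<Sum>j<Suc k. r * D (grid a t k j) \<omega> * ?h k)
      + (\<Sum>j<Suc k. \<sigma> * D (grid a t k j) \<omega> * ?dW k j \<omega>) - D t \<omega>\<bar>) \<in> borel_measurable M"
      by measurable
    have s: "AE \<omega> in M. X a \<omega> = x" "AE \<omega> in M. X' a \<omega> = x" using X X' by (auto simp: stock_price_def)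
    show "AE \<omega> in M. ennreal \<bar>(\<Sum>j<Suc k. r * D (grid a t k j) \<omega> * ?h k)
      + (\<Sum>j<Suc k. \<sigma> * D (grid a t k j) \<omega> * ?dW k j \<omega>) - D t \<omega>\<bar>
      \<le> ennreal \<bar>(\<Sum>j<Suc k. \<sigma> * X (grid a t k j) \<omega> * ?dW k j \<omega>) - I \<omega>\<bar>
       + ennreal \<bar>(\<Sum>j<Suc k. \<sigma> * X' (grid a t k j) \<omega> * ?dW k j \<omega>) - I' \<omega>\<bar>
       + ennreal \<bar>(\<Sum>j<Suc k. r * D (grid a t k j) \<omega> * ?h k) - integral {a..t} (\<lambda>s. r * D s \<omega>)\<bar>"
      using s I(2) I'(2) AE_space
    proof eventually_elim
      case (elim \<omega>)
      have int: "integral {a..t} (\<lambda>s. r * D s \<omega>) = integral {a..t} (\<lambda>s. r * X s \<omega>) - integral {a..t} (\<lambda>s. r * X' s \<omega>)"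
        unfolding D_def right_diff_distrib
        by (intro Henstock_Kurzweil_Integration.integral_diff integrable_continuous_real continuous_intros c elim)
      have sm: "(\<Sum>j<Suc k. \<sigma> * D (grid a t k j) \<omega> * ?dW k j \<omega>)
        = (\<Sum>j<Suc k. \<sigma> * X (grid a t k j) \<omega> * ?dW k j \<omega>) - (\<Sum>j<Suc k. \<sigma> * X' (grid a t k j) \<omega> * ?dW k j \<omega>)"
        unfolding sum_subtractf[symmetric] by (intro sum.cong refl) (simp add: D_def algebra_simps)
      have "D t \<omega> = integral {a..t} (\<lambda>s. r * D s \<omega>) + I \<omega> - I' \<omega>"
        unfolding int using elim by (simp add: D_def)
      then have "\<bar>(\<Sum>j<Suc k. r * D (grid a t k j) \<omega> * ?h k)
        + (\<Sum>j<Suc k. \<sigma> * D (grid a t k j) \<omega> * ?dW k j \<omega>) - D t \<omega>\<bar>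
        \<le> (\<bar>(\<Sum>j<Suc k. \<sigma> * X (grid a t k j) \<omega> * ?dW k j \<omega>) - I \<omega>\<bar>
         + \<bar>(\<Sum>j<Suc k. \<sigma> * X' (grid a t k j) \<omega> * ?dW k j \<omega>) - I' \<omega>\<bar>)
         + \<bar>(\<Sum>j<Suc k. r * D (grid a t k j) \<omega> * ?h k) - integral {a..t} (\<lambda>s. r * D s \<omega>)\<bar>"
        unfolding sm by linarith
      from ennreal_leI[OF this] show ?case
        by (simp only: ennreal_plus add_nonneg_nonneg abs_ge_zero)
    qed
  qed
qed

text \<open>A bounded truncation of a solution of the homogeneous equation vanishes: its second moment
  satisfies a Gronwall inequality, which the weight \<open>exp (\<beta> t)\<close> turns into a contraction.\<close>

lemma homogeneous_solution_zero:
  fixes D :: "real \<Rightarrow> 'a \<Rightarrow> real"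
  assumes a: "0 \<le> a" 
    and D_F: "\<And>t. t \<in> {a..T} \<Longrightarrow> D t \<in> borel_measurable (F t)"
    and D_cont: "\<And>\<omega>. \<omega> \<in> space M \<Longrightarrow> continuous_on {a..T} (\<lambda>t. D t \<omega>)"
    and eq: "\<And>t. t \<in> {a..T} \<Longrightarrow> to_zero_in_prob M (\<lambda>k \<omega>. ennreal
      \<bar>(\<Sum>j<Suc k. r * D (grid a t k j) \<omega> * ((t - a) / real (Suc k)))
      + (\<Sum>j<Suc k. \<sigma> * D (grid a t k j) \<omega> * (W (grid a t k (Suc j)) \<omega> - W (grid a t k j) \<omega>)) - D t \<omega>\<bar>)"
    and t: "t \<in> {a..T}"
  shows "AE \<omega> in M. D t \<omega> = 0"
proof -
  \<comment> \<open>\<open>G N s\<close> is decided at time \<open>s\<close> and shrinks with \<open>s\<close>, so the truncated integrand stays adapted and agrees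
    with \<open>D\<close> at all earlier times on \<open>G N t\<close>.\<close>
  define G where "G N s \<omega> \<longleftrightarrow> (\<forall>u\<in>{a..s}. \<bar>D u \<omega>\<bar> \<le> real N)" for N s \<omega>
  define Z where "Z N s \<omega> = (if G N s \<omega> then D s \<omega> else 0)" for N s \<omega>
  define C where "C = 2 * r\<^sup>2 * (T - a) + 2 * \<sigma>\<^sup>2"
  have T: "a \<le> T" using t by auto
  have C: "0 \<le> C" using T by (auto simp: C_def)
  \<comment> \<open>With this weight the factor \<open>2 C / \<beta>\<close> of the Gronwall step is at most \<open>1 / 2\<close>.\<close>
  define \<beta> where "\<beta> = 4 * C + 1"
  have \<beta>: "0 < \<beta>" using C by (auto simp: \<beta>_def)
  have G_meas: "Measurable.pred (F s) (G N s)" if s: "s \<in> {a..T}" for N s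
  proof -
    have as: "a \<le> s" using s by auto
    have "Measurable.pred (F s) (\<lambda>\<omega>. \<forall>k. \<forall>j\<in>{..Suc k}. \<bar>D (grid a s k j) \<omega>\<bar> \<le> real N)"
    proof (intro pred_intros_countable pred_intros_finite)
      fix k j assume "j \<in> {..Suc k}"
      then have "grid a s k j \<in> {a..s}" using grid_bounds[OF as] by auto
      then have [measurable]: "D (grid a s k j) \<in> borel_measurable (F s)"
        using s by (intro measurable_F_mono[OF D_F]) auto
      show "Measurable.pred (F s) (\<lambda>\<omega>. \<bar>D (grid a s k j) \<omega>\<bar> \<le> real N)" by measurable
    qed auto
    also have "?this \<longleftrightarrow> Measurable.pred (F s) (G N s)"
    proof (rule measurable_cong)
      fix \<omega> assume "\<omega> \<in> space (F s)"
      then have "continuous_on {a..s} (\<lambda>u. \<bar>D u \<omega>\<bar>)"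
        using s space_F by (intro continuous_intros continuous_on_subset[OF D_cont]) auto
      from grid_universal[OF this as]
      show "(\<forall>k. \<forall>j\<in>{..Suc k}. \<bar>D (grid a s k j) \<omega>\<bar> \<le> real N) = G N s \<omega>" by (simp add: G_def)
    qed
    finally show ?thesis .
  qed
  have Z_F: "Z N s \<in> borel_measurable (F s)" if s: "s \<in> {a..T}" for N s
  proof -
    note [measurable] = G_meas[OF s] D_F[OF s]
    show ?thesis unfolding Z_def[abs_def] by measurable
  qed
  have Z_M: "Z N s \<in> borel_measurable M" if "s \<in> {a..T}" for N s using measurable_F_M[OF Z_F[OF that]] .
  have Z_bd: "\<bar>Z N s \<omega>\<bar> \<le> real N" if "s \<in> {a..T}" for N s \<omega>
    using that by (auto simp: Z_def G_def)
  have Z2_bd: "(Z N s \<omega>)\<^sup>2 \<le> (real N)\<^sup>2" if "s \<in> {a..T}" for N s \<omega>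
    using Z_bd[OF that, of N \<omega>] by (simp add: abs_le_square_iff[symmetric])
  have Z_int: "integrable M (\<lambda>\<omega>. (Z N s \<omega>)\<^sup>2)" if "s \<in> {a..T}" for N s
    using Z2_bd[OF that] Z_M[OF that, of N]
    by (intro integrable_const_bound[where B = "(real N)\<^sup>2"]) (auto simp: )
  define \<phi> where "\<phi> N s = expectation (\<lambda>\<omega>. (Z N s \<omega>)\<^sup>2)" for N s
  have step: "\<phi> N s \<le> (b / 2) * exp (\<beta> * s)"
    if b: "0 \<le> b" and le: "\<And>u. u \<in> {a..T} \<Longrightarrow> \<phi> N u \<le> b * exp (\<beta> * u)" and s: "s \<in> {a..T}" for N b s
  proof -
    have as: "a \<le> s" "s \<le> T" using s by auto
    let ?h = "\<lambda>k. (s - a) / real (Suc k)"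
    let ?dW = "\<lambda>k j \<omega>. W (grid a s k (Suc j)) \<omega> - W (grid a s k j) \<omega>"
    define A where "A k \<omega> = (\<Sum>j<Suc k. r * Z N (grid a s k j) \<omega> * ?h k)" for k \<omega>
    define B where "B k \<omega> = (\<Sum>j<Suc k. (\<sigma> * Z N (grid a s k j) \<omega>) * ?dW k j \<omega>)" for k \<omega>
    define S where "S k \<omega> = (\<Sum>j<Suc k. r * D (grid a s k j) \<omega> * ?h k)
      + (\<Sum>j<Suc k. \<sigma> * D (grid a s k j) \<omega> * ?dW k j \<omega>)" for k \<omega>
    have g: "grid a s k j \<in> {a..T}" if "j \<le> Suc k" for k j
      using grid_bounds[OF as(1) that] as by auto
    have g0: "0 \<le> grid a s k j" if "j \<le> Suc k" for k j using g[OF that] a by auto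
    have os: "integrable M (\<lambda>\<omega>. (B k \<omega>)\<^sup>2) \<and> B k \<in> borel_measurable (F (grid a s k (Suc k))) \<and>
      expectation (\<lambda>\<omega>. (B k \<omega>)\<^sup>2)
        = (\<Sum>j<Suc k. expectation (\<lambda>\<omega>. (\<sigma> * Z N (grid a s k j) \<omega>)\<^sup>2) * expectation (\<lambda>\<omega>. (?dW k j \<omega>)\<^sup>2))" for k
      unfolding B_def[abs_def]
    proof (rule orthogonal_sum)
      fix j assume j: "j < Suc k"
      have i: "0 \<le> grid a s k j" "grid a s k j \<le> grid a s k (Suc j)"
        using g0[of j k] as j by (auto intro!: grid_mono)
      show "grid a s k j \<le> grid a s k (Suc j)" by fact
      show "(\<lambda>\<omega>. \<sigma> * Z N (grid a s k j) \<omega>) \<in> borel_measurable (F (grid a s k j))"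
        using g[of j k] j by (intro borel_measurable_times borel_measurable_const Z_F) auto
      show "integrable M (\<lambda>\<omega>. (\<sigma> * Z N (grid a s k j) \<omega>)\<^sup>2)"
        using g[of j k] j Z_int by (auto simp: power_mult_distrib)
      have [measurable]: "W (grid a s k (Suc j)) \<in> borel_measurable (F (grid a s k (Suc j)))"
        "W (grid a s k j) \<in> borel_measurable (F (grid a s k (Suc j)))"
        using i by (auto intro!: W_measurable_F)
      show "?dW k j \<in> borel_measurable (F (grid a s k (Suc j)))" by measurable
      show "integrable M (\<lambda>\<omega>. (?dW k j \<omega>)\<^sup>2)" "expectation (?dW k j) = 0"
        using increment_moments[OF i] by auto
      show "indep_var borel U borel (?dW k j)" if "U \<in> borel_measurable (F (grid a s k j))" for U
        using increment_indep[OF i that] .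
    qed
    have B_M[measurable]: "B k \<in> borel_measurable M" for k using os measurable_F_M by blast
    have A_M[measurable]: "A k \<in> borel_measurable M" for k
      unfolding A_def[abs_def] using g[of _ k]
      by (intro borel_measurable_sum borel_measurable_times borel_measurable_const Z_M) auto
    have S_M[measurable]: "S k \<in> borel_measurable M" for k
      unfolding S_def[abs_def] using g[of _ k] g0[of _ k] 
      by (intro borel_measurable_add borel_measurable_sum borel_measurable_times borel_measurable_diff
          borel_measurable_const W_measurable_M measurable_F_M[OF D_F]) auto
    have dW2: "expectation (\<lambda>\<omega>. (?dW k j \<omega>)\<^sup>2) = ?h k" if "j < Suc k" for k j
      using increment_moments(4)[of "grid a s k j" "grid a s k (Suc j)"] g0[of j k] that as 
      by (simp add: grid_diff grid_mono del: of_nat_Suc)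
    have EB: "expectation (\<lambda>\<omega>. (B k \<omega>)\<^sup>2) = \<sigma>\<^sup>2 * (\<Sum>j<Suc k. \<phi> N (grid a s k j) * ?h k)" for k
    proof -
      have "expectation (\<lambda>\<omega>. (B k \<omega>)\<^sup>2) = (\<Sum>j<Suc k. \<sigma>\<^sup>2 * (\<phi> N (grid a s k j) * ?h k))"
        unfolding os[THEN conjunct2, THEN conjunct2]
        by (intro sum.cong refl) (simp add: dW2 power_mult_distrib \<phi>_def del: of_nat_Suc)
      then show ?thesis by (simp only: sum_distrib_left)
    qed
    have A_le: "(A k \<omega>)\<^sup>2 \<le> r\<^sup>2 * (s - a) * (\<Sum>j<Suc k. (Z N (grid a s k j) \<omega>)\<^sup>2 * ?h k)" for k \<omega>
    proof -
      have "(A k \<omega>)\<^sup>2 = r\<^sup>2 * (?h k)\<^sup>2 * (\<Sum>j<Suc k. Z N (grid a s k j) \<omega>)\<^sup>2"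
        unfolding A_def sum_distrib_right[symmetric] sum_distrib_left[symmetric] by (simp only: power_mult_distrib mult_ac)
      also have "(\<Sum>j<Suc k. Z N (grid a s k j) \<omega>)\<^sup>2 \<le> real (Suc k) * (\<Sum>j<Suc k. (Z N (grid a s k j) \<omega>)\<^sup>2)"
        using sum_squared_le_sum_of_squares[of "\<lambda>j. Z N (grid a s k j) \<omega>" "{..<Suc k}"] by (simp only: card_lessThan mult.commute)
      finally have "(A k \<omega>)\<^sup>2 \<le> r\<^sup>2 * (?h k)\<^sup>2 * (real (Suc k) * (\<Sum>j<Suc k. (Z N (grid a s k j) \<omega>)\<^sup>2))"
        by (simp add: mult_left_mono)
      also have "\<dots> = r\<^sup>2 * (s - a) * (\<Sum>j<Suc k. (Z N (grid a s k j) \<omega>)\<^sup>2 * ?h k)"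
      proof -
        have h2: "(?h k)\<^sup>2 * real (Suc k) = (s - a) * ?h k" by (simp add: power2_eq_square del: of_nat_Suc)
        have alg: "R * H * (n * Q) = R * ((H * n) * Q)" "R * ((L * m) * Q) = R * (L * Q * m)" for R H n Q L m :: real
          by (simp_all add: mult_ac)
        show ?thesis unfolding sum_distrib_right[symmetric] alg(1) h2 by (rule alg(2))
      qed
      finally show ?thesis .
    qed
    have Zs_int: "integrable M (\<lambda>\<omega>. (\<Sum>j<Suc k. (Z N (grid a s k j) \<omega>)\<^sup>2 * ?h k))" for k
      using g[of _ k] by (intro Bochner_Integration.integrable_sum integrable_mult_left Z_int) auto
    have A_int: "integrable M (\<lambda>\<omega>. (A k \<omega>)\<^sup>2)" for k
      using A_le by (intro Bochner_Integration.integrable_bound[OF integrable_mult_right[OF Zs_int, of "r\<^sup>2 * (s - a)" k]])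
        (auto intro: order_trans[OF _ abs_ge_self])
    have EA: "expectation (\<lambda>\<omega>. (A k \<omega>)\<^sup>2) \<le> r\<^sup>2 * (s - a) * (\<Sum>j<Suc k. \<phi> N (grid a s k j) * ?h k)" for k
    proof -
      have "expectation (\<lambda>\<omega>. (A k \<omega>)\<^sup>2) \<le> expectation (\<lambda>\<omega>. r\<^sup>2 * (s - a) * (\<Sum>j<Suc k. (Z N (grid a s k j) \<omega>)\<^sup>2 * ?h k))"
        by (intro integral_mono A_int integrable_mult_right Zs_int A_le)
      also have "\<dots> = r\<^sup>2 * (s - a) * (\<Sum>j<Suc k. expectation (\<lambda>\<omega>. (Z N (grid a s k j) \<omega>)\<^sup>2 * ?h k))"
        unfolding integral_mult_right_zero using g[of _ k]
        by (subst Bochner_Integration.integral_sum) (auto intro!: integrable_mult_left Z_int)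
      finally show ?thesis by (simp only: integral_mult_left_zero \<phi>_def)
    qed
    have AB: "expectation (\<lambda>\<omega>. 2 * (A k \<omega>)\<^sup>2 + 2 * (B k \<omega>)\<^sup>2) \<le> C * b * exp (\<beta> * s) / \<beta>" for k
    proof -
      have sum_nn: "0 \<le> (\<Sum>j<Suc k. \<phi> N (grid a s k j) * ?h k)"
        using as by (intro sum_nonneg mult_nonneg_nonneg) (auto simp: \<phi>_def)
      have "expectation (\<lambda>\<omega>. 2 * (A k \<omega>)\<^sup>2 + 2 * (B k \<omega>)\<^sup>2)
        = 2 * expectation (\<lambda>\<omega>. (A k \<omega>)\<^sup>2) + 2 * expectation (\<lambda>\<omega>. (B k \<omega>)\<^sup>2)"
        using A_int os by simp
      also have "\<dots> \<le> 2 * (r\<^sup>2 * (s - a) * (\<Sum>j<Suc k. \<phi> N (grid a s k j) * ?h k))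
         + 2 * (\<sigma>\<^sup>2 * (\<Sum>j<Suc k. \<phi> N (grid a s k j) * ?h k))"
        using EA[of k] EB[of k] by simp
      also have "\<dots> = (2 * r\<^sup>2 * (s - a) + 2 * \<sigma>\<^sup>2) * (\<Sum>j<Suc k. \<phi> N (grid a s k j) * ?h k)"
        by (simp only: algebra_simps)
      also have "\<dots> \<le> C * (\<Sum>j<Suc k. \<phi> N (grid a s k j) * ?h k)"
        using as sum_nn by (intro mult_right_mono) (auto simp: C_def intro!: mult_left_mono)
      also have "\<dots> \<le> C * (\<Sum>j<Suc k. b * exp (\<beta> * grid a s k j) * ?h k)"
        using g[of _ k] as C by (intro mult_left_mono sum_mono mult_right_mono le) auto
      also have "(\<Sum>j<Suc k. b * exp (\<beta> * grid a s k j) * ?h k) = b * (\<Sum>j<Suc k. exp (\<beta> * grid a s k j) * ?h k)"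
        by (simp only: sum_distrib_left mult.assoc)
      also have "C * (b * (\<Sum>j<Suc k. exp (\<beta> * grid a s k j) * ?h k)) \<le> C * (b * (exp (\<beta> * s) / \<beta>))"
        using C b by (intro mult_left_mono exp_grid_sum_le as \<beta>)
      finally show ?thesis by simp
    qed
    have lim: "(\<lambda>k. prob {\<omega> \<in> space M. ennreal \<epsilon> < ennreal \<bar>S k \<omega> - D s \<omega>\<bar>}) \<longlonglongrightarrow> 0" if "0 < \<epsilon>" for \<epsilon>
      using eq[OF s] that unfolding S_def to_zero_in_prob_def by blast
    \<comment> \<open>\<open>D s\<close> is only a limit in probability of its Riemann sums; on the exceptional event the truncation bound
      \<open>N\<^sup>2\<close> is used.\<close>
    have main: "\<phi> N s \<le> (real N)\<^sup>2 * prob {\<omega> \<in> space M. ennreal \<epsilon> < ennreal \<bar>S k \<omega> - D s \<omega>\<bar>}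
       + (2 * (C * b * exp (\<beta> * s) / \<beta>) + 2 * \<epsilon>\<^sup>2)" if \<epsilon>: "0 < \<epsilon>" for \<epsilon> k
    proof -
      let ?E = "{\<omega> \<in> space M. ennreal \<epsilon> < ennreal \<bar>S k \<omega> - D s \<omega>\<bar>}"
      have [measurable]: "D s \<in> borel_measurable M" by (rule measurable_F_M[OF D_F[OF s]])
      have E: "?E \<in> sets M" by measurable
      have pw: "(Z N s \<omega>)\<^sup>2 \<le> (real N)\<^sup>2 * indicator ?E \<omega> + 2 * (2 * (A k \<omega>)\<^sup>2 + 2 * (B k \<omega>)\<^sup>2) + 2 * \<epsilon>\<^sup>2"
        if \<omega>: "\<omega> \<in> space M" for \<omega>
      proof (cases "\<omega> \<in> ?E \<or> \<not> G N s \<omega>")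
        case True
        then have "(Z N s \<omega>)\<^sup>2 \<le> (real N)\<^sup>2 * indicator ?E \<omega>"
          using Z2_bd[OF s, of N \<omega>] by (auto simp: Z_def)
        then show ?thesis by (simp add: add_increasing2)
      next
        case False
        then have G: "G N s \<omega>" and "\<bar>S k \<omega> - D s \<omega>\<bar> \<le> \<epsilon>"
          using \<omega> \<epsilon> by (auto simp: ennreal_less_iff)
        have ZD: "Z N (grid a s k j) \<omega> = D (grid a s k j) \<omega>" if "j \<le> Suc k" for j
          using G grid_bounds[OF as(1) that] by (auto simp: Z_def G_def)
        have SAB: "S k \<omega> = A k \<omega> + B k \<omega>"
          unfolding S_def A_def B_def by (intro arg_cong2[where f = "(+)"] sum.cong refl) (auto simp: ZD)
        have bound: "d \<le> i + 2 * w + 2 * e" if "d \<le> 2 * q + 2 * z" "q \<le> w" "z \<le> e" "0 \<le> i" for d i w e q z :: real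
          using that by linarith
        from SAB have "(A k \<omega> + B k \<omega>) + (D s \<omega> - S k \<omega>) = D s \<omega>" by simp
        with power2_sum_le[of "A k \<omega> + B k \<omega>" "D s \<omega> - S k \<omega>"]
        have "(D s \<omega>)\<^sup>2 \<le> 2 * (A k \<omega> + B k \<omega>)\<^sup>2 + 2 * (D s \<omega> - S k \<omega>)\<^sup>2" by (simp only:)
        moreover have "(A k \<omega> + B k \<omega>)\<^sup>2 \<le> 2 * (A k \<omega>)\<^sup>2 + 2 * (B k \<omega>)\<^sup>2" by (rule power2_sum_le)
        moreover have "(D s \<omega> - S k \<omega>)\<^sup>2 \<le> \<epsilon>\<^sup>2"
          using \<open>\<bar>S k \<omega> - D s \<omega>\<bar> \<le> \<epsilon>\<close> \<epsilon> by (simp add: abs_le_square_iff[symmetric])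
        moreover have "0 \<le> (real N)\<^sup>2 * indicator ?E \<omega>" by simp
        ultimately have "(D s \<omega>)\<^sup>2 \<le> (real N)\<^sup>2 * indicator ?E \<omega> + 2 * (2 * (A k \<omega>)\<^sup>2 + 2 * (B k \<omega>)\<^sup>2) + 2 * \<epsilon>\<^sup>2"
          by (rule bound)
        then show ?thesis using G by (simp only: Z_def if_True)
      qed
      have i1: "integrable M (\<lambda>\<omega>. (real N)\<^sup>2 * indicator ?E \<omega>)"
        using E by (intro integrable_mult_right integrable_real_indicator) (auto simp: emeasure_eq_measure)
      have i2: "integrable M (\<lambda>\<omega>. 2 * (A k \<omega>)\<^sup>2 + 2 * (B k \<omega>)\<^sup>2)" using A_int os by simp
      have "\<phi> N s \<le> expectation (\<lambda>\<omega>. (real N)\<^sup>2 * indicator ?E \<omega> + 2 * (2 * (A k \<omega>)\<^sup>2 + 2 * (B k \<omega>)\<^sup>2) + 2 * \<epsilon>\<^sup>2)"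
        unfolding \<phi>_def
        by (intro integral_mono Z_int s pw integrable_affine[OF i1 i2])
      also have "\<dots> = (real N)\<^sup>2 * prob ?E + 2 * expectation (\<lambda>\<omega>. 2 * (A k \<omega>)\<^sup>2 + 2 * (B k \<omega>)\<^sup>2) + 2 * \<epsilon>\<^sup>2"
        unfolding expectation_affine[OF i1 i2] using E by (simp add: Int_absorb2 sets.sets_into_space)
      finally show ?thesis using AB[of k] by linarith
    qed
    have le2: "\<phi> N s \<le> 2 * (C * b * exp (\<beta> * s) / \<beta>) + 2 * \<epsilon>\<^sup>2" if \<epsilon>: "0 < \<epsilon>" for \<epsilon>
    proof (rule LIMSEQ_le_const)
      have "(\<lambda>k. (real N)\<^sup>2 * prob {\<omega> \<in> space M. ennreal \<epsilon> < ennreal \<bar>S k \<omega> - D s \<omega>\<bar>}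
       + (2 * (C * b * exp (\<beta> * s) / \<beta>) + 2 * \<epsilon>\<^sup>2)) \<longlonglongrightarrow> (real N)\<^sup>2 * 0 + (2 * (C * b * exp (\<beta> * s) / \<beta>) + 2 * \<epsilon>\<^sup>2)"
        by (intro tendsto_intros lim \<epsilon>)
      then show "(\<lambda>k. (real N)\<^sup>2 * prob {\<omega> \<in> space M. ennreal \<epsilon> < ennreal \<bar>S k \<omega> - D s \<omega>\<bar>}
       + (2 * (C * b * exp (\<beta> * s) / \<beta>) + 2 * \<epsilon>\<^sup>2)) \<longlonglongrightarrow> (2 * (C * b * exp (\<beta> * s) / \<beta>) + 2 * \<epsilon>\<^sup>2)" by simp
    qed (use main[OF \<epsilon>] in blast)
    have "\<phi> N s \<le> 2 * (C * b * exp (\<beta> * s) / \<beta>)"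
    proof (rule field_le_epsilon)
      fix e :: real assume "0 < e"
      then show "\<phi> N s \<le> 2 * (C * b * exp (\<beta> * s) / \<beta>) + e"
        using le2[of "sqrt (e / 2)"] by simp
    qed
    also have "\<dots> = (b * exp (\<beta> * s)) * (2 * C / \<beta>)" by simp
    also have "\<dots> \<le> (b * exp (\<beta> * s)) * (1 / 2)"
      using \<beta> b by (intro mult_left_mono) (auto simp: \<beta>_def divide_le_eq)
    finally show ?thesis by simp
  qed
  \<comment> \<open>Iterating the contraction, starting from the trivial bound \<open>N\<^sup>2\<close>.\<close>
  have "\<phi> N s \<le> ((real N)\<^sup>2 / 2 ^ n) * exp (\<beta> * s)" if "s \<in> {a..T}" for N n s
    using that
  proof (induction n arbitrary: s)
    case 0
    have "\<phi> N s \<le> expectation (\<lambda>\<omega>. (real N)\<^sup>2)"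
      unfolding \<phi>_def using 0 by (intro integral_mono Z_int Z2_bd) auto
    also have "\<dots> = (real N)\<^sup>2" by (simp add: prob_space)
    also have "\<dots> \<le> (real N)\<^sup>2 * exp (\<beta> * s)"
    proof -
      have "1 \<le> exp (\<beta> * s)" using 0 a \<beta> by simp
      from mult_left_mono[OF this, of "(real N)\<^sup>2"] show ?thesis by simp
    qed
    finally show ?case by simp
  next
    case (Suc n)
    from step[OF _ Suc.IH Suc.prems] show ?case by simp
  qed
  note bound = this[OF t]
  have "AE \<omega> in M. Z N t \<omega> = 0" for N
  proof -
    have "\<phi> N t \<le> 0"
    proof (rule LIMSEQ_le_const)
      have "(\<lambda>n. (real N)\<^sup>2 * exp (\<beta> * t) * (1 / 2) ^ n) \<longlonglongrightarrow> (real N)\<^sup>2 * exp (\<beta> * t) * 0"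
        by (intro tendsto_mult tendsto_const LIMSEQ_realpow_zero) auto
      then show "(\<lambda>n. ((real N)\<^sup>2 / 2 ^ n) * exp (\<beta> * t)) \<longlonglongrightarrow> 0" by (simp add: power_one_over field_simps)
    qed (use bound in blast)
    moreover have "0 \<le> \<phi> N t" unfolding \<phi>_def by (rule Bochner_Integration.integral_nonneg) simp
    ultimately have "expectation (\<lambda>\<omega>. (Z N t \<omega>)\<^sup>2) = 0" unfolding \<phi>_def by (rule antisym)
    then have "AE \<omega> in M. (Z N t \<omega>)\<^sup>2 = 0"
      using integral_nonneg_eq_0_iff_AE[OF Z_int[OF t, of N]] by simp
    then show ?thesis by simp
  qed
  then have "AE \<omega> in M. \<forall>N. Z N t \<omega> = 0" by (simp add: AE_all_countable)
  then show ?thesis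
    using AE_space
  proof eventually_elim
    case (elim \<omega>)
    have "continuous_on {a..t} (\<lambda>u. D u \<omega>)" using t by (intro continuous_on_subset[OF D_cont[OF elim(2)]]) auto
    then have "bounded ((\<lambda>u. D u \<omega>) ` {a..t})" by (intro compact_imp_bounded compact_continuous_image) auto
    then obtain b where b: "\<forall>u\<in>{a..t}. \<bar>D u \<omega>\<bar> \<le> b" unfolding bounded_iff by auto
    obtain N where "b \<le> real N" using real_arch_simple by blast
    then have "G N t \<omega>" using b by (auto simp: G_def intro: order_trans)
    then show ?case using elim(1) by (metis Z_def)
  qed
qed

lemma stock_price_unique:
  assumes a: "0 \<le> a" and \<sigma>: "\<sigma> \<noteq> 0"
    and X: "stock_price M F W r \<sigma> T a x X" and X': "stock_price M F W r \<sigma> T a x X'"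
  shows "AE \<omega> in M. \<forall>t\<in>{a..T}. X t \<omega> = X' t \<omega>"
proof (cases "a \<le> T")
  case True
  let ?D = "\<lambda>t \<omega>. X t \<omega> - X' t \<omega>"
  have cont: "continuous_on {a..T} (\<lambda>t. ?D t \<omega>)" if "\<omega> \<in> space M" for \<omega>
    by (intro continuous_intros stock_price_continuous[OF X that] stock_price_continuous[OF X' that])
  have "AE \<omega> in M. ?D t \<omega> = 0" if "t \<in> {a..T}" for t
  proof (rule homogeneous_solution_zero[OF a _ cont _ that])
    show "?D t \<in> borel_measurable (F t)" if "t \<in> {a..T}" for t
      using stock_price_adapted[OF X \<sigma> that] stock_price_adapted[OF X' \<sigma> that] by (intro borel_measurable_diff)
  qed (use stock_price_difference[OF a \<sigma> X X'] in auto)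
  then have "AE \<omega> in M. \<forall>k. \<forall>j\<in>{..Suc k}. ?D (grid a T k j) \<omega> = 0"
    using grid_bounds[OF True] by (simp add: AE_all_countable AE_ball_countable)
  then show ?thesis
    using AE_space
  proof eventually_elim
    case (elim \<omega>)
    have "continuous_on {a..T} (\<lambda>t. \<bar>?D t \<omega>\<bar>)" using cont[OF elim(2)] by (rule continuous_on_rabs)
    from grid_universal[OF this True, of 0] elim(1) show ?case by auto
  qed
qed auto

end

section \<open>One-step expansion\<close>

text \<open>\<open>v\<close> is once differentiable in time and twice in space on \<open>\<real> \<times> [0, T)\<close>, with the given continuous
  derivatives. The time derivative is taken within \<open>[0, T]\<close>, so it is one-sided at time 0. No bound on the
  derivatives as \<open>x\<close> tends to infinity or \<open>t\<close> to \<open>T\<close> is required.\<close>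

definition C12 :: "real \<Rightarrow> (real \<Rightarrow> real \<Rightarrow> real) \<Rightarrow> (real \<Rightarrow> real \<Rightarrow> real) \<Rightarrow>
    (real \<Rightarrow> real \<Rightarrow> real) \<Rightarrow> (real \<Rightarrow> real \<Rightarrow> real) \<Rightarrow> bool" where
  "C12 T v vt vx vxx \<longleftrightarrow>
     continuous_on (UNIV \<times> {0..<T}) (\<lambda>(x, t). vt x t) \<and>
     continuous_on (UNIV \<times> {0..<T}) (\<lambda>(x, t). vx x t) \<and>
     continuous_on (UNIV \<times> {0..<T}) (\<lambda>(x, t). vxx x t) \<and>
     (\<forall>x. \<forall>t\<in>{0..<T}.
        ((\<lambda>s. v x s) has_real_derivative vt x t) (at t within {0..T}) \<and>
        ((\<lambda>y. v y t) has_real_derivative vx x t) (at x) \<and>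
        ((\<lambda>y. vx y t) has_real_derivative vxx x t) (at x))"

lemma uniformly_close_on_compact:
  fixes f :: "real \<times> real \<Rightarrow> real"
  assumes "continuous_on (UNIV \<times> {0..<T}) f" "T' < T" "0 < e"
  shows "\<exists>d>0. \<forall>x t x' t'. \<bar>x\<bar> \<le> R \<and> \<bar>x'\<bar> \<le> R \<and> t \<in> {0..T'} \<and> t' \<in> {0..T'} \<and> \<bar>x - x'\<bar> \<le> d \<and> \<bar>t - t'\<bar> \<le> d
    \<longrightarrow> \<bar>f (x, t) - f (x', t')\<bar> \<le> e"
proof -
  let ?K = "{-R..R} \<times> {0..T'}"
  have "compact ?K" by (intro compact_Times compact_Icc)
  moreover have "continuous_on ?K f" using assms by (elim continuous_on_subset) auto
  ultimately have "uniformly_continuous_on ?K f" by (rule compact_uniformly_continuous[rotated])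
  then obtain d where d: "d > 0" "\<And>p q. p \<in> ?K \<Longrightarrow> q \<in> ?K \<Longrightarrow> dist q p < d \<Longrightarrow> dist (f q) (f p) < e"
    using assms(3) unfolding uniformly_continuous_on_def by metis
  show ?thesis
  proof (intro exI[of _ "d / 3"] conjI allI impI)
    fix x t x' t'
    assume *: "\<bar>x\<bar> \<le> R \<and> \<bar>x'\<bar> \<le> R \<and> t \<in> {0..T'} \<and> t' \<in> {0..T'} \<and> \<bar>x - x'\<bar> \<le> d / 3 \<and> \<bar>t - t'\<bar> \<le> d / 3"
    have "dist (x, t) (x', t') \<le> dist x x' + dist t t'"
      unfolding dist_Pair_Pair by (rule sqrt_sum_squares_le_sum) auto
    then have "dist (x, t) (x', t') < d" using * d(1) by (simp add: dist_real_def)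
    then have "dist (f (x, t)) (f (x', t')) < e" using * by (intro d(2)) auto
    then show "\<bar>f (x, t) - f (x', t')\<bar> \<le> e" by (simp add: dist_real_def)
  qed (use d in auto)
qed

text \<open>The error is small compared with \<open>h + y\<^sup>2\<close>, uniformly on compact sets away from the terminal time.\<close>

lemma C12_taylor:
  assumes v: "C12 T v vt vx vxx" and T': "T' < T" and e: "0 < e"
  shows "\<exists>d>0. d \<le> 1 \<and> (\<forall>x t h y. \<bar>x\<bar> \<le> R \<and> 0 \<le> t \<and> 0 \<le> h \<and> t + h \<le> T' \<and> h \<le> d \<and> \<bar>y\<bar> \<le> d \<longrightarrow>
    \<bar>v (x + y) (t + h) - v x t - h * vt x t - y * vx x t - y\<^sup>2 / 2 * vxx x t\<bar> \<le> e * (h + y\<^sup>2))"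
proof -
  obtain d1 where d1: "d1 > 0" "\<And>x t x' t'. \<bar>x\<bar> \<le> R + 1 \<Longrightarrow> \<bar>x'\<bar> \<le> R + 1 \<Longrightarrow> t \<in> {0..T'} \<Longrightarrow> t' \<in> {0..T'} \<Longrightarrow>
      \<bar>x - x'\<bar> \<le> d1 \<Longrightarrow> \<bar>t - t'\<bar> \<le> d1 \<Longrightarrow> \<bar>vt x t - vt x' t'\<bar> \<le> e"
    using uniformly_close_on_compact[of T "\<lambda>(x, t). vt x t" T' e "R + 1"] v T' e
    unfolding C12_def by auto
  obtain d2 where d2: "d2 > 0" "\<And>x t x' t'. \<bar>x\<bar> \<le> R + 1 \<Longrightarrow> \<bar>x'\<bar> \<le> R + 1 \<Longrightarrow> t \<in> {0..T'} \<Longrightarrow> t' \<in> {0..T'} \<Longrightarrow>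
      \<bar>x - x'\<bar> \<le> d2 \<Longrightarrow> \<bar>t - t'\<bar> \<le> d2 \<Longrightarrow> \<bar>vxx x t - vxx x' t'\<bar> \<le> e"
    using uniformly_close_on_compact[of T "\<lambda>(x, t). vxx x t" T' e "R + 1"] v T' e
    unfolding C12_def by auto
  have Dt: "((\<lambda>s. v x s) has_real_derivative vt x t) (at t within {0..T})"
    and Dx: "((\<lambda>y. v y t) has_real_derivative vx x t) (at x)"
    and Dxx: "((\<lambda>y. vx y t) has_real_derivative vxx x t) (at x)" if "0 \<le> t" "t \<le> T'" for x t
    using v T' that unfolding C12_def by auto
  show ?thesis
  proof (intro exI[of _ "min 1 (min d1 d2)"] conjI allI impI)
    fix x t h y
    assume "\<bar>x\<bar> \<le> R \<and> 0 \<le> t \<and> 0 \<le> h \<and> t + h \<le> T' \<and> h \<le> min 1 (min d1 d2) \<and> \<bar>y\<bar> \<le> min 1 (min d1 d2)"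
    then have x: "\<bar>x\<bar> \<le> R" and t: "0 \<le> t" "t \<le> T'" "t + h \<le> T'" and h: "0 \<le> h" "h \<le> d1" "h \<le> d2"
      and y: "\<bar>y\<bar> \<le> 1" "\<bar>y\<bar> \<le> d1" "\<bar>y\<bar> \<le> d2" by auto
    have time: "\<bar>v (x + y) (t + h) - v (x + y) t - h * vt x t\<bar> \<le> e * h"
    proof -
      have "norm ((v (x + y) (t + h) - (t + h) * vt x t) - (v (x + y) t - t * vt x t)) \<le> e * norm ((t + h) - t)"
      proof (rule field_differentiable_bound[where S = "{t..t + h}" and f' = "\<lambda>s. vt (x + y) s - vt x t"])
        fix s assume s: "s \<in> {t..t + h}"
        have "((\<lambda>s. v (x + y) s) has_real_derivative vt (x + y) s) (at s within {t..t + h})"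
          using s t T' by (intro DERIV_subset[OF Dt]) auto
        then show "((\<lambda>s. v (x + y) s - s * vt x t) has_real_derivative vt (x + y) s - vt x t) (at s within {t..t + h})"
          by (auto intro!: derivative_eq_intros)
        show "norm (vt (x + y) s - vt x t) \<le> e"
          using s x y t h d1(2)[of "x + y" x s t] by auto
      qed (use h in auto)
      then show ?thesis using h by (simp add: algebra_simps)
    qed
    let ?S = "{-\<bar>y\<bar>..\<bar>y\<bar>}"
    have Sx: "\<bar>(x + z) - x\<bar> \<le> d2" "\<bar>x + z\<bar> \<le> R + 1" if "z \<in> ?S" for z using that x y by auto
    have sh: "((\<lambda>z. f (x + z)) has_real_derivative f') (at z within S)"
      if "(f has_real_derivative f') (at (x + z))" for f f' z S
    proof -
      have "((\<lambda>z. x + z) has_real_derivative 1) (at z within S)" by (auto intro!: derivative_eq_intros)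
      from DERIV_chain2[OF that this] show ?thesis by simp
    qed
    have first: "\<bar>vx (x + z) t - vx x t - z * vxx x t\<bar> \<le> e * \<bar>y\<bar>" if z: "z \<in> ?S" for z
    proof -
      have "norm ((vx (x + z) t - z * vxx x t) - (vx (x + 0) t - 0 * vxx x t)) \<le> e * norm (z - 0)"
      proof (rule field_differentiable_bound[where S = ?S and f' = "\<lambda>z. vxx (x + z) t - vxx x t"])
        fix s assume s: "s \<in> ?S"
        show "((\<lambda>z. vx (x + z) t - z * vxx x t) has_real_derivative vxx (x + s) t - vxx x t) (at s within ?S)"
          by (auto intro!: derivative_eq_intros sh[of "\<lambda>z. vx z t"] Dxx t)
        show "norm (vxx (x + s) t - vxx x t) \<le> e"
          using d2(2)[of "x + s" x t t] Sx[OF s] x t d2(1) by auto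
      qed (use z in auto)
      also have "\<dots> \<le> e * \<bar>y\<bar>" using z e by (intro mult_left_mono) auto
      finally show ?thesis by simp
    qed
    have "norm ((v (x + y) t - y * vx x t - y\<^sup>2 / 2 * vxx x t) - (v (x + 0) t - 0 * vx x t - 0\<^sup>2 / 2 * vxx x t))
      \<le> (e * \<bar>y\<bar>) * norm (y - 0)"
    proof (rule field_differentiable_bound[where S = ?S and f' = "\<lambda>z. vx (x + z) t - vx x t - z * vxx x t"])
      fix s assume s: "s \<in> ?S"
      show "((\<lambda>y. v (x + y) t - y * vx x t - y\<^sup>2 / 2 * vxx x t) has_real_derivative
        vx (x + s) t - vx x t - s * vxx x t) (at s within ?S)"
        by (auto intro!: derivative_eq_intros sh[of "\<lambda>z. v z t"] Dx t)
      show "norm (vx (x + s) t - vx x t - s * vxx x t) \<le> e * \<bar>y\<bar>" using first[OF s] by simp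
    qed auto
    then have "\<bar>v (x + y) t - v x t - y * vx x t - y\<^sup>2 / 2 * vxx x t\<bar> \<le> e * y\<^sup>2"
      by (simp add: power2_eq_square algebra_simps)
    with time show "\<bar>v (x + y) (t + h) - v x t - h * vt x t - y * vx x t - y\<^sup>2 / 2 * vxx x t\<bar> \<le> e * (h + y\<^sup>2)"
      unfolding distrib_left by linarith
  qed (use d1 d2 in auto)
qed

lemma bounded_on_compact_strip:
  fixes f :: "real \<times> real \<Rightarrow> real"
  assumes "continuous_on (UNIV \<times> {0..<T}) f" "T' < T"
  shows "\<exists>A\<ge>0. \<forall>x t. \<bar>x\<bar> \<le> R \<and> t \<in> {0..T'} \<longrightarrow> \<bar>f (x, t)\<bar> \<le> A"
proof -
  have "compact ({-R..R} \<times> {0..T'})" by (intro compact_Times compact_Icc)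
  moreover have "continuous_on ({-R..R} \<times> {0..T'}) f" using assms by (elim continuous_on_subset) auto
  ultimately have "bounded (f ` ({-R..R} \<times> {0..T'}))" by (intro compact_imp_bounded compact_continuous_image)
  then obtain A where A: "\<forall>p\<in>{-R..R} \<times> {0..T'}. \<bar>f p\<bar> \<le> A" unfolding bounded_iff by auto
  show ?thesis
  proof (intro exI[of _ "\<bar>A\<bar>"] conjI allI impI)
    fix x t assume "\<bar>x\<bar> \<le> R \<and> t \<in> {0..T'}"
    then have "(x, t) \<in> {-R..R} \<times> {0..T'}" by auto
    with A have "\<bar>f (x, t)\<bar> \<le> A" by blast
    then show "\<bar>f (x, t)\<bar> \<le> \<bar>A\<bar>" by linarith
  qed simp
qed

text \<open>Far from the expansion point the remainder is dominated by a fourth power, since \<open>v\<close> is bounded.\<close>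

lemma C12_taylor_bounded:
  assumes v: "C12 T v vt vx vxx" and T': "T' < T" and e: "0 < e"
    and B: "\<And>x t. t \<in> {0..T} \<Longrightarrow> \<bar>v x t\<bar> \<le> B"
  shows "\<exists>d>0. d \<le> 1 \<and> (\<exists>C\<ge>0. \<exists>A\<ge>0. \<forall>x t. \<bar>x\<bar> \<le> R \<and> 0 \<le> t \<and> t \<le> T' \<longrightarrow> \<bar>vxx x t\<bar> \<le> A \<and>
    (\<forall>h y. 0 \<le> h \<and> t + h \<le> T' \<and> h \<le> d \<longrightarrow>
    v x t + h * vt x t + y * vx x t + y\<^sup>2 / 2 * vxx x t - e * (h + y\<^sup>2) - C * y ^ 4 \<le> v (x + y) (t + h)))"
proof -
  obtain d where d: "0 < d" "d \<le> 1" and taylor: "\<And>x t h y. \<bar>x\<bar> \<le> R \<Longrightarrow> 0 \<le> t \<Longrightarrow> 0 \<le> h \<Longrightarrow> t + h \<le> T' \<Longrightarrow> h \<le> d \<Longrightarrow> \<bar>y\<bar> \<le> d \<Longrightarrow>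
    \<bar>v (x + y) (t + h) - v x t - h * vt x t - y * vx x t - y\<^sup>2 / 2 * vxx x t\<bar> \<le> e * (h + y\<^sup>2)"
    using C12_taylor[OF v T' e, of R] by blast
  have c: "continuous_on (UNIV \<times> {0..<T}) (\<lambda>(x, t). vt x t)" "continuous_on (UNIV \<times> {0..<T}) (\<lambda>(x, t). vx x t)"
    "continuous_on (UNIV \<times> {0..<T}) (\<lambda>(x, t). vxx x t)" using v by (auto simp: C12_def)
  obtain A1 where A1: "A1 \<ge> 0" "\<And>x t. \<bar>x\<bar> \<le> R \<Longrightarrow> t \<in> {0..T'} \<Longrightarrow> \<bar>vt x t\<bar> \<le> A1"
    using bounded_on_compact_strip[OF c(1) T', of R] by auto
  obtain A2 where A2: "A2 \<ge> 0" "\<And>x t. \<bar>x\<bar> \<le> R \<Longrightarrow> t \<in> {0..T'} \<Longrightarrow> \<bar>vx x t\<bar> \<le> A2"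
    using bounded_on_compact_strip[OF c(2) T', of R] by auto
  obtain A3 where A3: "A3 \<ge> 0" "\<And>x t. \<bar>x\<bar> \<le> R \<Longrightarrow> t \<in> {0..T'} \<Longrightarrow> \<bar>vxx x t\<bar> \<le> A3"
    using bounded_on_compact_strip[OF c(3) T', of R] by auto
  define C where "C = (2 * \<bar>B\<bar> + A1 + A2 + A3) / d ^ 4"
  have C: "0 \<le> C" using A1 A2 A3 d by (auto simp: C_def)
  have main: "v x t + h * vt x t + y * vx x t + y\<^sup>2 / 2 * vxx x t - e * (h + y\<^sup>2) - C * y ^ 4 \<le> v (x + y) (t + h)"
    if x: "\<bar>x\<bar> \<le> R" and t: "0 \<le> t" "t \<le> T'" and h: "0 \<le> h" "t + h \<le> T'" "h \<le> d" for x t h y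
  proof (cases "\<bar>y\<bar> \<le> d")
    case True
    have "0 \<le> C * y ^ 4" using C by simp
    then show ?thesis using taylor[OF x t(1) h True] by linarith
  next
    case False
    define q where "q = y ^ 4 / d ^ 4"
    have yd: "d < \<bar>y\<bar>" using False by simp
    have z: "1 \<le> \<bar>y\<bar> / d" using yd d by simp
    have q4: "q = (\<bar>y\<bar> / d) ^ 4" by (simp add: q_def power_divide)
    have q1: "1 \<le> q" unfolding q4 by (rule one_le_power[OF z])
    have "\<bar>y\<bar> \<le> \<bar>y\<bar> / d" using d by (simp add: pos_le_divide_eq mult_left_le)
    also have "\<dots> \<le> q" unfolding q4 using power_increasing[OF _ z, of 1 4] by simp
    finally have qy: "\<bar>y\<bar> \<le> q" .
    have "y\<^sup>2 \<le> (\<bar>y\<bar> / d)\<^sup>2"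
      using d by (simp add: power_divide pos_le_divide_eq mult_left_le power_le_one)
    also have "\<dots> \<le> q" unfolding q4 by (rule power_increasing[OF _ z]) simp
    finally have qy2: "y\<^sup>2 \<le> q" .
    have "\<bar>h * vt x t\<bar> \<le> 1 * A1" unfolding abs_mult using A1(2)[OF x, of t] t h d by (intro mult_mono) auto
    also have "1 * A1 \<le> q * A1" using q1 A1 by (intro mult_right_mono) auto
    finally have 1: "\<bar>h * vt x t\<bar> \<le> q * A1" .
    have 2: "\<bar>y * vx x t\<bar> \<le> q * A2"
      unfolding abs_mult using A2(1) A2(2)[OF x, of t] t qy q1 by (intro mult_mono) auto
    have 3: "\<bar>y\<^sup>2 / 2 * vxx x t\<bar> \<le> q * A3"
      unfolding abs_mult using A3(1) A3(2)[OF x, of t] t qy2 q1 by (intro mult_mono) auto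
    have 4: "\<bar>v x t\<bar> \<le> \<bar>B\<bar>" "\<bar>v (x + y) (t + h)\<bar> \<le> \<bar>B\<bar>"
      using B[of t x] B[of "t + h" "x + y"] t h T' by auto
    have "\<bar>B\<bar> \<le> q * \<bar>B\<bar>" using mult_right_mono[OF q1, of "\<bar>B\<bar>"] by simp
    moreover have "C * y ^ 4 = q * (2 * \<bar>B\<bar>) + q * A1 + q * A2 + q * A3"
      unfolding C_def q_def using d by (simp add: field_simps)
    moreover have "0 \<le> e * (h + y\<^sup>2)" using e h by simp
    ultimately show ?thesis using 1 2 3 4 by linarith
  qed
  show ?thesis
    using d C A3 main by (intro exI[of _ d] exI[of _ C] exI[of _ A3] conjI allI impI) auto
qed

lemma fourth_power_sum_le: "(x + y) ^ 4 \<le> 8 * x ^ 4 + 8 * (y::real) ^ 4"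
proof -
  have "(x + y) ^ 4 = ((x + y)\<^sup>2)\<^sup>2" by simp
  also have "\<dots> \<le> (2 * x\<^sup>2 + 2 * y\<^sup>2)\<^sup>2" by (intro power_mono power2_sum_le) auto
  also have "\<dots> = 4 * (x\<^sup>2 + y\<^sup>2)\<^sup>2" by (simp add: power2_eq_square algebra_simps)
  also have "\<dots> \<le> 4 * (2 * (x\<^sup>2)\<^sup>2 + 2 * (y\<^sup>2)\<^sup>2)" by (intro mult_left_mono power2_sum_le) auto
  finally show ?thesis by simp
qed

context brownian_motion
begin

lemma increment_fourth_moment:
  assumes "0 \<le> s" "s \<le> t"
  shows "integrable M (\<lambda>\<omega>. (W t \<omega> - W s \<omega>) ^ 4)" (is ?A)
    and "expectation (\<lambda>\<omega>. (W t \<omega> - W s \<omega>) ^ 4) = 3 * (t - s)\<^sup>2" (is ?B)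
proof -
  have "?A \<and> ?B"
  proof (cases "s < t")
    case False
    then have "t = s" using assms by auto
    then show ?thesis by simp
  next
    case True
    let ?q = "sqrt (t - s)"
    have q: "?q > 0" "?q\<^sup>2 = t - s" using True by auto
    have D: "distributed M lborel (\<lambda>\<omega>. W t \<omega> - W s \<omega>) (\<lambda>x. ennreal (normal_density 0 ?q x))"
      using normal_increments True assms by auto
    have "fact (2 * 2) / ((2 / ?q\<^sup>2)\<^sup>2 * fact 2) = 3 * (t - s)\<^sup>2"
      unfolding q(2) using True by (simp add: fact_numeral power_divide field_simps)
    then have m: "has_bochner_integral lborel (\<lambda>x. normal_density 0 ?q x * x ^ 4) (3 * (t - s)\<^sup>2)"
      using normal_moment_even[OF q(1), of 0 2] by simp
    have "?A"
      by (subst distributed_integrable[OF D, of "\<lambda>x. x^4", symmetric])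
        (use m in \<open>auto simp: has_bochner_integral_iff\<close>)
    moreover have "?B"
      by (subst distributed_integral[OF D, of "\<lambda>x. x^4", symmetric])
        (use m in \<open>auto simp: has_bochner_integral_iff\<close>)
    ultimately show ?thesis by blast
  qed
  then show ?A ?B by auto
qed

lemma expectation_quartic:
  assumes "0 \<le> s" "s \<le> t"
  shows "integrable M (\<lambda>\<omega>. c0 + c1 * (W t \<omega> - W s \<omega>) + c2 * (W t \<omega> - W s \<omega>)\<^sup>2 + c4 * (W t \<omega> - W s \<omega>) ^ 4)"
    "expectation (\<lambda>\<omega>. c0 + c1 * (W t \<omega> - W s \<omega>) + c2 * (W t \<omega> - W s \<omega>)\<^sup>2 + c4 * (W t \<omega> - W s \<omega>) ^ 4)
      = c0 + c2 * (t - s) + c4 * (3 * (t - s)\<^sup>2)"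
  using increment_moments[OF assms] increment_fourth_moment[OF assms] by (simp_all add: prob_space)

text \<open>The expected change over one step is at least the step size times the generator, up to an
  error that is small compared with the step, uniformly on compact sets.\<close>

lemma one_step_expansion:
  fixes \<mu> \<sigma> R :: real
  assumes v: "C12 T v vt vx vxx" and T': "T' < T" and \<epsilon>: "0 < \<epsilon>"
    and B: "\<And>x t. t \<in> {0..T} \<Longrightarrow> \<bar>v x t\<bar> \<le> B"
    and vm: "\<And>t. t \<in> {0..T} \<Longrightarrow> (\<lambda>x. v x t) \<in> borel_measurable borel"
  shows "\<exists>d>0. \<forall>x s t. \<bar>x\<bar> \<le> R \<and> 0 \<le> s \<and> s \<le> t \<and> t \<le> T' \<and> t - s \<le> d \<longrightarrow>
    v x s + (t - s) * (vt x s + \<mu> * vx x s + \<sigma>\<^sup>2 / 2 * vxx x s) - \<epsilon> * (t - s)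
      \<le> expectation (\<lambda>\<omega>. v (x + \<mu> * (t - s) + \<sigma> * (W t \<omega> - W s \<omega>)) t)"
proof -
  define e where "e = \<epsilon> / (2 * (1 + \<mu>\<^sup>2 + \<sigma>\<^sup>2))"
  have pos: "0 < 1 + \<mu>\<^sup>2 + \<sigma>\<^sup>2" by (simp add: add_pos_nonneg)
  have e: "0 < e" "e * (1 + \<mu>\<^sup>2 + \<sigma>\<^sup>2) = \<epsilon> / 2"
    using \<epsilon> pos nonzero_mult_divide_mult_cancel_right[of "1 + \<mu>\<^sup>2 + \<sigma>\<^sup>2" \<epsilon> 2] by (auto simp: e_def simp del: distrib_left_numeral)
  obtain d C A where d: "0 < d" "d \<le> 1" and C: "0 \<le> C" and A: "0 \<le> A"
    and vxx: "\<And>x t. \<bar>x\<bar> \<le> R \<Longrightarrow> 0 \<le> t \<Longrightarrow> t \<le> T' \<Longrightarrow> \<bar>vxx x t\<bar> \<le> A"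
    and low: "\<And>x t h y. \<bar>x\<bar> \<le> R \<Longrightarrow> 0 \<le> t \<Longrightarrow> t \<le> T' \<Longrightarrow> 0 \<le> h \<Longrightarrow> t + h \<le> T' \<Longrightarrow> h \<le> d \<Longrightarrow>
      v x t + h * vt x t + y * vx x t + y\<^sup>2 / 2 * vxx x t - e * (h + y\<^sup>2) - C * y ^ 4 \<le> v (x + y) (t + h)"
    using C12_taylor_bounded[OF v T' e(1) B, of R] by blast
  define L where "L = A * \<mu>\<^sup>2 / 2 + 8 * C * (\<mu> ^ 4 + 3 * \<sigma> ^ 4)"
  have L: "0 \<le> L" using A C by (auto simp: L_def)
  define d' where "d' = min d (\<epsilon> / (2 * (L + 1)))"
  have d': "0 < d'" "d' \<le> d" "d' * L \<le> \<epsilon> / 2"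
  proof -
    show "0 < d'" "d' \<le> d" using d \<epsilon> L by (auto simp: d'_def)
    have "d' * L \<le> \<epsilon> / (2 * (L + 1)) * L" using L by (intro mult_right_mono) (auto simp: d'_def)
    also have "\<dots> = \<epsilon> / 2 * (L / (L + 1))" by simp
    also have "\<dots> \<le> \<epsilon> / 2 * 1" using \<epsilon> L by (intro mult_left_mono) auto
    finally show "d' * L \<le> \<epsilon> / 2" by simp
  qed
  show ?thesis
  proof (intro exI[of _ d'] conjI allI impI)
    fix x s t assume "\<bar>x\<bar> \<le> R \<and> 0 \<le> s \<and> s \<le> t \<and> t \<le> T' \<and> t - s \<le> d'"
    then have x: "\<bar>x\<bar> \<le> R" and s: "0 \<le> s" "s \<le> t" "t \<le> T'" and hd: "t - s \<le> d'" by auto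
    define h where "h = t - s"
    have h: "0 \<le> h" "h \<le> d" "h \<le> 1" "h \<le> d'" "t = s + h" using s hd d d' by (auto simp: h_def)
    define p where "p = vxx x s / 2 - e"
    define c0 where "c0 = v x s + h * vt x s + \<mu> * h * vx x s + (\<mu> * h)\<^sup>2 * p - e * h - 8 * C * (\<mu> * h) ^ 4"
    define c1 where "c1 = \<sigma> * vx x s + 2 * \<mu> * h * \<sigma> * p"
    define c2 where "c2 = \<sigma>\<^sup>2 * p"
    define c4 where "c4 = - 8 * C * \<sigma> ^ 4"
    have "c0 + c2 * (t - s) + c4 * (3 * (t - s)\<^sup>2)
      = expectation (\<lambda>\<omega>. c0 + c1 * (W t \<omega> - W s \<omega>) + c2 * (W t \<omega> - W s \<omega>)\<^sup>2 + c4 * (W t \<omega> - W s \<omega>) ^ 4)"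
      by (rule expectation_quartic(2)[OF s(1,2), symmetric])
    also have "\<dots> \<le> expectation (\<lambda>\<omega>. v (x + \<mu> * (t - s) + \<sigma> * (W t \<omega> - W s \<omega>)) t)"
    proof (rule integral_mono)
      show "integrable M (\<lambda>\<omega>. c0 + c1 * (W t \<omega> - W s \<omega>) + c2 * (W t \<omega> - W s \<omega>)\<^sup>2 + c4 * (W t \<omega> - W s \<omega>) ^ 4)"
        by (rule expectation_quartic(1)[OF s(1,2)])
      have tT: "t \<in> {0..T}" using s T' by auto
      have [measurable]: "W t \<in> borel_measurable M" "W s \<in> borel_measurable M"
        using s by (auto intro!: W_measurable_M)
      show "integrable M (\<lambda>\<omega>. v (x + \<mu> * (t - s) + \<sigma> * (W t \<omega> - W s \<omega>)) t)"
        using B[OF tT] by (intro integrable_const_bound[where B = B] measurable_compose[OF _ vm[OF tT]]) auto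
      fix \<omega>
      define w where "w = W t \<omega> - W s \<omega>"
      have "c0 + c1 * w + c2 * w\<^sup>2 + c4 * w ^ 4
        = v x s + h * vt x s + (\<mu> * h + \<sigma> * w) * vx x s + (\<mu> * h + \<sigma> * w)\<^sup>2 / 2 * vxx x s - e * (h + (\<mu> * h + \<sigma> * w)\<^sup>2)
          - C * (8 * (\<mu> * h) ^ 4 + 8 * (\<sigma> * w) ^ 4)"
        unfolding c0_def c1_def c2_def c4_def p_def by (simp add: algebra_simps power2_eq_square power_mult_distrib diff_divide_distrib)
      also have "\<dots> \<le> v x s + h * vt x s + (\<mu> * h + \<sigma> * w) * vx x s + (\<mu> * h + \<sigma> * w)\<^sup>2 / 2 * vxx x s - e * (h + (\<mu> * h + \<sigma> * w)\<^sup>2)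
          - C * (\<mu> * h + \<sigma> * w) ^ 4"
        using C by (intro diff_left_mono mult_left_mono fourth_power_sum_le)
      also have "\<dots> \<le> v (x + (\<mu> * h + \<sigma> * w)) (s + h)"
        using x s h by (intro low) auto
      finally show "c0 + c1 * (W t \<omega> - W s \<omega>) + c2 * (W t \<omega> - W s \<omega>)\<^sup>2 + c4 * (W t \<omega> - W s \<omega>) ^ 4
        \<le> v (x + \<mu> * (t - s) + \<sigma> * (W t \<omega> - W s \<omega>)) t"
        by (simp add: w_def h_def add.assoc)
    qed
    finally have E: "c0 + c2 * h + c4 * (3 * h\<^sup>2) \<le> expectation (\<lambda>\<omega>. v (x + \<mu> * (t - s) + \<sigma> * (W t \<omega> - W s \<omega>)) t)"
      by (simp only: h_def)
    have "h\<^sup>2 \<le> h" using h by (simp add: power2_eq_square mult_left_le)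
    have h4: "h ^ 4 \<le> h\<^sup>2" using h by (intro power_decreasing) auto
    have a1: "e * (h + \<mu>\<^sup>2 * h\<^sup>2 + \<sigma>\<^sup>2 * h) \<le> \<epsilon> / 2 * h"
    proof -
      have "\<mu>\<^sup>2 * h\<^sup>2 \<le> \<mu>\<^sup>2 * h" using \<open>h\<^sup>2 \<le> h\<close> by (intro mult_left_mono) auto
      then have "e * (h + \<mu>\<^sup>2 * h\<^sup>2 + \<sigma>\<^sup>2 * h) \<le> e * (h + \<mu>\<^sup>2 * h + \<sigma>\<^sup>2 * h)"
        using e by (intro mult_left_mono) auto
      also have "\<dots> = e * (1 + \<mu>\<^sup>2 + \<sigma>\<^sup>2) * h" by (simp add: algebra_simps)
      finally show ?thesis by (simp only: e(2))
    qed
    have a2: "A * (\<mu>\<^sup>2 * h\<^sup>2) / 2 + 8 * C * (\<mu> ^ 4 * h ^ 4 + 3 * \<sigma> ^ 4 * h\<^sup>2) \<le> \<epsilon> / 2 * h"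
    proof -
      have "\<mu> ^ 4 * h ^ 4 \<le> \<mu> ^ 4 * h\<^sup>2" using h4 by (intro mult_left_mono) auto
      then have "A * (\<mu>\<^sup>2 * h\<^sup>2) / 2 + 8 * C * (\<mu> ^ 4 * h ^ 4 + 3 * \<sigma> ^ 4 * h\<^sup>2)
        \<le> A * (\<mu>\<^sup>2 * h\<^sup>2) / 2 + 8 * C * (\<mu> ^ 4 * h\<^sup>2 + 3 * \<sigma> ^ 4 * h\<^sup>2)"
        using C by (intro add_left_mono mult_left_mono) auto
      also have "\<dots> = (h * L) * h" by (simp add: L_def algebra_simps power2_eq_square)
      also have "\<dots> \<le> (d' * L) * h" using h L by (intro mult_right_mono) auto
      also have "\<dots> \<le> \<epsilon> / 2 * h" using d' h by (intro mult_right_mono) auto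
      finally show ?thesis .
    qed
    have a3: "- (A * (\<mu>\<^sup>2 * h\<^sup>2) / 2) \<le> \<mu>\<^sup>2 * h\<^sup>2 / 2 * vxx x s"
    proof -
      have "- A \<le> vxx x s" using vxx[OF x s(1)] s by auto
      from mult_left_mono[OF this, of "\<mu>\<^sup>2 * h\<^sup>2 / 2"] show ?thesis by (simp add: mult_ac)
    qed
    have "c0 + c2 * h + c4 * (3 * h\<^sup>2) = v x s + h * (vt x s + \<mu> * vx x s + \<sigma>\<^sup>2 / 2 * vxx x s)
      + \<mu>\<^sup>2 * h\<^sup>2 / 2 * vxx x s - e * (h + \<mu>\<^sup>2 * h\<^sup>2 + \<sigma>\<^sup>2 * h) - 8 * C * (\<mu> ^ 4 * h ^ 4 + 3 * \<sigma> ^ 4 * h\<^sup>2)"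
      unfolding c0_def c2_def c4_def p_def by (simp add: algebra_simps power_mult_distrib diff_divide_distrib)
    then show "v x s + (t - s) * (vt x s + \<mu> * vx x s + \<sigma>\<^sup>2 / 2 * vxx x s) - \<epsilon> * (t - s)
      \<le> expectation (\<lambda>\<omega>. v (x + \<mu> * (t - s) + \<sigma> * (W t \<omega> - W s \<omega>)) t)"
      using E a1 a2 a3 unfolding h_def[symmetric] by linarith
  qed (use d' in auto)
qed

text \<open>A lower bound for the conditional expectation given the past is a lower bound for the expectation: the
  increment may be integrated out with the past frozen.\<close>

lemma increment_fubini_lower:
  fixes k :: "'b \<times> real \<Rightarrow> real"
  assumes st: "0 \<le> s" "s \<le> t" and U: "U \<in> measurable (F s) N"
    and k: "k \<in> borel_measurable (N \<Otimes>\<^sub>M borel)" and bd: "\<And>z. \<bar>k z\<bar> \<le> c"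
    and low: "\<And>\<omega>. \<omega> \<in> space M \<Longrightarrow> l \<le> expectation (\<lambda>\<omega>'. k (U \<omega>, W t \<omega>' - W s \<omega>'))"
  shows "l \<le> expectation (\<lambda>\<omega>. k (U \<omega>, W t \<omega> - W s \<omega>))"
proof -
  let ?V = "\<lambda>\<omega>. W t \<omega> - W s \<omega>"
  note [measurable] = k measurable_F_M[OF U]
  have [measurable]: "W t \<in> borel_measurable M" "W s \<in> borel_measurable M"
    using st by (auto intro!: W_measurable_M)
  interpret PU: prob_space "distr M N U" by (rule prob_space_distr) measurable
  interpret PV: prob_space "distr M borel ?V" by (rule prob_space_distr) measurable
  interpret P: pair_prob_space "distr M N U" "distr M borel ?V" ..
  have joint: "distr M N U \<Otimes>\<^sub>M distr M borel ?V = distr M (N \<Otimes>\<^sub>M borel) (\<lambda>\<omega>. (U \<omega>, ?V \<omega>))"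
  proof (rule pair_measure_eqI[OF PU.sigma_finite_measure_axioms PV.sigma_finite_measure_axioms])
    show "sets (distr M N U \<Otimes>\<^sub>M distr M borel ?V) = sets (distr M (N \<Otimes>\<^sub>M borel) (\<lambda>\<omega>. (U \<omega>, ?V \<omega>)))"
      by (simp cong: sets_pair_measure_cong)
    fix A B assume "A \<in> sets (distr M N U)" "B \<in> sets (distr M borel ?V)"
    then have [measurable]: "A \<in> sets N" "B \<in> sets borel" by auto
    have "U -` A \<inter> space M \<in> sets (F s)" using measurable_sets[OF U, of A] space_F by simp
    moreover have "?V -` B \<inter> space M \<in> {?V -` A \<inter> space M | A. A \<in> sets borel}" by auto
    ultimately have "prob ((U -` A \<inter> space M) \<inter> (?V -` B \<inter> space M)) = prob (U -` A \<inter> space M) * prob (?V -` B \<inter> space M)"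
      using increment_indep_set[OF st] unfolding indep_sets2_eq by blast
    moreover have "(U -` A \<inter> space M) \<inter> (?V -` B \<inter> space M) = (\<lambda>\<omega>. (U \<omega>, ?V \<omega>)) -` (A \<times> B) \<inter> space M" by auto
    ultimately show "emeasure (distr M N U) A * emeasure (distr M borel ?V) B
      = emeasure (distr M (N \<Otimes>\<^sub>M borel) (\<lambda>\<omega>. (U \<omega>, ?V \<omega>))) (A \<times> B)"
      by (simp add: emeasure_distr emeasure_eq_measure ennreal_mult)
  qed
  have ki: "integrable (distr M N U \<Otimes>\<^sub>M distr M borel ?V) k"
    using bd k by (intro P.P.integrable_const_bound[where B = c]) (auto cong: measurable_cong_sets)
  have "expectation (\<lambda>\<omega>. k (U \<omega>, ?V \<omega>)) = integral\<^sup>L (distr M N U \<Otimes>\<^sub>M distr M borel ?V) k"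
    unfolding joint by (subst integral_distr) auto
  also have "\<dots> = (\<integral>u. (\<integral>v. k (u, v) \<partial>distr M borel ?V) \<partial>distr M N U)"
    using P.integral_fst'[OF ki] by simp
  also have "\<dots> = expectation (\<lambda>\<omega>. \<integral>v. k (U \<omega>, v) \<partial>distr M borel ?V)"
    by (subst integral_distr) (auto intro!: PV.borel_measurable_lebesgue_integral cong: measurable_cong_sets)
  finally have eq: "expectation (\<lambda>\<omega>. k (U \<omega>, ?V \<omega>)) = expectation (\<lambda>\<omega>. \<integral>v. k (U \<omega>, v) \<partial>distr M borel ?V)" .
  have inner: "(\<integral>v. k (U \<omega>, v) \<partial>distr M borel ?V) = expectation (\<lambda>\<omega>'. k (U \<omega>, ?V \<omega>'))" if "\<omega> \<in> space M" for \<omega>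
  proof -
    have "U \<omega> \<in> space N" using measurable_space[OF measurable_F_M[OF U] that] .
    then show ?thesis by (subst integral_distr) (auto intro!: measurable_compose[OF _ k])
  qed
  have "l = expectation (\<lambda>\<omega>. l)" by (simp add: prob_space)
  also have "\<dots> \<le> expectation (\<lambda>\<omega>. \<integral>v. k (U \<omega>, v) \<partial>distr M borel ?V)"
  proof (rule integral_mono)
    have "integrable (distr M N U) (\<lambda>u. \<integral>v. k (u, v) \<partial>distr M borel ?V)"
      using P.integrable_fst'[OF ki] .
    then show "integrable M (\<lambda>\<omega>. \<integral>v. k (U \<omega>, v) \<partial>distr M borel ?V)"
      by (rule integrable_distr[rotated]) measurable
    show "l \<le> (\<integral>v. k (U \<omega>, v) \<partial>distr M borel ?V)" if "\<omega> \<in> space M" for \<omega>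
      using low[OF that] inner[OF that] by simp
  qed simp
  finally show ?thesis by (simp only: eq)
qed

end

section \<open>Dynkin inequality\<close>

text \<open>Increments summed up to the first failure of \<open>P\<close> telescope; this is optional stopping along a grid.\<close>

lemma decreasing_telescope:
  fixes z :: "nat \<Rightarrow> real"
  assumes "\<And>i. P (Suc i) \<Longrightarrow> P i"
  shows "\<exists>\<kappa>\<le>n. (\<forall>i<\<kappa>. P i) \<and> (\<kappa> < n \<longrightarrow> \<not> P \<kappa>) \<and> (\<Sum>i<n. if P i then z (Suc i) - z i else 0) = z \<kappa> - z 0"
proof (induction n)
  case 0 then show ?case by simp
next
  case (Suc n)
  then obtain \<kappa> where \<kappa>: "\<kappa> \<le> n" "\<forall>i<\<kappa>. P i" "\<kappa> < n \<longrightarrow> \<not> P \<kappa>"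
    "(\<Sum>i<n. if P i then z (Suc i) - z i else 0) = z \<kappa> - z 0" by auto
  show ?case
  proof (cases "P n")
    case True
    have all: "P i" if "i \<le> n" for i using that
      by (induction rule: inc_induct) (auto intro: assms True)
    then have "\<kappa> = n" using \<kappa>(1,3) by (metis le_neq_implies_less)
    then show ?thesis using \<kappa> True all by (intro exI[of _ "Suc n"]) auto
  next
    case False
    then show ?thesis using \<kappa> by (intro exI[of _ \<kappa>]) (cases "\<kappa> = n"; auto)
  qed
qed

lemma process_at_time_measurable:
  fixes X :: "real \<Rightarrow> 'a \<Rightarrow> real"
  assumes ab: "a \<le> b" and X: "\<And>t. t \<in> {a..b} \<Longrightarrow> X t \<in> borel_measurable M"
    and cont: "\<And>\<omega>. \<omega> \<in> space M \<Longrightarrow> continuous_on {a..b} (\<lambda>t. X t \<omega>)"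
    and \<tau>: "\<tau> \<in> borel_measurable M" "\<And>\<omega>. \<omega> \<in> space M \<Longrightarrow> \<tau> \<omega> \<in> {a..b}"
  shows "(\<lambda>\<omega>. X (\<tau> \<omega>) \<omega>) \<in> borel_measurable M"
proof -
  have "\<tau> \<in> measurable M (restrict_space borel {a..b})"
    using \<tau> by (intro measurable_restrict_space2) auto
  then have "(\<lambda>\<omega>. (\<tau> \<omega>, \<omega>)) \<in> measurable M (restrict_space borel {a..b} \<Otimes>\<^sub>M M)"
    by (intro measurable_Pair) auto
  from measurable_compose[OF this continuous_process_jointly_measurable[OF ab X cont]]
  show ?thesis by simp
qed

lemma path_bound_measurable:
  fixes X :: "real \<Rightarrow> 'a \<Rightarrow> real"
  assumes ab: "a \<le> b" and X: "\<And>t. t \<in> {a..b} \<Longrightarrow> X t \<in> borel_measurable M"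
    and cont: "\<And>\<omega>. \<omega> \<in> space M \<Longrightarrow> continuous_on {a..b} (\<lambda>t. X t \<omega>)"
  shows "{\<omega> \<in> space M. \<forall>t\<in>{a..b}. \<bar>X t \<omega>\<bar> \<le> c} \<in> sets M"
proof -
  have "{\<omega> \<in> space M. \<forall>t\<in>{a..b}. \<bar>X t \<omega>\<bar> \<le> c}
    = {\<omega> \<in> space M. \<forall>k. \<forall>j\<in>{..Suc k}. \<bar>X (grid a b k j) \<omega>\<bar> \<le> c}"
    using grid_universal[OF continuous_on_rabs[OF cont] ab] by blast
  moreover have "Measurable.pred M (\<lambda>\<omega>. \<forall>k. \<forall>j\<in>{..Suc k}. \<bar>X (grid a b k j) \<omega>\<bar> \<le> c)"
  proof (intro pred_intros_countable pred_intros_finite)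
    fix k j assume "j \<in> {..Suc k}"
    then have "grid a b k j \<in> {a..b}" using grid_bounds[OF ab, of j k] by auto
    then have [measurable]: "X (grid a b k j) \<in> borel_measurable M" by (rule X)
    show "Measurable.pred M (\<lambda>\<omega>. \<bar>X (grid a b k j) \<omega>\<bar> \<le> c)" by measurable
  qed auto
  ultimately show ?thesis by (simp add: pred_def)
qed

context brownian_motion
begin

lemma stopping_time_measurable: "stopping_time F \<tau> \<Longrightarrow> \<tau> \<in> borel_measurable M"
  by (rule measurable_stopping_time[of F]) (auto simp: sets_F_subset space_F)

text \<open>The logarithm of the geometric Brownian motion started at \<open>exp y\<close> at time \<open>a\<close>.\<close>

definition log_gbm :: "real \<Rightarrow> real \<Rightarrow> real \<Rightarrow> real \<Rightarrow> real \<Rightarrow> 'a \<Rightarrow> real" where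
  "log_gbm r \<sigma> a y t \<omega> = y + (r - \<sigma>\<^sup>2 / 2) * (t - a) + \<sigma> * (W t \<omega> - W a \<omega>)"

lemma gbm_exp: "gbm W r \<sigma> a (exp y) t \<omega> = exp (log_gbm r \<sigma> a y t \<omega>)"
  by (simp add: gbm_def log_gbm_def mult_exp_exp add.assoc)

lemma log_gbm_continuous:
  assumes "\<omega> \<in> space M" "0 \<le> a"
  shows "continuous_on {a..T} (\<lambda>t. log_gbm r \<sigma> a y t \<omega>)"
proof -
  have "continuous_on {a..T} (\<lambda>t. W t \<omega>)"
    by (rule continuous_on_subset[OF continuous_paths[OF assms(1)]]) (use assms in auto)
  then show ?thesis unfolding log_gbm_def by (intro continuous_intros)
qed

lemma log_gbm_measurable:
  assumes "0 \<le> a" "a \<le> s" "s \<le> t"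
  shows "log_gbm r \<sigma> a y s \<in> borel_measurable (F t)"
proof -
  have [measurable]: "W s \<in> borel_measurable (F t)" "W a \<in> borel_measurable (F t)"
    using assms by (auto intro!: W_measurable_F)
  show ?thesis unfolding log_gbm_def[abs_def] by measurable
qed

lemma log_gbm_step: "log_gbm r \<sigma> a y t \<omega>
  = log_gbm r \<sigma> a y s \<omega> + (r - \<sigma>\<^sup>2 / 2) * (t - s) + \<sigma> * (W t \<omega> - W s \<omega>)"
  by (simp add: log_gbm_def field_simps)

text \<open>The derivatives of \<open>v\<close> need not be bounded, so the grid sum is stopped when the log-price leaves
  \<open>[-R, R]\<close>, and time stops at \<open>T' < T\<close>. On the event \<open>G\<close> that the path stays inside, the stopped grid times converge
  to \<open>min \<tau> T'\<close>; off \<open>G\<close> only the bound \<open>B\<close> is used.\<close>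

lemma dynkin_lower_localized:
  fixes r \<sigma> a T T' y B c \<epsilon> R :: real and v vt vx vxx :: "real \<Rightarrow> real \<Rightarrow> real"
  defines "X \<equiv> log_gbm r \<sigma> a y" and "\<mu> \<equiv> r - \<sigma>\<^sup>2 / 2"
  assumes a: "0 \<le> a" and aT': "a < T'" and T': "T' < T"
    and v: "C12 T v vt vx vxx"
    and v_cont: "continuous_on (UNIV \<times> {0..T}) (\<lambda>(x, t). v x t)"
    and B: "\<And>x t. t \<in> {0..T} \<Longrightarrow> \<bar>v x t\<bar> \<le> B"
    and \<tau>: "stopping_time F \<tau>" "\<And>\<omega>. \<omega> \<in> space M \<Longrightarrow> \<tau> \<omega> \<in> {a..T}"
    and c: "0 \<le> c"
    and gen: "\<And>\<omega> s. \<omega> \<in> space M \<Longrightarrow> s \<in> {a..<T} \<Longrightarrow> s < \<tau> \<omega> \<Longrightarrow>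
      - c \<le> vt (X s \<omega>) s + \<mu> * vx (X s \<omega>) s + \<sigma>\<^sup>2 / 2 * vxx (X s \<omega>) s"
    and \<epsilon>: "0 < \<epsilon>"
  defines "G \<equiv> {\<omega> \<in> space M. \<forall>s\<in>{a..T}. \<bar>X s \<omega>\<bar> \<le> R}"
  shows "v y a \<le> expectation (\<lambda>\<omega>. v (X (min (\<tau> \<omega>) T') \<omega>) (min (\<tau> \<omega>) T'))
    + (c + \<epsilon>) * (T' - a) + 4 * B * prob (space M - G)"
proof -
  have aT: "a \<le> T'" "a \<le> T" "0 \<le> T" using a aT' T' by auto
  have B0: "0 \<le> B" using B[of 0 0] aT by auto
  have X_cont: "continuous_on {a..T} (\<lambda>s. X s \<omega>)" if "\<omega> \<in> space M" for \<omega>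
    unfolding X_def using that a by (rule log_gbm_continuous)
  have X_F: "X s \<in> borel_measurable (F t)" if "a \<le> s" "s \<le> t" for s t
    unfolding X_def using a that by (rule log_gbm_measurable)
  have X_M: "X s \<in> borel_measurable M" if "a \<le> s" for s
    using measurable_F_M[OF X_F[OF that order_refl]] .
  have v_cont1: "continuous_on UNIV (\<lambda>x. v x t)" if "t \<in> {0..T}" for t
    using that by (intro continuous_on_compose2[OF v_cont, of _ "\<lambda>x. (x, t)", simplified] continuous_intros) auto
  have vm: "(\<lambda>x. v x t) \<in> borel_measurable borel" if "t \<in> {0..T}" for t
    using v_cont1[OF that] by (rule borel_measurable_continuous_onI)
  define f where "f s \<omega> = v (X s \<omega>) s" for s \<omega>
  have f_cont: "continuous_on {a..T} (\<lambda>s. f s \<omega>)" if "\<omega> \<in> space M" for \<omega>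
    unfolding f_def using a
    by (intro continuous_on_compose2[OF v_cont, of _ "\<lambda>s. (X s \<omega>, s)", simplified] continuous_intros X_cont that) auto
  have f_M: "f s \<in> borel_measurable M" if "s \<in> {a..T}" for s
    unfolding f_def[abs_def] using that a by (intro measurable_compose[OF X_M vm]) auto
  have f_bd: "\<bar>f s \<omega>\<bar> \<le> B" if "s \<in> {a..T}" for s \<omega>
    unfolding f_def using that a by (intro B) auto
  note [measurable] = stopping_time_measurable[OF \<tau>(1)]
  define \<rho> where "\<rho> \<omega> = min (\<tau> \<omega>) T'" for \<omega>
  have \<rho>: "\<rho> \<omega> \<in> {a..T}" if "\<omega> \<in> space M" for \<omega> using \<tau>(2)[OF that] aT T' by (auto simp: \<rho>_def)
  have f\<rho>_M[measurable]: "(\<lambda>\<omega>. f (\<rho> \<omega>) \<omega>) \<in> borel_measurable M"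
    by (rule process_at_time_measurable[OF aT(2) f_M f_cont _ \<rho>]) (auto simp: \<rho>_def)
  have G_M[measurable]: "G \<in> sets M"
    unfolding G_def using aT(2) X_M X_cont by (intro path_bound_measurable) auto
  obtain d where d: "0 < d" and step: "\<And>x s t. \<bar>x\<bar> \<le> R \<Longrightarrow> 0 \<le> s \<Longrightarrow> s \<le> t \<Longrightarrow> t \<le> T' \<Longrightarrow> t - s \<le> d \<Longrightarrow>
    v x s + (t - s) * (vt x s + \<mu> * vx x s + \<sigma>\<^sup>2 / 2 * vxx x s) - \<epsilon> * (t - s)
      \<le> expectation (\<lambda>\<omega>. v (x + \<mu> * (t - s) + \<sigma> * (W t \<omega> - W s \<omega>)) t)"
    using one_step_expansion[OF v T' \<epsilon> B vm, of R \<mu> \<sigma>] by blast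
  let ?g = "grid a T'"
  let ?h = "\<lambda>k. (T' - a) / real (Suc k)"
  define P where "P k i \<omega> \<longleftrightarrow> ?g k i < \<tau> \<omega> \<and> (\<forall>j\<in>{..i}. \<bar>X (?g k j) \<omega>\<bar> \<le> R)" for k i \<omega>
  define \<theta> where "\<theta> k i \<omega> = (if P k i \<omega> then 1 else (0::real))" for k i \<omega>
  define Q where "Q k \<omega> = (\<Sum>i<Suc k. if P k i \<omega> then f (?g k (Suc i)) \<omega> - f (?g k i) \<omega> else 0)" for k \<omega>
  have g: "a \<le> ?g k j" "?g k j \<le> T'" "?g k j \<in> {a..T}" if "j \<le> Suc k" for k j
    using grid_bounds[OF aT(1) that] T' by auto
  have \<theta>_F: "\<theta> k i \<in> borel_measurable (F (?g k i))" if i: "i < Suc k" for k i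
  proof -
    have [measurable]: "Measurable.pred (F (?g k i)) (\<lambda>\<omega>. ?g k i < \<tau> \<omega>)"
      by (rule stopping_timeD2[OF \<tau>(1)])
    have [measurable]: "Measurable.pred (F (?g k i)) (\<lambda>\<omega>. \<forall>j\<in>{..i}. \<bar>X (?g k j) \<omega>\<bar> \<le> R)"
    proof (intro pred_intros_finite)
      fix j assume j: "j \<in> {..i}"
      then have [measurable]: "X (?g k j) \<in> borel_measurable (F (?g k i))"
        using g[of j k] i aT by (intro X_F grid_mono) auto
      show "Measurable.pred (F (?g k i)) (\<lambda>\<omega>. \<bar>X (?g k j) \<omega>\<bar> \<le> R)" by measurable
    qed auto
    show ?thesis unfolding \<theta>_def[abs_def] P_def by measurable
  qed
  have \<theta>_M[measurable]: "\<theta> k i \<in> borel_measurable M" if "i < Suc k" for k i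
    using measurable_F_M[OF \<theta>_F[OF that]] .
  have Q_eq: "Q k \<omega> = (\<Sum>i<Suc k. \<theta> k i \<omega> * (f (?g k (Suc i)) \<omega> - f (?g k i) \<omega>))" for k \<omega>
    unfolding Q_def by (intro sum.cong refl) (auto simp: \<theta>_def)
  have term_M: "(\<lambda>\<omega>. \<theta> k i \<omega> * (f (?g k (Suc i)) \<omega> - f (?g k i) \<omega>)) \<in> borel_measurable M" if "i < Suc k" for k i
    using that g[of i k] g[of "Suc i" k] by (intro borel_measurable_times borel_measurable_diff \<theta>_M f_M) auto
  have term_int: "integrable M (\<lambda>\<omega>. \<theta> k i \<omega> * (f (?g k (Suc i)) \<omega> - f (?g k i) \<omega>))" if i: "i < Suc k" for k i
  proof (rule integrable_const_bound[where B = "2 * B"])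
    show "AE \<omega> in M. norm (\<theta> k i \<omega> * (f (?g k (Suc i)) \<omega> - f (?g k i) \<omega>)) \<le> 2 * B"
    proof (rule AE_I2)
      fix \<omega>
      have "\<bar>f (?g k (Suc i)) \<omega>\<bar> \<le> B" "\<bar>f (?g k i) \<omega>\<bar> \<le> B"
        using i g(3)[of i k] g(3)[of "Suc i" k] by (auto intro!: f_bd)
      then show "norm (\<theta> k i \<omega> * (f (?g k (Suc i)) \<omega> - f (?g k i) \<omega>)) \<le> 2 * B"
        using B0 by (auto simp: \<theta>_def)
    qed
  qed (rule term_M[OF i])
  have term_low: "- ((c + \<epsilon>) * ?h k) \<le> expectation (\<lambda>\<omega>. \<theta> k i \<omega> * (f (?g k (Suc i)) \<omega> - f (?g k i) \<omega>))"
    if i: "i < Suc k" and hd: "?h k \<le> d" for k i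
  proof -
    define s where "s = ?g k i"
    define t where "t = ?g k (Suc i)"
    have st: "0 \<le> s" "s \<le> t" "t \<le> T'" "t - s = ?h k" "s \<in> {0..T}" "t \<in> {0..T}" "a \<le> s" "s < T"
      using g[of i k] g[of "Suc i" k] i a aT T' grid_mono[OF aT(1), of i "Suc i" k] grid_diff[of a T' k i]
      by (auto simp: s_def t_def)
    have h0: "0 \<le> t - s" using st by simp
    define U where "U \<omega> = (\<theta> k i \<omega>, X s \<omega>)" for \<omega>
    define \<kappa> where "\<kappa> z = (case z of ((q, x), w) \<Rightarrow> if q = 1 then v (x + \<mu> * (t - s) + \<sigma> * w) t - v x s else 0)"
      for z :: "(real \<times> real) \<times> real"
    have "- ((c + \<epsilon>) * (t - s)) \<le> expectation (\<lambda>\<omega>. \<kappa> (U \<omega>, W t \<omega> - W s \<omega>))"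
    proof (rule increment_fubini_lower[OF st(1,2), where N = "borel \<Otimes>\<^sub>M borel" and c = "2 * B"])
      have "X s \<in> borel_measurable (F s)" using st by (intro X_F) auto
      then show "U \<in> F s \<rightarrow>\<^sub>M borel \<Otimes>\<^sub>M borel"
        unfolding U_def using \<theta>_F[OF i] by (intro measurable_Pair) (auto simp: s_def)
      have [measurable]: "(\<lambda>x. v x t) \<in> borel_measurable borel" "(\<lambda>x. v x s) \<in> borel_measurable borel"
        using st by (auto intro!: vm)
      show "\<kappa> \<in> borel_measurable ((borel \<Otimes>\<^sub>M borel) \<Otimes>\<^sub>M borel)"
        unfolding \<kappa>_def[abs_def] split_beta by measurable
      show "\<bar>\<kappa> z\<bar> \<le> 2 * B" for z
      proof -
        obtain q x w where z: "z = ((q, x), w)" by (metis surj_pair)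
        show ?thesis using B[OF st(6), of "x + \<mu> * (t - s) + \<sigma> * w"] B[OF st(5), of x] B0
          by (auto simp: \<kappa>_def z)
      qed
      fix \<omega> assume \<omega>: "\<omega> \<in> space M"
      show "- ((c + \<epsilon>) * (t - s)) \<le> expectation (\<lambda>\<omega>'. \<kappa> (U \<omega>, W t \<omega>' - W s \<omega>'))"
      proof (cases "P k i \<omega>")
        case True
        define x where "x = X s \<omega>"
        have x: "\<bar>x\<bar> \<le> R" using True by (auto simp: P_def x_def s_def)
        have s\<tau>: "s < \<tau> \<omega>" using True by (auto simp: P_def s_def)
        have [measurable]: "W t \<in> borel_measurable M" "W s \<in> borel_measurable M"
          using st by (auto intro!: W_measurable_M)
        have int: "integrable M (\<lambda>\<omega>'. v (x + \<mu> * (t - s) + \<sigma> * (W t \<omega>' - W s \<omega>')) t)"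
          using B[OF st(6)] by (intro integrable_const_bound[where B = B] measurable_compose[OF _ vm[OF st(6)]]) auto
        have "- c \<le> vt x s + \<mu> * vx x s + \<sigma>\<^sup>2 / 2 * vxx x s"
          unfolding x_def using st s\<tau> by (intro gen[OF \<omega>]) auto
        then have "(t - s) * - c \<le> (t - s) * (vt x s + \<mu> * vx x s + \<sigma>\<^sup>2 / 2 * vxx x s)"
          using h0 by (rule mult_left_mono)
        then have "- ((c + \<epsilon>) * (t - s)) \<le> (t - s) * (vt x s + \<mu> * vx x s + \<sigma>\<^sup>2 / 2 * vxx x s) - \<epsilon> * (t - s)"
          by (simp add: algebra_simps)
        also have "\<dots> \<le> expectation (\<lambda>\<omega>'. v (x + \<mu> * (t - s) + \<sigma> * (W t \<omega>' - W s \<omega>')) t) - v x s"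
          using step[OF x st(1,2,3)] hd st(4) by simp
        also have "\<dots> = expectation (\<lambda>\<omega>'. v (x + \<mu> * (t - s) + \<sigma> * (W t \<omega>' - W s \<omega>')) t - v x s)"
          using int by (simp add: prob_space)
        also have "\<dots> = expectation (\<lambda>\<omega>'. \<kappa> (U \<omega>, W t \<omega>' - W s \<omega>'))"
          using True by (simp add: \<kappa>_def U_def \<theta>_def x_def)
        finally show ?thesis .
      next
        case False
        then have "expectation (\<lambda>\<omega>'. \<kappa> (U \<omega>, W t \<omega>' - W s \<omega>')) = 0" by (simp add: \<kappa>_def U_def \<theta>_def)
        then show ?thesis using c \<epsilon> h0 by simp
      qed
    qed
    also have "expectation (\<lambda>\<omega>. \<kappa> (U \<omega>, W t \<omega> - W s \<omega>)) = expectation (\<lambda>\<omega>. \<theta> k i \<omega> * (f t \<omega> - f s \<omega>))"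
    proof (intro Bochner_Integration.integral_cong refl)
      fix \<omega>
      have "X t \<omega> = X s \<omega> + \<mu> * (t - s) + \<sigma> * (W t \<omega> - W s \<omega>)"
        unfolding X_def \<mu>_def by (rule log_gbm_step)
      then show "\<kappa> (U \<omega>, W t \<omega> - W s \<omega>) = \<theta> k i \<omega> * (f t \<omega> - f s \<omega>)"
        by (simp add: \<kappa>_def U_def \<theta>_def f_def)
    qed
    finally show ?thesis unfolding st(4) by (simp only: s_def t_def)
  qed
  have EQ: "- ((c + \<epsilon>) * (T' - a)) \<le> expectation (Q k)" if hd: "?h k \<le> d" for k
  proof -
    have "- ((c + \<epsilon>) * (T' - a)) = (\<Sum>i<Suc k. - ((c + \<epsilon>) * ?h k))"
      by (simp add: sum_negf del: of_nat_Suc)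
    also have "\<dots> \<le> (\<Sum>i<Suc k. expectation (\<lambda>\<omega>. \<theta> k i \<omega> * (f (?g k (Suc i)) \<omega> - f (?g k i) \<omega>)))"
      by (intro sum_mono term_low hd) auto
    also have "\<dots> = expectation (Q k)"
      unfolding Q_eq[abs_def] by (intro Bochner_Integration.integral_sum[symmetric] term_int) auto
    finally show ?thesis .
  qed
  have dec: "P k (Suc i) \<omega> \<Longrightarrow> P k i \<omega>" for k i \<omega>
    using grid_mono[OF aT(1), of i "Suc i" k] by (auto simp: P_def)
  have Q_tel: "\<exists>\<kappa>\<le>Suc k. (\<forall>i<\<kappa>. P k i \<omega>) \<and> (\<kappa> < Suc k \<longrightarrow> \<not> P k \<kappa> \<omega>) \<and> Q k \<omega> = f (?g k \<kappa>) \<omega> - f a \<omega>" for k \<omega>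
    using decreasing_telescope[of "\<lambda>i. P k i \<omega>" "Suc k" "\<lambda>i. f (?g k i) \<omega>", OF dec] unfolding Q_def by simp
  have Q_bd: "\<bar>Q k \<omega>\<bar> \<le> 2 * B" for k \<omega>
  proof -
    obtain \<kappa> where "\<kappa> \<le> Suc k" "Q k \<omega> = f (?g k \<kappa>) \<omega> - f a \<omega>" using Q_tel by blast
    then show ?thesis using f_bd[OF g(3), of \<kappa> k \<omega>] f_bd[of a \<omega>] aT by auto
  qed
  have Q_M[measurable]: "Q k \<in> borel_measurable M" for k
    unfolding Q_eq[abs_def] by (intro borel_measurable_sum term_M) auto
  have Q_lim: "(\<lambda>k. Q k \<omega>) \<longlonglongrightarrow> f (\<rho> \<omega>) \<omega> - f a \<omega>" if \<omega>: "\<omega> \<in> G" for \<omega>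
  proof -
    have \<omega>M: "\<omega> \<in> space M" using \<omega> by (simp add: G_def)
    have P: "P k i \<omega> \<longleftrightarrow> ?g k i < \<tau> \<omega>" if "i < Suc k" for k i
      using \<omega> g(3)[of _ k] that by (auto simp: P_def G_def simp del: atLeastAtMost_iff)
    have "\<exists>s. s \<in> {a..T} \<and> \<bar>s - \<rho> \<omega>\<bar> \<le> ?h k \<and> Q k \<omega> = f s \<omega> - f a \<omega>" for k
    proof -
      obtain \<kappa> where \<kappa>: "\<kappa> \<le> Suc k" "\<forall>i<\<kappa>. P k i \<omega>" "\<kappa> < Suc k \<longrightarrow> \<not> P k \<kappa> \<omega>"
        "Q k \<omega> = f (?g k \<kappa>) \<omega> - f a \<omega>" using Q_tel by blast
      have lo: "?g k \<kappa> \<le> \<tau> \<omega> + ?h k"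
      proof (cases \<kappa>)
        case 0
        have "0 \<le> ?h k" using aT by simp
        then show ?thesis using 0 \<tau>(2)[OF \<omega>M] by (simp add: add_increasing2)
      next
        case (Suc i)
        then have "?g k i < \<tau> \<omega>" using \<kappa> P[of i k] by auto
        then show ?thesis using grid_diff[of a T' k i] unfolding Suc by linarith
      qed
      have hi: "?g k \<kappa> = T' \<or> \<tau> \<omega> \<le> ?g k \<kappa>"
      proof (cases "\<kappa> < Suc k")
        case True then show ?thesis using \<kappa>(3) P[OF True] by auto
      next
        case False
        then have "\<kappa> = Suc k" using \<kappa>(1) by simp
        then show ?thesis by simp
      qed
      have "?g k \<kappa> \<le> T'" "0 \<le> ?h k" using g(2)[OF \<kappa>(1)] aT by auto
      with lo hi have "\<bar>?g k \<kappa> - \<rho> \<omega>\<bar> \<le> ?h k" unfolding \<rho>_def min_def by (auto split: if_splits)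
      then show ?thesis using g(3)[OF \<kappa>(1)] \<kappa>(4) by (intro exI[of _ "?g k \<kappa>"]) blast
    qed
    then obtain s where s: "\<And>k. s k \<in> {a..T}" "\<And>k. \<bar>s k - \<rho> \<omega>\<bar> \<le> ?h k" "\<And>k. Q k \<omega> = f (s k) \<omega> - f a \<omega>"
      by metis
    have "(\<lambda>k. ?h k) \<longlonglongrightarrow> 0"
      using LIMSEQ_inverse_real_of_nat by (auto intro!: tendsto_mult_right_zero simp: divide_inverse)
    then have "(\<lambda>k. s k - \<rho> \<omega>) \<longlonglongrightarrow> 0" by (rule Lim_null_comparison[rotated]) (use s(2) in auto)
    then have "s \<longlonglongrightarrow> \<rho> \<omega>" by (simp add: LIM_zero_iff)
    then have "(\<lambda>k. f (s k) \<omega>) \<longlonglongrightarrow> f (\<rho> \<omega>) \<omega>"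
      by (rule continuous_on_tendsto_compose[OF f_cont[OF \<omega>M]]) (use s(1) \<rho>[OF \<omega>M] in auto)
    then show ?thesis unfolding s(3) by (intro tendsto_diff tendsto_const)
  qed
  have "(\<lambda>k. expectation (\<lambda>\<omega>. Q k \<omega> * indicator G \<omega>)) \<longlonglongrightarrow> expectation (\<lambda>\<omega>. (f (\<rho> \<omega>) \<omega> - f a \<omega>) * indicator G \<omega>)"
  proof (rule integral_dominated_convergence[where w = "\<lambda>_. 2 * B"])
    have "f a \<in> borel_measurable M" using aT by (intro f_M) auto
    then show "(\<lambda>\<omega>. (f (\<rho> \<omega>) \<omega> - f a \<omega>) * indicator G \<omega>) \<in> borel_measurable M" by measurable
    show "AE \<omega> in M. (\<lambda>k. Q k \<omega> * indicator G \<omega>) \<longlonglongrightarrow> (f (\<rho> \<omega>) \<omega> - f a \<omega>) * indicator G \<omega>"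
      using Q_lim by (intro AE_I2) (auto simp: indicator_def)
    show "AE \<omega> in M. norm (Q k \<omega> * indicator G \<omega>) \<le> 2 * B" for k
      using Q_bd B0 by (intro AE_I2) (auto simp: indicator_def)
  qed auto
  moreover have "eventually (\<lambda>k. - ((c + \<epsilon>) * (T' - a)) - 2 * B * prob (space M - G)
    \<le> expectation (\<lambda>\<omega>. Q k \<omega> * indicator G \<omega>)) sequentially"
  proof -
    have "(\<lambda>k. ?h k) \<longlonglongrightarrow> 0"
      using LIMSEQ_inverse_real_of_nat by (auto intro!: tendsto_mult_right_zero simp: divide_inverse)
    then have "eventually (\<lambda>k. ?h k < d) sequentially" using d by (rule order_tendstoD)
    then show ?thesis
    proof eventually_elim
      case (elim k)
      have "expectation (Q k) \<le> expectation (\<lambda>\<omega>. Q k \<omega> * indicator G \<omega> + 2 * B * indicator (space M - G) \<omega>)"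
      proof (rule integral_mono)
        have Qi: "integrable M (Q k)" using Q_bd by (intro integrable_const_bound[where B = "2 * B"]) auto
        show "integrable M (Q k)" by fact
        show "integrable M (\<lambda>\<omega>. Q k \<omega> * indicator G \<omega> + 2 * B * indicator (space M - G) \<omega>)"
          by (intro Bochner_Integration.integrable_add integrable_mult_right integrable_real_mult_indicator Qi integrable_real_indicator)
            (auto simp: emeasure_eq_measure)
        show "Q k \<omega> \<le> Q k \<omega> * indicator G \<omega> + 2 * B * indicator (space M - G) \<omega>" if "\<omega> \<in> space M" for \<omega>
          using Q_bd[of k \<omega>] that by (auto simp: indicator_def)
      qed
      also have "\<dots> = expectation (\<lambda>\<omega>. Q k \<omega> * indicator G \<omega>) + 2 * B * prob (space M - G)"
      proof -
        have "integrable M (\<lambda>\<omega>. Q k \<omega> * indicator G \<omega>)"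
          using Q_bd B0 by (intro integrable_const_bound[where B = "2 * B"]) (auto simp: indicator_def)
        moreover have "integrable M (\<lambda>\<omega>. 2 * B * indicator (space M - G) \<omega>)"
          by (intro integrable_mult_right integrable_real_indicator) (auto simp: emeasure_eq_measure)
        ultimately show ?thesis by (subst Bochner_Integration.integral_add) (auto simp: Int_absorb2)
      qed
      finally show ?case using EQ[of k] elim by linarith
    qed
  qed
  ultimately have "- ((c + \<epsilon>) * (T' - a)) - 2 * B * prob (space M - G)
    \<le> expectation (\<lambda>\<omega>. (f (\<rho> \<omega>) \<omega> - f a \<omega>) * indicator G \<omega>)"
    by (intro tendsto_lowerbound) auto
  also have "\<dots> \<le> expectation (\<lambda>\<omega>. f (\<rho> \<omega>) \<omega> - v y a + 2 * B * indicator (space M - G) \<omega>)"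
  proof (rule integral_mono)
    have fa: "f a \<omega> = v y a" for \<omega> by (simp add: f_def X_def log_gbm_def)
    have bd: "\<bar>f (\<rho> \<omega>) \<omega>\<bar> \<le> B" if "\<omega> \<in> space M" for \<omega> using \<rho>[OF that] by (rule f_bd)
    have bv: "\<bar>v y a\<bar> \<le> B" using a aT by (intro B) auto
    show "integrable M (\<lambda>\<omega>. (f (\<rho> \<omega>) \<omega> - f a \<omega>) * indicator G \<omega>)"
      unfolding fa
    proof (rule integrable_const_bound[where B = "2 * B"])
      show "AE \<omega> in M. norm ((f (\<rho> \<omega>) \<omega> - v y a) * indicator G \<omega>) \<le> 2 * B"
      proof (rule AE_I2)
        fix \<omega> assume "\<omega> \<in> space M"
        then show "norm ((f (\<rho> \<omega>) \<omega> - v y a) * indicator G \<omega>) \<le> 2 * B"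
          using bd[of \<omega>] bv B0 by (auto simp: indicator_def)
      qed
    qed measurable
    have i: "integrable M (\<lambda>\<omega>. f (\<rho> \<omega>) \<omega>)" using bd by (intro integrable_const_bound[where B = B]) auto
    show "integrable M (\<lambda>\<omega>. f (\<rho> \<omega>) \<omega> - v y a + 2 * B * indicator (space M - G) \<omega>)"
      by (intro Bochner_Integration.integrable_add Bochner_Integration.integrable_diff i integrable_const integrable_mult_right integrable_real_indicator)
        (auto simp: emeasure_eq_measure)
    show "(f (\<rho> \<omega>) \<omega> - f a \<omega>) * indicator G \<omega> \<le> f (\<rho> \<omega>) \<omega> - v y a + 2 * B * indicator (space M - G) \<omega>"
      if "\<omega> \<in> space M" for \<omega>
      using bd[OF that] bv that by (auto simp: indicator_def fa)
  qed
  also have "\<dots> = expectation (\<lambda>\<omega>. f (\<rho> \<omega>) \<omega>) - v y a + 2 * B * prob (space M - G)"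
  proof -
    have i: "integrable M (\<lambda>\<omega>. f (\<rho> \<omega>) \<omega>)" using f_bd[OF \<rho>] by (intro integrable_const_bound[where B = B]) auto
    moreover have "integrable M (\<lambda>\<omega>. 2 * B * indicator (space M - G) \<omega>)"
      by (intro integrable_mult_right integrable_real_indicator) (auto simp: emeasure_eq_measure)
    ultimately show ?thesis
      by (subst Bochner_Integration.integral_add) (auto simp: Int_absorb2 prob_space)
  qed
  finally show ?thesis by (simp add: f_def \<rho>_def)
qed

text \<open>Dynkin's formula as an inequality: if the generator applied to \<open>v\<close> is at least \<open>- c\<close> along the path before \<open>\<tau>\<close>,
  then \<open>v\<close> loses at most \<open>c (T - a)\<close> in expectation up to \<open>\<tau>\<close>. Applied to \<open>- v\<close> it gives upper bounds.\<close>

lemma dynkin_lower: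
  fixes r \<sigma> a T y B c :: real and v vt vx vxx :: "real \<Rightarrow> real \<Rightarrow> real"
  defines "X \<equiv> log_gbm r \<sigma> a y" and "\<mu> \<equiv> r - \<sigma>\<^sup>2 / 2"
  assumes a: "0 \<le> a" and aT: "a \<le> T"
    and v: "C12 T v vt vx vxx"
    and v_cont: "continuous_on (UNIV \<times> {0..T}) (\<lambda>(x, t). v x t)"
    and B: "\<And>x t. t \<in> {0..T} \<Longrightarrow> \<bar>v x t\<bar> \<le> B"
    and \<tau>: "stopping_time F \<tau>" "\<And>\<omega>. \<omega> \<in> space M \<Longrightarrow> \<tau> \<omega> \<in> {a..T}"
    and c: "0 \<le> c"
    and gen: "\<And>\<omega> s. \<omega> \<in> space M \<Longrightarrow> s \<in> {a..<T} \<Longrightarrow> s < \<tau> \<omega> \<Longrightarrow>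
      - c \<le> vt (X s \<omega>) s + \<mu> * vx (X s \<omega>) s + \<sigma>\<^sup>2 / 2 * vxx (X s \<omega>) s"
  shows "v y a \<le> expectation (\<lambda>\<omega>. v (X (\<tau> \<omega>) \<omega>) (\<tau> \<omega>)) + c * (T - a)"
proof (cases "a = T")
  case True
  then have "\<tau> \<omega> = a" if "\<omega> \<in> space M" for \<omega> using \<tau>(2)[OF that] by auto
  then have "expectation (\<lambda>\<omega>. v (X (\<tau> \<omega>) \<omega>) (\<tau> \<omega>)) = expectation (\<lambda>\<omega>. v y a)"
    by (intro Bochner_Integration.integral_cong) (auto simp: X_def log_gbm_def)
  then show ?thesis using True by (simp add: prob_space)
next
  case False
  then have aT': "a < T" using aT by simp
  have B0: "0 \<le> B" using B[of 0 0] a aT by auto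
  have X_cont: "continuous_on {a..T} (\<lambda>s. X s \<omega>)" if "\<omega> \<in> space M" for \<omega>
    unfolding X_def using that a by (rule log_gbm_continuous)
  have X_M: "X s \<in> borel_measurable M" if "a \<le> s" for s
    unfolding X_def using measurable_F_M[OF log_gbm_measurable[OF a that order_refl]] .
  have v_cont1: "continuous_on UNIV (\<lambda>x. v x t)" if "t \<in> {0..T}" for t
    using that by (intro continuous_on_compose2[OF v_cont, of _ "\<lambda>x. (x, t)", simplified] continuous_intros) auto
  define f where "f s \<omega> = v (X s \<omega>) s" for s \<omega>
  have f_cont: "continuous_on {a..T} (\<lambda>s. f s \<omega>)" if "\<omega> \<in> space M" for \<omega>
    unfolding f_def using a
    by (intro continuous_on_compose2[OF v_cont, of _ "\<lambda>s. (X s \<omega>, s)", simplified] continuous_intros X_cont that) auto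
  have f_M: "f s \<in> borel_measurable M" if "s \<in> {a..T}" for s
    unfolding f_def[abs_def] using that a
    by (intro measurable_compose[OF X_M borel_measurable_continuous_onI[OF v_cont1]]) auto
  have f_bd: "\<bar>f s \<omega>\<bar> \<le> B" if "s \<in> {a..T}" for s \<omega>
    unfolding f_def using that a by (intro B) auto
  note [measurable] = stopping_time_measurable[OF \<tau>(1)]
  define T' where "T' n = T - (T - a) / (real n + 2)" for n :: nat
  have T': "a < T' n" "T' n < T" for n
  proof -
    have "0 < (T - a) / (real n + 2)" using aT' by (intro divide_pos_pos) auto
    moreover have "(T - a) / (real n + 2) < (T - a) / 1" using aT' by (intro divide_strict_left_mono) auto
    ultimately show "a < T' n" "T' n < T" by (auto simp: T'_def)
  qed
  define G where "G n = {\<omega> \<in> space M. \<forall>s\<in>{a..T}. \<bar>X s \<omega>\<bar> \<le> real n}" for n :: nat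
  have main: "v y a \<le> expectation (\<lambda>\<omega>. f (min (\<tau> \<omega>) (T' n)) \<omega>)
    + (c + 1 / real (Suc n)) * (T' n - a) + 4 * B * prob (space M - G n)" for n
    unfolding f_def G_def X_def
    by (rule dynkin_lower_localized[OF a T' v v_cont B \<tau> c gen[unfolded X_def \<mu>_def]]) auto
  have G_M: "G n \<in> sets M" for n
    unfolding G_def using aT X_M X_cont by (intro path_bound_measurable) auto
  have "(\<lambda>n. prob (space M - G n)) \<longlonglongrightarrow> prob (\<Inter>n. space M - G n)"
  proof (rule finite_Lim_measure_decseq)
    show "range (\<lambda>n. space M - G n) \<subseteq> sets M" using G_M by auto
    show "decseq (\<lambda>n. space M - G n)"
      unfolding decseq_def G_def by (auto intro: order_trans)
  qed
  also have "(\<Inter>n. space M - G n) = {}"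
  proof (rule equals0I)
    fix \<omega> assume \<omega>: "\<omega> \<in> (\<Inter>n. space M - G n)"
    then have \<omega>M: "\<omega> \<in> space M" by auto
    have "bounded ((\<lambda>s. X s \<omega>) ` {a..T})"
      using X_cont[OF \<omega>M] by (intro compact_imp_bounded compact_continuous_image) auto
    then obtain b where b: "\<forall>s\<in>{a..T}. \<bar>X s \<omega>\<bar> \<le> b" unfolding bounded_iff by auto
    obtain n where "b \<le> real n" using real_arch_simple by blast
    then have "\<omega> \<in> G n" using b \<omega>M by (auto simp: G_def intro: order_trans)
    then show False using \<omega> by auto
  qed
  finally have lim1: "(\<lambda>n. prob (space M - G n)) \<longlonglongrightarrow> 0" by simp
  have lim2: "T' \<longlonglongrightarrow> T"
  proof -
    have "(\<lambda>n. (T - a) / (real n + 2)) \<longlonglongrightarrow> 0" by real_asymp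
    from tendsto_diff[OF tendsto_const this, of T] show ?thesis by (simp add: T'_def[abs_def])
  qed
  have lim3: "(\<lambda>n. 1 / real (Suc n)) \<longlonglongrightarrow> 0"
    using LIMSEQ_inverse_real_of_nat by (simp add: divide_inverse)
  have lim4: "(\<lambda>n. expectation (\<lambda>\<omega>. f (min (\<tau> \<omega>) (T' n)) \<omega>)) \<longlonglongrightarrow> expectation (\<lambda>\<omega>. f (\<tau> \<omega>) \<omega>)"
  proof (rule integral_dominated_convergence[where w = "\<lambda>_. B"])
    show "(\<lambda>\<omega>. f (\<tau> \<omega>) \<omega>) \<in> borel_measurable M"
      by (rule process_at_time_measurable[OF aT f_M f_cont _ \<tau>(2)]) auto
    have m: "min (\<tau> \<omega>) (T' n) \<in> {a..T}" if "\<omega> \<in> space M" for \<omega> n using \<tau>(2)[OF that] T'[of n] by auto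
    show "(\<lambda>\<omega>. f (min (\<tau> \<omega>) (T' n)) \<omega>) \<in> borel_measurable M" for n
      by (rule process_at_time_measurable[OF aT f_M f_cont _ m]) auto
    show "AE \<omega> in M. norm (f (min (\<tau> \<omega>) (T' n)) \<omega>) \<le> B" for n
      using f_bd[OF m] by (intro AE_I2) auto
    show "AE \<omega> in M. (\<lambda>n. f (min (\<tau> \<omega>) (T' n)) \<omega>) \<longlonglongrightarrow> f (\<tau> \<omega>) \<omega>"
    proof (rule AE_I2)
      fix \<omega> assume \<omega>: "\<omega> \<in> space M"
      have "(\<lambda>n. min (\<tau> \<omega>) (T' n)) \<longlonglongrightarrow> min (\<tau> \<omega>) T" by (intro tendsto_min tendsto_const lim2)
      moreover have "min (\<tau> \<omega>) T = \<tau> \<omega>" using \<tau>(2)[OF \<omega>] by simp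
      ultimately have "(\<lambda>n. min (\<tau> \<omega>) (T' n)) \<longlonglongrightarrow> \<tau> \<omega>" by simp
      then show "(\<lambda>n. f (min (\<tau> \<omega>) (T' n)) \<omega>) \<longlonglongrightarrow> f (\<tau> \<omega>) \<omega>"
        by (rule continuous_on_tendsto_compose[OF f_cont[OF \<omega>]]) (use m[OF \<omega>] \<tau>(2)[OF \<omega>] in auto)
    qed
  qed auto
  have "v y a \<le> expectation (\<lambda>\<omega>. f (\<tau> \<omega>) \<omega>) + (c + 0) * (T - a) + 4 * B * 0"
  proof (rule LIMSEQ_le_const)
    show "(\<lambda>n. expectation (\<lambda>\<omega>. f (min (\<tau> \<omega>) (T' n)) \<omega>)
      + (c + 1 / real (Suc n)) * (T' n - a) + 4 * B * prob (space M - G n))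
      \<longlonglongrightarrow> expectation (\<lambda>\<omega>. f (\<tau> \<omega>) \<omega>) + (c + 0) * (T - a) + 4 * B * 0"
      by (intro tendsto_add tendsto_mult tendsto_diff tendsto_const lim1 lim2 lim3 lim4)
  qed (use main in blast)
  then show ?thesis by (simp add: f_def)
qed

end

section \<open>The penalized solution stays close to the obstacle\<close>

lemma interior_min_second_derivative_nonneg:
  fixes f :: "real \<Rightarrow> real"
  assumes f: "\<And>x. (f has_real_derivative f' x) (at x)" and f': "(f' has_real_derivative f'') (at x)"
    and x: "a < x" "x < b" and min: "\<And>y. y \<in> {a..b} \<Longrightarrow> f x \<le> f y"
  shows "f' x = 0" "0 \<le> f''"
proof -
  show f'0: "f' x = 0"
    using x min by (intro DERIV_local_min[OF f, of "min (x - a) (b - x)"]) (auto simp: abs_less_iff)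
  show "0 \<le> f''"
  proof (rule ccontr)
    assume "\<not> 0 \<le> f''"
    then obtain d where d: "d > 0" "\<And>h. 0 < h \<Longrightarrow> h < d \<Longrightarrow> f' (x + h) < 0"
      using DERIV_neg_dec_right[OF f'] f'0 by auto
    define h where "h = min (d / 2) (b - x)"
    have h: "0 < h" "h < d" "x + h \<in> {a..b}" using d x by (auto simp: h_def)
    obtain z where z: "x < z" "z < x + h" "f (x + h) - f x = (x + h - x) * f' z"
      using MVT2[of x "x + h" f f'] f h by auto
    have "f' z < 0" using d(2)[of "z - x"] z h by simp
    then have "h * f' z < 0" using h(1) by (intro mult_pos_neg)
    then have "f (x + h) < f x" using z(3) by simp
    then show False using min[OF h(3)] by simp
  qed
qed

text \<open>The comparison takes place on \<open>x \<le> ln K\<close>, where the payoff is smooth. The linear function \<open>p\<close>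
  compensates for the unboundedness of the domain as \<open>x\<close> tends to minus infinity.\<close>

lemma penalized_solution_ge_obstacle:
  assumes K: "0 < K" and r: "0 < r" and T: "0 < T" and l: "0 < l"
    and u: "penalized_solution r \<sigma> K T l u"
    and c: "0 \<le> c" "r * K \<le> l * exp c"
    and t0: "t0 \<in> {0..T}"
  shows "put_payoff K (exp x0) - l * c \<le> u x0 t0"
proof (rule ccontr)
  assume neg: "\<not> put_payoff K (exp x0) - l * c \<le> u x0 t0"
  obtain ut ux uxx where
    D: "\<And>x t. t \<in> {0..<T} \<Longrightarrow> ((\<lambda>s. u x s) has_real_derivative ut x t) (at t within {0..T})"
       "\<And>x t. t \<in> {0..<T} \<Longrightarrow> ((\<lambda>y. u y t) has_real_derivative ux x t) (at x)"
       "\<And>x t. t \<in> {0..<T} \<Longrightarrow> ((\<lambda>y. ux y t) has_real_derivative uxx x t) (at x)"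
    and pde: "\<And>x t. t \<in> {0..<T} \<Longrightarrow> ut x t + (\<sigma>\<^sup>2 / 2 * uxx x t + (r - \<sigma>\<^sup>2 / 2) * ux x t - r * u x t)
      + l * exp (- (u x t - put_payoff K (exp x)) / l) = 0"
    and u_cont: "continuous_on (UNIV \<times> {0..T}) (\<lambda>(x, t). u x t)"
    and u_T: "\<And>x. u x T = put_payoff K (exp x)"
    and u_0: "\<And>x t. t \<in> {0..T} \<Longrightarrow> 0 \<le> u x t"
    using u unfolding penalized_solution_def by blast
  define d where "d x t = u x t - (K - exp x) + l * c" for x t
  have lc: "0 \<le> l * c" using l c by simp
  have payoff: "put_payoff K (exp x) = K - exp x" if "x \<le> ln K" for x
  proof -
    have "exp x \<le> exp (ln K)" using that by simp
    then have "exp x \<le> K" using K by simp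
    then show ?thesis by (simp add: put_payoff_def)
  qed
  have x0: "x0 < ln K"
  proof (rule ccontr)
    assume "\<not> x0 < ln K"
    then have "exp (ln K) \<le> exp x0" by simp
    then have "K \<le> exp x0" using K by simp
    then show False using neg u_0[OF t0, of x0] lc by (simp add: put_payoff_def)
  qed
  have d0: "d x0 t0 < 0" using neg payoff[of x0] x0 by (simp add: d_def)
  \<comment> \<open>The constant dominates the first-order coefficient, so that \<open>p\<close> is a strict supersolution.\<close>
  define A where "A = \<bar>r - \<sigma>\<^sup>2 / 2\<bar> + 1"
  define p where "p x t = (ln K - x) + A * (T - t)" for x t
  have p_nn: "0 \<le> p x t" if "x \<le> ln K" "t \<in> {0..T}" for x t
    using that by (auto simp: p_def A_def intro!: add_nonneg_nonneg mult_nonneg_nonneg)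
  define \<epsilon> where "\<epsilon> = - d x0 t0 / (p x0 t0 + 1)"
  have p0: "0 \<le> p x0 t0" using x0 t0 by (intro p_nn) auto
  have \<epsilon>: "0 < \<epsilon>" using d0 p0 by (simp add: \<epsilon>_def divide_neg_pos)
  have "\<epsilon> * p x0 t0 < \<epsilon> * (p x0 t0 + 1)" using \<epsilon> by simp
  also have "\<dots> = - d x0 t0" using p0 by (simp add: \<epsilon>_def)
  finally have \<phi>0: "d x0 t0 + \<epsilon> * p x0 t0 < 0" by simp
  define \<phi> where "\<phi> x t = d x t + \<epsilon> * p x t" for x t
  define x1 where "x1 = ln K - K / \<epsilon>"
  have left: "0 \<le> \<phi> x t" if "x \<le> x1" "t \<in> {0..T}" for x t
  proof -
    have "K \<le> \<epsilon> * (ln K - x)" using that \<epsilon> by (simp add: x1_def field_simps)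
    moreover have "0 \<le> \<epsilon> * (A * (T - t))" using \<epsilon> that by (auto simp: A_def)
    ultimately show ?thesis
      using u_0[OF that(2), of x] lc exp_gt_zero[of x] unfolding \<phi>_def d_def p_def distrib_left by linarith
  qed
  have x1: "x1 < x0" using left[of x0 t0] t0 \<phi>0 unfolding \<phi>_def by (meson not_le)
  let ?Q = "{x1..ln K} \<times> {0..T}"
  have "continuous_on ?Q (\<lambda>(x, t). u x t)" using u_cont by (rule continuous_on_subset) auto
  then have "continuous_on ?Q (\<lambda>z. \<phi> (fst z) (snd z))"
    unfolding \<phi>_def d_def p_def by (intro continuous_intros) (simp_all add: split_beta)
  moreover have "compact ?Q" by (intro compact_Times compact_Icc)
  moreover have "?Q \<noteq> {}" using x1 x0 T by auto
  ultimately obtain z where "z \<in> ?Q" "\<forall>w\<in>?Q. \<phi> (fst z) (snd z) \<le> \<phi> (fst w) (snd w)"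
    using continuous_attains_inf by blast
  then obtain x t where x: "x \<in> {x1..ln K}" and t: "t \<in> {0..T}"
    and min: "\<And>x' t'. x' \<in> {x1..ln K} \<Longrightarrow> t' \<in> {0..T} \<Longrightarrow> \<phi> x t \<le> \<phi> x' t'"
    by (cases z) auto
  have "\<phi> x t \<le> \<phi> x0 t0" using x0 x1 t0 by (intro min) auto
  then have \<phi>neg: "\<phi> x t < 0" using \<phi>0 by (simp add: \<phi>_def)
  have pxt: "0 \<le> p x t" using x t by (intro p_nn) auto
  have dneg: "d x t < 0"
    using \<phi>neg mult_nonneg_nonneg[OF less_imp_le[OF \<epsilon>] pxt] unfolding \<phi>_def by linarith
  have xlt: "x1 < x" "x < ln K"
  proof -
    show "x1 < x" using left[of x t] t \<phi>neg by (meson not_le)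
    have "x \<noteq> ln K"
    proof
      assume "x = ln K"
      then have "d x t = u x t + l * c" using K by (simp add: d_def)
      then show False using dneg u_0[OF t, of x] lc by simp
    qed
    then show "x < ln K" using x by simp
  qed
  have "t \<noteq> T"
  proof
    assume "t = T"
    then show False using dneg u_T[of x] payoff[of x] x lc by (simp add: d_def)
  qed
  then have tlt: "t \<in> {0..<T}" using t by auto
  have DX: "((\<lambda>x. \<phi> x t) has_real_derivative ux y t + exp y - \<epsilon>) (at y)" for y
    unfolding \<phi>_def d_def p_def by (auto intro!: derivative_eq_intros D(2) tlt)
  have DXX: "((\<lambda>y. ux y t + exp y - \<epsilon>) has_real_derivative uxx x t + exp x) (at x)"
    by (auto intro!: derivative_eq_intros D(3) tlt)
  have fx: "ux x t + exp x - \<epsilon> = 0" and fxx: "0 \<le> uxx x t + exp x"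
    using interior_min_second_derivative_nonneg[OF DX DXX xlt] min[OF _ t] by auto
  have ft: "0 \<le> ut x t - \<epsilon> * A"
  proof (rule ccontr)
    assume "\<not> 0 \<le> ut x t - \<epsilon> * A"
    moreover have "((\<lambda>s. \<phi> x s) has_real_derivative ut x t - \<epsilon> * A) (at t within {0..T})"
      unfolding \<phi>_def d_def p_def by (auto intro!: derivative_eq_intros D(1) tlt)
    ultimately obtain d where d: "d > 0" "\<And>h. 0 < h \<Longrightarrow> t + h \<in> {0..T} \<Longrightarrow> h < d \<Longrightarrow> \<phi> x (t + h) < \<phi> x t"
      using has_real_derivative_neg_dec_right[of "\<phi> x"] by (meson not_le)
    define h where "h = min (d / 2) (T - t)"
    have "0 < h" "t + h \<in> {0..T}" "h < d" using d tlt by (auto simp: h_def)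
    then show False using d(2)[of h] min[OF x, of "t + h"] by auto
  qed
  have ex: "r * K \<le> l * exp (- (u x t - put_payoff K (exp x)) / l)"
  proof -
    have "c \<le> - (u x t - put_payoff K (exp x)) / l"
      using dneg l payoff[of x] x by (simp add: d_def pos_le_divide_eq algebra_simps)
    then have "l * exp c \<le> l * exp (- (u x t - put_payoff K (exp x)) / l)"
      using l by (intro mult_left_mono) auto
    then show ?thesis using c(2) by simp
  qed
  have ru: "r * u x t \<le> r * (K - exp x)"
    using dneg lc r by (intro mult_left_mono) (auto simp: d_def)
  have bux: "(r - \<sigma>\<^sup>2 / 2) * ux x t = (r - \<sigma>\<^sup>2 / 2) * \<epsilon> - r * exp x + \<sigma>\<^sup>2 / 2 * exp x"
  proof -
    have e: "ux x t = \<epsilon> - exp x" using fx by simp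
    show ?thesis unfolding e by (simp add: field_simps)
  qed
  have suxx: "- (\<sigma>\<^sup>2 / 2 * exp x) \<le> \<sigma>\<^sup>2 / 2 * uxx x t"
  proof -
    have "\<sigma>\<^sup>2 / 2 * (- exp x) \<le> \<sigma>\<^sup>2 / 2 * uxx x t" using fxx by (intro mult_left_mono) auto
    then show ?thesis by simp
  qed
  have "0 < \<epsilon> * (A + (r - \<sigma>\<^sup>2 / 2))" using \<epsilon> by (intro mult_pos_pos) (auto simp: A_def)
  then have "0 < \<epsilon> * A + (r - \<sigma>\<^sup>2 / 2) * \<epsilon>" by (simp add: algebra_simps)
  then show False
    using pde[OF tlt, of x] ex ru bux suxx ft unfolding right_diff_distrib by linarith
qed

section \<open>Hitting times\<close>

text \<open>The first time in \<open>[a, T]\<close> at which the process \<open>w\<close> is nonpositive, and \<open>T\<close> if there is none.\<close>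

definition hitting_time :: "real \<Rightarrow> real \<Rightarrow> (real \<Rightarrow> 'a \<Rightarrow> real) \<Rightarrow> 'a \<Rightarrow> real" where
  "hitting_time a T w \<omega> = Inf (insert T {t \<in> {a..T}. w t \<omega> \<le> 0})"

lemma hitting_time_properties:
  fixes w :: "real \<Rightarrow> 'a \<Rightarrow> real"
  assumes aT: "a \<le> T" and w: "continuous_on {a..T} (\<lambda>t. w t \<omega>)"
  shows "hitting_time a T w \<omega> \<in> {a..T}"
    and "s \<in> {a..T} \<Longrightarrow> s < hitting_time a T w \<omega> \<Longrightarrow> 0 < w s \<omega>"
    and "hitting_time a T w \<omega> = T \<or> w (hitting_time a T w \<omega>) \<omega> \<le> 0"
    and "t \<in> {a..<T} \<Longrightarrow> hitting_time a T w \<omega> \<le> t \<longleftrightarrow> (\<exists>s\<in>{a..t}. w s \<omega> \<le> 0)"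
proof -
  let ?C = "insert T {t \<in> {a..T}. w t \<omega> \<le> 0}"
  have "closed {t \<in> {a..T}. w t \<omega> \<le> 0}"
    by (rule continuous_on_closed_Collect_le[OF w continuous_on_const closed_atLeastAtMost])
  then have cl: "closed ?C" by (rule closed_insert)
  have bd: "bdd_below ?C" using aT by (intro bdd_belowI[of _ a]) auto
  have "Inf ?C \<in> ?C" using cl bd by (intro closed_contains_Inf) auto
  then have mem: "hitting_time a T w \<omega> \<in> ?C" by (simp only: hitting_time_def)
  have le: "hitting_time a T w \<omega> \<le> s" if "s \<in> ?C" for s
    unfolding hitting_time_def using that bd by (rule cInf_lower)
  show "hitting_time a T w \<omega> \<in> {a..T}" using mem aT by auto
  show "0 < w s \<omega>" if "s \<in> {a..T}" "s < hitting_time a T w \<omega>"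
    using le[of s] that by force
  show "hitting_time a T w \<omega> = T \<or> w (hitting_time a T w \<omega>) \<omega> \<le> 0" using mem by auto
  show "hitting_time a T w \<omega> \<le> t \<longleftrightarrow> (\<exists>s\<in>{a..t}. w s \<omega> \<le> 0)" if t: "t \<in> {a..<T}"
  proof
    assume "hitting_time a T w \<omega> \<le> t"
    then show "\<exists>s\<in>{a..t}. w s \<omega> \<le> 0" using mem t by auto
  next
    assume "\<exists>s\<in>{a..t}. w s \<omega> \<le> 0"
    then obtain s where "s \<in> {a..t}" "w s \<omega> \<le> 0" by blast
    then show "hitting_time a T w \<omega> \<le> t" using le[of s] t by auto
  qed
qed

context brownian_motion
begin

text \<open>No right-continuity of the filtration is needed: a continuous path reaches the closed half-line by
  time \<open>t\<close> exactly if it comes arbitrarily close to it on the grids of \<open>[a, t]\<close>.\<close>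

lemma hitting_time_stopping_time:
  fixes w :: "real \<Rightarrow> 'a \<Rightarrow> real"
  assumes aT: "a \<le> T" and w: "\<And>\<omega>. \<omega> \<in> space M \<Longrightarrow> continuous_on {a..T} (\<lambda>t. w t \<omega>)"
    and w_F: "\<And>t. t \<in> {a..T} \<Longrightarrow> w t \<in> borel_measurable (F t)"
  shows "stopping_time F (hitting_time a T w)"
proof
  fix t
  consider "t < a" | "a \<le> t" "t < T" | "T \<le> t" by linarith
  then show "Measurable.pred (F t) (\<lambda>\<omega>. hitting_time a T w \<omega> \<le> t)"
  proof cases
    case 1
    have "hitting_time a T w \<omega> \<le> t \<longleftrightarrow> False" if "\<omega> \<in> space (F t)" for \<omega>
      using hitting_time_properties(1)[where w = w and \<omega> = \<omega>, OF aT w] that 1 by (auto simp: space_F)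
    then have "Measurable.pred (F t) (\<lambda>\<omega>. hitting_time a T w \<omega> \<le> t) \<longleftrightarrow> Measurable.pred (F t) (\<lambda>\<omega>. False)"
      by (rule measurable_cong)
    then show ?thesis by simp
  next
    case 3
    have "hitting_time a T w \<omega> \<le> t \<longleftrightarrow> True" if "\<omega> \<in> space (F t)" for \<omega>
      using hitting_time_properties(1)[where w = w and \<omega> = \<omega>, OF aT w] that 3 by (auto simp: space_F)
    then have "Measurable.pred (F t) (\<lambda>\<omega>. hitting_time a T w \<omega> \<le> t) \<longleftrightarrow> Measurable.pred (F t) (\<lambda>\<omega>. True)"
      by (rule measurable_cong)
    then show ?thesis by simp
  next
    case 2
    have "Measurable.pred (F t) (\<lambda>\<omega>. \<forall>n. \<exists>k. \<exists>j\<in>{..Suc k}. w (grid a t k j) \<omega> < 1 / real (Suc n))"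
    proof (intro pred_intros_countable pred_intros_finite)
      fix n k j assume "j \<in> {..Suc k}"
      then have "grid a t k j \<in> {a..t}" using grid_bounds[OF 2(1)] by auto
      then have [measurable]: "w (grid a t k j) \<in> borel_measurable (F t)"
        using 2 by (intro measurable_F_mono[OF w_F]) auto
      show "Measurable.pred (F t) (\<lambda>\<omega>. w (grid a t k j) \<omega> < 1 / real (Suc n))" by measurable
    qed auto
    also have "?this \<longleftrightarrow> Measurable.pred (F t) (\<lambda>\<omega>. hitting_time a T w \<omega> \<le> t)"
    proof (rule measurable_cong)
      fix \<omega> assume "\<omega> \<in> space (F t)"
      then have \<omega>: "\<omega> \<in> space M" by (simp add: space_F)
      have wt: "continuous_on {a..t} (\<lambda>t. w t \<omega>)" using 2 by (intro continuous_on_subset[OF w[OF \<omega>]]) auto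
      have "(\<forall>n. \<exists>k. \<exists>j\<in>{..Suc k}. w (grid a t k j) \<omega> < 1 / real (Suc n)) \<longleftrightarrow> (\<exists>s\<in>{a..t}. w s \<omega> \<le> 0)"
      proof
        assume *: "\<forall>n. \<exists>k. \<exists>j\<in>{..Suc k}. w (grid a t k j) \<omega> < 1 / real (Suc n)"
        have "{a..t} \<noteq> {}" using 2 by auto
        from continuous_attains_inf[OF compact_Icc this wt]
        obtain s where s: "s \<in> {a..t}" "\<And>y. y \<in> {a..t} \<Longrightarrow> w s \<omega> \<le> w y \<omega>" by blast
        have "w s \<omega> \<le> 1 / real (Suc n)" for n
        proof -
          obtain k j where "j \<in> {..Suc k}" "w (grid a t k j) \<omega> < 1 / real (Suc n)" using * by blast
          then show ?thesis using s(2)[OF grid_bounds[OF 2(1), of j k]] by simp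
        qed
        moreover have "(\<lambda>n. 1 / real (Suc n)) \<longlonglongrightarrow> 0"
          using LIMSEQ_inverse_real_of_nat by (simp add: divide_inverse)
        ultimately have "w s \<omega> \<le> 0" by (intro LIMSEQ_le_const) auto
        then show "\<exists>s\<in>{a..t}. w s \<omega> \<le> 0" using s(1) by blast
      next
        assume "\<exists>s\<in>{a..t}. w s \<omega> \<le> 0"
        then obtain s where s: "s \<in> {a..t}" "w s \<omega> \<le> 0" by blast
        show "\<forall>n. \<exists>k. \<exists>j\<in>{..Suc k}. w (grid a t k j) \<omega> < 1 / real (Suc n)"
        proof
          fix n
          define e where "e = 1 / real (Suc n)"
          have e: "0 < e / 2" by (simp add: e_def)
          from grid_dense[OF wt 2(1) s(1) e] obtain k j where
            j: "j \<le> Suc k" "\<bar>w s \<omega> - w (grid a t k j) \<omega>\<bar> \<le> e / 2" by blast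
          then have "w (grid a t k j) \<omega> < e" using e s(2) unfolding abs_le_iff by linarith
          then have "w (grid a t k j) \<omega> < 1 / real (Suc n)" by (simp only: e_def)
          then show "\<exists>k. \<exists>j\<in>{..Suc k}. w (grid a t k j) \<omega> < 1 / real (Suc n)" using j(1) by (intro exI[of _ k] bexI[of _ j]) auto
        qed
      qed
      also have "\<dots> \<longleftrightarrow> hitting_time a T w \<omega> \<le> t"
        using hitting_time_properties(4)[where w = w and \<omega> = \<omega>, OF aT w[OF \<omega>], of t] 2 by auto
      finally show "(\<forall>n. \<exists>k. \<exists>j\<in>{..Suc k}. w (grid a t k j) \<omega> < 1 / real (Suc n)) = (hitting_time a T w \<omega> \<le> t)" .
    qed
    finally show ?thesis .
  qed
qed

end

section \<open>The value of exercising\<close>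

lemma put_payoff_bounds: "0 < K \<Longrightarrow> 0 \<le> put_payoff K s" "0 < K \<Longrightarrow> 0 < s \<Longrightarrow> put_payoff K s \<le> K"
  by (auto simp: put_payoff_def)

lemma put_payoff_continuous [continuous_intros]:
  "continuous_on A f \<Longrightarrow> continuous_on A (\<lambda>x. put_payoff K (f x))"
  unfolding put_payoff_def by (intro continuous_intros)

lemma C12_uminus:
  assumes "C12 T v vt vx vxx"
  shows "C12 T (\<lambda>x t. - v x t) (\<lambda>x t. - vt x t) (\<lambda>x t. - vx x t) (\<lambda>x t. - vxx x t)"
  using assms unfolding C12_def split_beta by (auto intro!: continuous_intros derivative_eq_intros)

text \<open>The discounted penalized solution is a supersolution of the backward equation whose defect is
  at most \<open>l\<close> as long as the solution stays above the obstacle.\<close>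

lemma penalized_solution_discounted:
  assumes u: "penalized_solution r \<sigma> K T l u" and l: "0 < l" and r: "0 < r" and K: "0 < K"
  shows "\<exists>wt wx wxx. C12 T (\<lambda>x t. exp (- r * t) * u x t) wt wx wxx \<and>
    (\<forall>x. \<forall>t\<in>{0..<T}. wt x t + (r - \<sigma>\<^sup>2 / 2) * wx x t + \<sigma>\<^sup>2 / 2 * wxx x t \<le> 0) \<and>
    (\<forall>x. \<forall>t\<in>{0..<T}. put_payoff K (exp x) \<le> u x t \<longrightarrow>
      - exp (- r * t) * l \<le> wt x t + (r - \<sigma>\<^sup>2 / 2) * wx x t + \<sigma>\<^sup>2 / 2 * wxx x t)"
proof -
  obtain ut ux uxx where
    C: "continuous_on (UNIV \<times> {0..<T}) (\<lambda>(x, t). ut x t)"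
       "continuous_on (UNIV \<times> {0..<T}) (\<lambda>(x, t). ux x t)"
       "continuous_on (UNIV \<times> {0..<T}) (\<lambda>(x, t). uxx x t)"
    and all: "\<forall>x. \<forall>t\<in>{0..<T}.
       ((\<lambda>s. u x s) has_real_derivative ut x t) (at t within {0..T}) \<and>
       ((\<lambda>y. u y t) has_real_derivative ux x t) (at x) \<and>
       ((\<lambda>y. ux y t) has_real_derivative uxx x t) (at x) \<and>
       ut x t + (\<sigma>\<^sup>2 / 2 * uxx x t + (r - \<sigma>\<^sup>2 / 2) * ux x t - r * u x t)
         + l * exp (- (u x t - put_payoff K (exp x)) / l) = 0"
    and u_cont: "continuous_on (UNIV \<times> {0..T}) (\<lambda>(x, t). u x t)"
    using u unfolding penalized_solution_def by (elim conjE exE) (rule that)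
  have D: "\<And>x t. t \<in> {0..<T} \<Longrightarrow> ((\<lambda>s. u x s) has_real_derivative ut x t) (at t within {0..T})"
       "\<And>x t. t \<in> {0..<T} \<Longrightarrow> ((\<lambda>y. u y t) has_real_derivative ux x t) (at x)"
       "\<And>x t. t \<in> {0..<T} \<Longrightarrow> ((\<lambda>y. ux y t) has_real_derivative uxx x t) (at x)"
    and pde: "\<And>x t. t \<in> {0..<T} \<Longrightarrow> ut x t + (\<sigma>\<^sup>2 / 2 * uxx x t + (r - \<sigma>\<^sup>2 / 2) * ux x t - r * u x t)
      + l * exp (- (u x t - put_payoff K (exp x)) / l) = 0"
    using all by blast+
  have u_cont': "continuous_on (UNIV \<times> {0..<T}) (\<lambda>(x, t). u x t)"
    using u_cont by (rule continuous_on_subset) auto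
  let ?wt = "\<lambda>x t. exp (- r * t) * (ut x t - r * u x t)"
  let ?wx = "\<lambda>x t. exp (- r * t) * ux x t"
  let ?wxx = "\<lambda>x t. exp (- r * t) * uxx x t"
  have gen: "?wt x t + (r - \<sigma>\<^sup>2 / 2) * ?wx x t + \<sigma>\<^sup>2 / 2 * ?wxx x t
    = - exp (- r * t) * (l * exp (- (u x t - put_payoff K (exp x)) / l))" if "t \<in> {0..<T}" for x t
  proof -
    have "?wt x t + (r - \<sigma>\<^sup>2 / 2) * ?wx x t + \<sigma>\<^sup>2 / 2 * ?wxx x t
      = exp (- r * t) * (ut x t + (\<sigma>\<^sup>2 / 2 * uxx x t + (r - \<sigma>\<^sup>2 / 2) * ux x t - r * u x t))"
      by (simp add: algebra_simps)
    also have "ut x t + (\<sigma>\<^sup>2 / 2 * uxx x t + (r - \<sigma>\<^sup>2 / 2) * ux x t - r * u x t)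
      = - (l * exp (- (u x t - put_payoff K (exp x)) / l))"
      using pde[OF that, of x] by (simp add: eq_neg_iff_add_eq_0)
    finally show ?thesis by simp
  qed
  show ?thesis
  proof (rule exI[of _ ?wt], rule exI[of _ ?wx], rule exI[of _ ?wxx], intro conjI allI ballI impI)
    show "C12 T (\<lambda>x t. exp (- r * t) * u x t) ?wt ?wx ?wxx"
      unfolding C12_def
    proof (intro conjI allI ballI)
      show "continuous_on (UNIV \<times> {0..<T}) (\<lambda>(x, t). ?wt x t)"
        "continuous_on (UNIV \<times> {0..<T}) (\<lambda>(x, t). ?wx x t)"
        "continuous_on (UNIV \<times> {0..<T}) (\<lambda>(x, t). ?wxx x t)"
        using C u_cont' unfolding split_beta by (auto intro!: continuous_intros)
      fix x t assume t: "t \<in> {0..<T}"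
      show "((\<lambda>s. exp (- r * s) * u x s) has_real_derivative ?wt x t) (at t within {0..T})"
        by (rule derivative_eq_intros D(1)[OF t] refl | simp add: algebra_simps)+
      show "((\<lambda>y. exp (- r * t) * u y t) has_real_derivative ?wx x t) (at x)"
        by (intro DERIV_cmult D t)
      show "((\<lambda>y. ?wx y t) has_real_derivative ?wxx x t) (at x)"
        by (intro DERIV_cmult D t)
    qed
    show "?wt x t + (r - \<sigma>\<^sup>2 / 2) * ?wx x t + \<sigma>\<^sup>2 / 2 * ?wxx x t \<le> 0" if "t \<in> {0..<T}" for x t
      unfolding gen[OF that] using l by simp
    show "- exp (- r * t) * l \<le> ?wt x t + (r - \<sigma>\<^sup>2 / 2) * ?wx x t + \<sigma>\<^sup>2 / 2 * ?wxx x t"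
      if "t \<in> {0..<T}" "put_payoff K (exp x) \<le> u x t" for x t
    proof -
      have "exp (- (u x t - put_payoff K (exp x)) / l) \<le> 1"
        using that l by (simp add: divide_nonpos_pos)
      then have "l * exp (- (u x t - put_payoff K (exp x)) / l) \<le> l"
        using l by (simp add: mult_left_le)
      then have "exp (- r * t) * (l * exp (- (u x t - put_payoff K (exp x)) / l)) \<le> exp (- r * t) * l"
        by (intro mult_left_mono) auto
      then show ?thesis unfolding gen[OF that(1)] by simp
    qed
  qed
qed

context brownian_motion
begin

lemma exercise_integrand_measurable:
  fixes X :: "real \<Rightarrow> 'a \<Rightarrow> real"
  assumes aT: "a \<le> T" and X: "\<And>t. t \<in> {a..T} \<Longrightarrow> X t \<in> borel_measurable M"
    and cont: "\<And>\<omega>. \<omega> \<in> space M \<Longrightarrow> continuous_on {a..T} (\<lambda>t. X t \<omega>)"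
    and \<tau>: "stopping_time F \<tau>" "\<And>\<omega>. \<omega> \<in> space M \<Longrightarrow> \<tau> \<omega> \<in> {a..T}"
  shows "(\<lambda>\<omega>. exp (- r * (\<tau> \<omega> - a)) * put_payoff K (X (\<tau> \<omega>) \<omega>)) \<in> borel_measurable M"
proof -
  note [measurable] = process_at_time_measurable[OF aT X cont stopping_time_measurable[OF \<tau>(1)] \<tau>(2)]
    stopping_time_measurable[OF \<tau>(1)]
  show ?thesis unfolding put_payoff_def by measurable
qed

lemma exercise_value_cong:
  fixes X X' :: "real \<Rightarrow> 'a \<Rightarrow> real"
  assumes aT: "a \<le> T"
    and X: "\<And>t. t \<in> {a..T} \<Longrightarrow> X t \<in> borel_measurable M" "\<And>\<omega>. \<omega> \<in> space M \<Longrightarrow> continuous_on {a..T} (\<lambda>t. X t \<omega>)"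
    and X': "\<And>t. t \<in> {a..T} \<Longrightarrow> X' t \<in> borel_measurable M" "\<And>\<omega>. \<omega> \<in> space M \<Longrightarrow> continuous_on {a..T} (\<lambda>t. X' t \<omega>)"
    and eq: "AE \<omega> in M. \<forall>t\<in>{a..T}. X t \<omega> = X' t \<omega>"
    and \<tau>: "stopping_time F \<tau>" "\<And>\<omega>. \<omega> \<in> space M \<Longrightarrow> \<tau> \<omega> \<in> {a..T}"
    and \<tau>': "stopping_time F \<tau>'" "\<And>\<omega>. \<omega> \<in> space M \<Longrightarrow> \<tau>' \<omega> \<in> {a..T}"
    and eq\<tau>: "AE \<omega> in M. \<tau> \<omega> = \<tau>' \<omega>"
  shows "exercise_value M r K a X \<tau> = exercise_value M r K a X' \<tau>'"
  unfolding exercise_value_def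
proof (rule integral_cong_AE)
  show "AE \<omega> in M. exp (- r * (\<tau> \<omega> - a)) * put_payoff K (X (\<tau> \<omega>) \<omega>) = exp (- r * (\<tau>' \<omega> - a)) * put_payoff K (X' (\<tau>' \<omega>) \<omega>)"
    using eq eq\<tau> AE_space
  proof eventually_elim
    case (elim \<omega>)
    then show ?case using \<tau>'(2)[of \<omega>] by auto
  qed
  show "(\<lambda>\<omega>. exp (- r * (\<tau> \<omega> - a)) * put_payoff K (X (\<tau> \<omega>) \<omega>)) \<in> borel_measurable M"
    using aT X \<tau> by (rule exercise_integrand_measurable)
  show "(\<lambda>\<omega>. exp (- r * (\<tau>' \<omega> - a)) * put_payoff K (X' (\<tau>' \<omega>) \<omega>)) \<in> borel_measurable M"
    using aT X' \<tau>' by (rule exercise_integrand_measurable)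
qed

lemma exercise_integrand_gbm_integrable:
  assumes a: "0 \<le> a" "a \<le> T" and \<tau>: "stopping_time F \<tau>" "\<And>\<omega>. \<omega> \<in> space M \<Longrightarrow> \<tau> \<omega> \<in> {a..T}"
    and r: "0 < r" and K: "0 < K"
  shows "integrable M (\<lambda>\<omega>. exp (- r * (\<tau> \<omega> - a)) * put_payoff K (exp (log_gbm r' \<sigma> a y (\<tau> \<omega>) \<omega>)))"
proof (rule integrable_const_bound[where B = K])
  show "(\<lambda>\<omega>. exp (- r * (\<tau> \<omega> - a)) * put_payoff K (exp (log_gbm r' \<sigma> a y (\<tau> \<omega>) \<omega>))) \<in> borel_measurable M"
  proof (rule exercise_integrand_measurable[OF a(2) _ _ \<tau>, where X = "\<lambda>s \<omega>. exp (log_gbm r' \<sigma> a y s \<omega>)"])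
    fix t assume "t \<in> {a..T}"
    then have [measurable]: "log_gbm r' \<sigma> a y t \<in> borel_measurable M"
      using a by (intro measurable_F_M[OF log_gbm_measurable]) auto
    show "(\<lambda>\<omega>. exp (log_gbm r' \<sigma> a y t \<omega>)) \<in> borel_measurable M" by measurable
  next
    fix \<omega> assume "\<omega> \<in> space M"
    then show "continuous_on {a..T} (\<lambda>t. exp (log_gbm r' \<sigma> a y t \<omega>))"
      by (intro continuous_on_exp log_gbm_continuous a)
  qed
  show "AE \<omega> in M. norm (exp (- r * (\<tau> \<omega> - a)) * put_payoff K (exp (log_gbm r' \<sigma> a y (\<tau> \<omega>) \<omega>))) \<le> K"
  proof (rule AE_I2)
    fix \<omega> assume "\<omega> \<in> space M"
    then have "exp (- r * (\<tau> \<omega> - a)) \<le> 1" using \<tau>(2)[of \<omega>] r by auto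
    then have "exp (- r * (\<tau> \<omega> - a)) * put_payoff K (exp (log_gbm r' \<sigma> a y (\<tau> \<omega>) \<omega>)) \<le> 1 * K"
      using put_payoff_bounds K by (intro mult_mono) auto
    then show "norm (exp (- r * (\<tau> \<omega> - a)) * put_payoff K (exp (log_gbm r' \<sigma> a y (\<tau> \<omega>) \<omega>))) \<le> K"
      using put_payoff_bounds(1)[OF K, of "exp (log_gbm r' \<sigma> a y (\<tau> \<omega>) \<omega>)"] by (simp add: abs_mult)
  qed
qed

text \<open>No stopping rule earns more than the penalized solution, up to its distance from the obstacle.\<close>

lemma exercise_value_le_penalized:
  assumes u: "penalized_solution r \<sigma> K T l u" and l: "0 < l" and r: "0 < r" and K: "0 < K" and T: "0 < T"
    and c: "0 \<le> c" "r * K \<le> l * exp c"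
    and a: "a \<in> {0..T}"
    and \<tau>: "stopping_time F \<tau>" "\<And>\<omega>. \<omega> \<in> space M \<Longrightarrow> \<tau> \<omega> \<in> {a..T}"
  shows "exercise_value M r K a (gbm W r \<sigma> a (exp y)) \<tau> \<le> u y a + l * c"
proof -
  have a0: "0 \<le> a" "a \<le> T" using a by auto
  let ?X = "log_gbm r \<sigma> a y"
  have u_cont: "continuous_on (UNIV \<times> {0..T}) (\<lambda>(x, t). u x t)"
    and u_bd: "\<And>x t. t \<in> {0..T} \<Longrightarrow> 0 \<le> u x t \<and> u x t \<le> K + l * (T - t)"
    using u unfolding penalized_solution_def by blast+
  obtain wt wx wxx where w1: "C12 T (\<lambda>x t. exp (- r * t) * u x t) wt wx wxx"
    and w2: "\<forall>x. \<forall>t\<in>{0..<T}. wt x t + (r - \<sigma>\<^sup>2 / 2) * wx x t + \<sigma>\<^sup>2 / 2 * wxx x t \<le> 0"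
    using penalized_solution_discounted[OF u l r K] by (elim exE conjE) (rule that)
  have w: "C12 T (\<lambda>x t. exp (- r * t) * u x t) wt wx wxx"
    "\<And>x t. t \<in> {0..<T} \<Longrightarrow> wt x t + (r - \<sigma>\<^sup>2 / 2) * wx x t + \<sigma>\<^sup>2 / 2 * wxx x t \<le> 0"
    using w1 w2 by auto
  have ub: "\<bar>- (exp (- r * t) * u x t)\<bar> \<le> K + l * T" if "t \<in> {0..T}" for x t
  proof -
    have "exp (- r * t) * u x t \<le> 1 * (K + l * T)"
      using that u_bd[OF that, of x] r l by (intro mult_mono) (auto intro: order_trans)
    then show ?thesis using u_bd[OF that, of x] by (simp add: abs_mult)
  qed
  have "- (exp (- r * a) * u y a) \<le> expectation (\<lambda>\<omega>. - (exp (- r * \<tau> \<omega>) * u (?X (\<tau> \<omega>) \<omega>) (\<tau> \<omega>))) + 0 * (T - a)"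
  proof (rule dynkin_lower[OF a0 C12_uminus[OF w(1)] _ ub \<tau>])
    show "continuous_on (UNIV \<times> {0..T}) (\<lambda>(x, t). - (exp (- r * t) * u x t))"
      using u_cont unfolding split_beta by (auto intro!: continuous_intros)
    show "- 0 \<le> - wt (?X s \<omega>) s + (r - \<sigma>\<^sup>2 / 2) * - wx (?X s \<omega>) s + \<sigma>\<^sup>2 / 2 * - wxx (?X s \<omega>) s"
      if "s \<in> {a..<T}" for \<omega> s using w(2)[of s "?X s \<omega>"] that a0 by auto
  qed auto
  then have "expectation (\<lambda>\<omega>. exp (- r * \<tau> \<omega>) * u (?X (\<tau> \<omega>) \<omega>) (\<tau> \<omega>)) \<le> exp (- r * a) * u y a" by simp
  then have "exp (r * a) * expectation (\<lambda>\<omega>. exp (- r * \<tau> \<omega>) * u (?X (\<tau> \<omega>) \<omega>) (\<tau> \<omega>)) \<le> exp (r * a) * (exp (- r * a) * u y a)"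
    by (intro mult_left_mono) auto
  then have sup: "expectation (\<lambda>\<omega>. exp (- r * (\<tau> \<omega> - a)) * u (?X (\<tau> \<omega>) \<omega>) (\<tau> \<omega>)) \<le> u y a"
    unfolding integral_mult_right_zero[symmetric] mult.assoc[symmetric] mult_exp_exp by (simp add: algebra_simps)
  have X_cont: "continuous_on {a..T} (\<lambda>s. ?X s \<omega>)" if "\<omega> \<in> space M" for \<omega>
    using that a0(1) by (rule log_gbm_continuous)
  have X_M: "?X s \<in> borel_measurable M" if "a \<le> s" for s
    using measurable_F_M[OF log_gbm_measurable[OF a0(1) that order_refl]] .
  have v_cont1: "continuous_on UNIV (\<lambda>x. u x t)" if "t \<in> {0..T}" for t
    using that by (intro continuous_on_compose2[OF u_cont, of _ "\<lambda>x. (x, t)", simplified] continuous_intros) auto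
  have m1: "(\<lambda>\<omega>. u (?X (\<tau> \<omega>) \<omega>) (\<tau> \<omega>)) \<in> borel_measurable M"
  proof (rule process_at_time_measurable[OF a0(2) _ _ stopping_time_measurable[OF \<tau>(1)] \<tau>(2), where X = "\<lambda>s \<omega>. u (?X s \<omega>) s"])
    show "(\<lambda>\<omega>. u (?X t \<omega>) t) \<in> borel_measurable M" if "t \<in> {a..T}" for t
      using that a0 by (intro measurable_compose[OF X_M borel_measurable_continuous_onI[OF v_cont1]]) auto
    show "continuous_on {a..T} (\<lambda>t. u (?X t \<omega>) t)" if "\<omega> \<in> space M" for \<omega>
      using a0 by (intro continuous_on_compose2[OF u_cont, of _ "\<lambda>s. (?X s \<omega>, s)", simplified] continuous_intros X_cont that) auto
  qed
  note [measurable] = m1 stopping_time_measurable[OF \<tau>(1)]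
  have disc: "exp (- r * (\<tau> \<omega> - a)) \<le> 1" if "\<omega> \<in> space M" for \<omega> using \<tau>(2)[OF that] r by auto
  have i: "integrable M (\<lambda>\<omega>. exp (- r * (\<tau> \<omega> - a)) * u (?X (\<tau> \<omega>) \<omega>) (\<tau> \<omega>))"
  proof (rule integrable_const_bound[where B = "K + l * T"])
    show "AE \<omega> in M. norm (exp (- r * (\<tau> \<omega> - a)) * u (?X (\<tau> \<omega>) \<omega>) (\<tau> \<omega>)) \<le> K + l * T"
    proof (rule AE_I2)
      fix \<omega> assume \<omega>: "\<omega> \<in> space M"
      have t: "\<tau> \<omega> \<in> {0..T}" using \<tau>(2)[OF \<omega>] a0 by auto
      then have "l * (T - \<tau> \<omega>) \<le> l * T" using l by (intro mult_left_mono) auto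
      then have "exp (- r * (\<tau> \<omega> - a)) * u (?X (\<tau> \<omega>) \<omega>) (\<tau> \<omega>) \<le> 1 * (K + l * T)"
        using u_bd[OF t, of "?X (\<tau> \<omega>) \<omega>"] disc[OF \<omega>] by (intro mult_mono) auto
      then show "norm (exp (- r * (\<tau> \<omega> - a)) * u (?X (\<tau> \<omega>) \<omega>) (\<tau> \<omega>)) \<le> K + l * T"
        using u_bd[OF t, of "?X (\<tau> \<omega>) \<omega>"] by (simp add: abs_mult)
    qed
  qed measurable
  have "exercise_value M r K a (gbm W r \<sigma> a (exp y)) \<tau>
    \<le> expectation (\<lambda>\<omega>. exp (- r * (\<tau> \<omega> - a)) * u (?X (\<tau> \<omega>) \<omega>) (\<tau> \<omega>) + l * c)"
    unfolding exercise_value_def gbm_exp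
  proof (rule integral_mono)
    show "integrable M (\<lambda>\<omega>. exp (- r * (\<tau> \<omega> - a)) * put_payoff K (exp (?X (\<tau> \<omega>) \<omega>)))"
      using a0 \<tau> r K by (rule exercise_integrand_gbm_integrable)
    show "integrable M (\<lambda>\<omega>. exp (- r * (\<tau> \<omega> - a)) * u (?X (\<tau> \<omega>) \<omega>) (\<tau> \<omega>) + l * c)" using i by simp
    fix \<omega> assume \<omega>: "\<omega> \<in> space M"
    have t: "\<tau> \<omega> \<in> {0..T}" using \<tau>(2)[OF \<omega>] a0 by auto
    have "put_payoff K (exp (?X (\<tau> \<omega>) \<omega>)) \<le> u (?X (\<tau> \<omega>) \<omega>) (\<tau> \<omega>) + l * c"
      using penalized_solution_ge_obstacle[OF K r T l u c t, of "?X (\<tau> \<omega>) \<omega>"] by simp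
    then have "exp (- r * (\<tau> \<omega> - a)) * put_payoff K (exp (?X (\<tau> \<omega>) \<omega>))
      \<le> exp (- r * (\<tau> \<omega> - a)) * (u (?X (\<tau> \<omega>) \<omega>) (\<tau> \<omega>) + l * c)"
      by (intro mult_left_mono) auto
    also have "\<dots> \<le> exp (- r * (\<tau> \<omega> - a)) * u (?X (\<tau> \<omega>) \<omega>) (\<tau> \<omega>) + l * c"
      unfolding distrib_left using mult_right_mono[OF disc[OF \<omega>], of "l * c"] l c by simp
    finally show "exp (- r * (\<tau> \<omega> - a)) * put_payoff K (exp (?X (\<tau> \<omega>) \<omega>))
      \<le> exp (- r * (\<tau> \<omega> - a)) * u (?X (\<tau> \<omega>) \<omega>) (\<tau> \<omega>) + l * c" .
  qed
  also have "\<dots> = expectation (\<lambda>\<omega>. exp (- r * (\<tau> \<omega> - a)) * u (?X (\<tau> \<omega>) \<omega>) (\<tau> \<omega>)) + l * c"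
    using i by (simp add: prob_space)
  finally show ?thesis using sup by simp
qed

text \<open>Stopping when the penalized solution meets the obstacle earns the penalized value up to
  \<open>l * T\<close>.\<close>

lemma penalized_le_exercise_value:
  assumes u: "penalized_solution r \<sigma> K T l u" and l: "0 < l" and r: "0 < r" and K: "0 < K" and T: "0 < T"
    and a: "a \<in> {0..T}"
    and \<tau>: "stopping_time F \<tau>" "\<And>\<omega>. \<omega> \<in> space M \<Longrightarrow> \<tau> \<omega> \<in> {a..T}"
    and before: "\<And>\<omega> s. \<omega> \<in> space M \<Longrightarrow> s \<in> {a..<T} \<Longrightarrow> s < \<tau> \<omega> \<Longrightarrow>
      put_payoff K (gbm W r \<sigma> a (exp y) s \<omega>) \<le> u (log_gbm r \<sigma> a y s \<omega>) s"
    and at: "\<And>\<omega>. \<omega> \<in> space M \<Longrightarrow> u (log_gbm r \<sigma> a y (\<tau> \<omega>) \<omega>) (\<tau> \<omega>) \<le> put_payoff K (gbm W r \<sigma> a (exp y) (\<tau> \<omega>) \<omega>)"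
  shows "u y a \<le> exercise_value M r K a (gbm W r \<sigma> a (exp y)) \<tau> + l * T"
proof -
  have a0: "0 \<le> a" "a \<le> T" using a by auto
  let ?X = "log_gbm r \<sigma> a y"
  have u_cont: "continuous_on (UNIV \<times> {0..T}) (\<lambda>(x, t). u x t)"
    and u_bd: "\<And>x t. t \<in> {0..T} \<Longrightarrow> 0 \<le> u x t \<and> u x t \<le> K + l * (T - t)"
    using u unfolding penalized_solution_def by blast+
  obtain wt wx wxx where w1: "C12 T (\<lambda>x t. exp (- r * t) * u x t) wt wx wxx"
    and w2: "\<forall>x. \<forall>t\<in>{0..<T}. put_payoff K (exp x) \<le> u x t \<longrightarrow>
      - exp (- r * t) * l \<le> wt x t + (r - \<sigma>\<^sup>2 / 2) * wx x t + \<sigma>\<^sup>2 / 2 * wxx x t"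
    using penalized_solution_discounted[OF u l r K] by (elim exE conjE) (rule that)
  have w: "C12 T (\<lambda>x t. exp (- r * t) * u x t) wt wx wxx"
    "\<And>x t. t \<in> {0..<T} \<Longrightarrow> put_payoff K (exp x) \<le> u x t \<Longrightarrow>
      - exp (- r * t) * l \<le> wt x t + (r - \<sigma>\<^sup>2 / 2) * wx x t + \<sigma>\<^sup>2 / 2 * wxx x t"
    using w1 w2 by auto
  have ub: "\<bar>exp (- r * t) * u x t\<bar> \<le> K + l * T" if "t \<in> {0..T}" for x t
  proof -
    have "l * (T - t) \<le> l * T" using l that by (intro mult_left_mono) auto
    then have "exp (- r * t) * u x t \<le> 1 * (K + l * T)"
      using that u_bd[OF that, of x] r by (intro mult_mono) auto
    then show ?thesis using u_bd[OF that, of x] by (simp add: abs_mult)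
  qed
  have "exp (- r * a) * u y a \<le> expectation (\<lambda>\<omega>. exp (- r * \<tau> \<omega>) * u (?X (\<tau> \<omega>) \<omega>) (\<tau> \<omega>)) + (exp (- r * a) * l) * (T - a)"
  proof (rule dynkin_lower[OF a0 w(1) _ ub \<tau>])
    show "continuous_on (UNIV \<times> {0..T}) (\<lambda>(x, t). exp (- r * t) * u x t)"
      using u_cont unfolding split_beta by (auto intro!: continuous_intros)
    show "- (exp (- r * a) * l) \<le> wt (?X s \<omega>) s + (r - \<sigma>\<^sup>2 / 2) * wx (?X s \<omega>) s + \<sigma>\<^sup>2 / 2 * wxx (?X s \<omega>) s"
      if "\<omega> \<in> space M" "s \<in> {a..<T}" "s < \<tau> \<omega>" for \<omega> s
    proof -
      have "- exp (- r * s) * l \<le> wt (?X s \<omega>) s + (r - \<sigma>\<^sup>2 / 2) * wx (?X s \<omega>) s + \<sigma>\<^sup>2 / 2 * wxx (?X s \<omega>) s"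
        using before[OF that] that a0 by (intro w(2)) (auto simp: gbm_exp)
      moreover have "exp (- r * s) * l \<le> exp (- r * a) * l" using that r l by (intro mult_right_mono) auto
      ultimately show ?thesis by simp
    qed
  qed (use l in auto)
  then have "exp (r * a) * (exp (- r * a) * u y a)
    \<le> exp (r * a) * (expectation (\<lambda>\<omega>. exp (- r * \<tau> \<omega>) * u (?X (\<tau> \<omega>) \<omega>) (\<tau> \<omega>)) + (exp (- r * a) * l) * (T - a))"
    by (intro mult_left_mono) auto
  then have main: "u y a \<le> expectation (\<lambda>\<omega>. exp (- r * (\<tau> \<omega> - a)) * u (?X (\<tau> \<omega>) \<omega>) (\<tau> \<omega>)) + l * (T - a)"
    unfolding distrib_left integral_mult_right_zero[symmetric] mult.assoc[symmetric] mult_exp_exp by (simp add: algebra_simps)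
  have X_cont: "continuous_on {a..T} (\<lambda>s. ?X s \<omega>)" if "\<omega> \<in> space M" for \<omega>
    using that a0(1) by (rule log_gbm_continuous)
  have X_M: "?X s \<in> borel_measurable M" if "a \<le> s" for s
    using measurable_F_M[OF log_gbm_measurable[OF a0(1) that order_refl]] .
  have disc: "exp (- r * (\<tau> \<omega> - a)) \<le> 1" if "\<omega> \<in> space M" for \<omega> using \<tau>(2)[OF that] r by auto
  have "expectation (\<lambda>\<omega>. exp (- r * (\<tau> \<omega> - a)) * u (?X (\<tau> \<omega>) \<omega>) (\<tau> \<omega>))
    \<le> exercise_value M r K a (gbm W r \<sigma> a (exp y)) \<tau>"
    unfolding exercise_value_def gbm_exp
  proof (rule integral_mono')
    show "integrable M (\<lambda>\<omega>. exp (- r * (\<tau> \<omega> - a)) * put_payoff K (exp (?X (\<tau> \<omega>) \<omega>)))"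
      using a0 \<tau> r K by (rule exercise_integrand_gbm_integrable)
    fix \<omega> assume \<omega>: "\<omega> \<in> space M"
    show "exp (- r * (\<tau> \<omega> - a)) * u (?X (\<tau> \<omega>) \<omega>) (\<tau> \<omega>) \<le> exp (- r * (\<tau> \<omega> - a)) * put_payoff K (exp (?X (\<tau> \<omega>) \<omega>))"
      using at[OF \<omega>] by (intro mult_left_mono) (auto simp: gbm_exp)
    show "0 \<le> exp (- r * (\<tau> \<omega> - a)) * put_payoff K (exp (?X (\<tau> \<omega>) \<omega>))"
      using put_payoff_bounds(1)[OF K] by simp
  qed
  moreover have "l * (T - a) \<le> l * T" using l a0 by (intro mult_left_mono) auto
  ultimately show ?thesis using main by linarith
qed

end

section \<open>Continuity of the American put price\<close>

text \<open>The constant \<open>c\<close> for which \<open>h - l * c\<close> is a subsolution, with \<open>C = r * K\<close>.\<close>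

lemma penalty_constant:
  fixes C l :: real
  assumes "0 < C" "0 < l"
  shows "0 \<le> max 0 (ln (C / l))" "C \<le> l * exp (max 0 (ln (C / l)))"
proof -
  have "C / l = exp (ln (C / l))" using assms by simp
  also have "\<dots> \<le> exp (max 0 (ln (C / l)))" by (simp only: exp_le_cancel_iff max.cobounded2)
  finally show "C \<le> l * exp (max 0 (ln (C / l)))" using assms by (simp only: pos_divide_le_eq mult.commute)
qed simp

lemma exercise_time_eq_hitting_time:
  "exercise_time K T X v = hitting_time 0 T (\<lambda>t \<omega>. v (ln (X t \<omega>)) t - put_payoff K (X t \<omega>))"
  by (simp add: fun_eq_iff exercise_time_def hitting_time_def)

context brownian_motion
begin

lemma obstacle_process:
  fixes X :: "real \<Rightarrow> 'a \<Rightarrow> real"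
  assumes a: "0 \<le> a"
    and v: "continuous_on (UNIV \<times> {0..T}) (\<lambda>(x, t). v x t)"
    and X_F: "\<And>t. t \<in> {a..T} \<Longrightarrow> X t \<in> borel_measurable (F t)"
    and X_cont: "\<And>\<omega>. \<omega> \<in> space M \<Longrightarrow> continuous_on {a..T} (\<lambda>t. X t \<omega>)"
    and X_pos: "\<And>\<omega> t. \<omega> \<in> space M \<Longrightarrow> t \<in> {a..T} \<Longrightarrow> 0 < X t \<omega>"
  shows "\<omega> \<in> space M \<Longrightarrow> continuous_on {a..T} (\<lambda>t. v (ln (X t \<omega>)) t - put_payoff K (X t \<omega>))"
    and "t \<in> {a..T} \<Longrightarrow> (\<lambda>\<omega>. v (ln (X t \<omega>)) t - put_payoff K (X t \<omega>)) \<in> borel_measurable (F t)"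
proof -
  show "continuous_on {a..T} (\<lambda>t. v (ln (X t \<omega>)) t - put_payoff K (X t \<omega>))" if \<omega>: "\<omega> \<in> space M"
  proof (intro continuous_on_diff put_payoff_continuous X_cont \<omega>)
    have "continuous_on {a..T} (\<lambda>t. ln (X t \<omega>))"
      using X_pos[OF \<omega>] by (intro continuous_on_ln X_cont \<omega>) force
    then show "continuous_on {a..T} (\<lambda>t. v (ln (X t \<omega>)) t)"
      using a by (intro continuous_on_compose2[OF v, of _ "\<lambda>t. (ln (X t \<omega>), t)", simplified] continuous_on_Pair continuous_on_id) auto
  qed
  show "(\<lambda>\<omega>. v (ln (X t \<omega>)) t - put_payoff K (X t \<omega>)) \<in> borel_measurable (F t)" if t: "t \<in> {a..T}"
  proof -
    have "continuous_on UNIV (\<lambda>x. v x t)"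
      using t a by (intro continuous_on_compose2[OF v, of _ "\<lambda>x. (x, t)", simplified] continuous_intros) auto
    then have [measurable]: "(\<lambda>x. v x t) \<in> borel_measurable borel" by (rule borel_measurable_continuous_onI)
    have [measurable]: "X t \<in> borel_measurable (F t)" using t by (rule X_F)
    show ?thesis unfolding put_payoff_def by measurable
  qed
qed

lemma exercise_time_gbm:
  fixes r \<sigma> y :: real
  assumes "0 \<le> T" and v: "continuous_on (UNIV \<times> {0..T}) (\<lambda>(x, t). v x t)"
  defines "Y \<equiv> gbm W r \<sigma> 0 (exp y)"
  shows "stopping_time F (exercise_time K T Y v)"
    and "\<omega> \<in> space M \<Longrightarrow> exercise_time K T Y v \<omega> \<in> {0..T}"
proof -
  let ?w = "\<lambda>t \<omega>. v (ln (Y t \<omega>)) t - put_payoff K (Y t \<omega>)"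
  have F: "\<And>t. t \<in> {0..T} \<Longrightarrow> Y t \<in> borel_measurable (F t)" unfolding Y_def by (intro gbm_measurable) auto
  have c: "\<And>\<omega>. \<omega> \<in> space M \<Longrightarrow> continuous_on {0..T} (\<lambda>t. Y t \<omega>)" unfolding Y_def by (intro gbm_continuous) auto
  have p: "\<And>\<omega> t. 0 < Y t \<omega>" unfolding Y_def by (intro gbm_pos) auto
  have wc: "continuous_on {0..T} (\<lambda>t. ?w t \<omega>)" if "\<omega> \<in> space M" for \<omega>
    by (rule obstacle_process(1)[OF order_refl v F c p that])
  have wF: "?w t \<in> borel_measurable (F t)" if "t \<in> {0..T}" for t
    by (rule obstacle_process(2)[OF order_refl v F c p that])
  show "stopping_time F (exercise_time K T Y v)"
    unfolding exercise_time_eq_hitting_time using assms(1) wc wF by (rule hitting_time_stopping_time)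
  show "exercise_time K T Y v \<omega> \<in> {0..T}" if "\<omega> \<in> space M"
    unfolding exercise_time_eq_hitting_time using assms(1) wc[OF that] by (rule hitting_time_properties(1))
qed

lemma exercise_value_stock_price:
  assumes a: "0 \<le> a" "a \<le> T" and \<sigma>: "\<sigma> \<noteq> 0" and X: "stock_price M F W r \<sigma> T a (exp y) X"
    and \<tau>: "stopping_time F \<tau>" "\<And>\<omega>. \<omega> \<in> space M \<Longrightarrow> \<tau> \<omega> \<in> {a..T}"
  shows "exercise_value M r K a X \<tau> = exercise_value M r K a (gbm W r \<sigma> a (exp y)) \<tau>"
proof (rule exercise_value_cong[OF a(2) _ _ _ _ _ \<tau> \<tau>])
  let ?Y = "gbm W r \<sigma> a (exp y)"
  have Y: "stock_price M F W r \<sigma> T a (exp y) ?Y" using a(1) by (rule gbm_stock_price) simp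
  show "X t \<in> borel_measurable M" "?Y t \<in> borel_measurable M" if "t \<in> {a..T}" for t
    using measurable_F_M[OF stock_price_adapted[OF X \<sigma> that]] measurable_F_M[OF stock_price_adapted[OF Y \<sigma> that]] .
  show "continuous_on {a..T} (\<lambda>t. X t \<omega>)" "continuous_on {a..T} (\<lambda>t. ?Y t \<omega>)" if "\<omega> \<in> space M" for \<omega>
    using stock_price_continuous[OF X that] stock_price_continuous[OF Y that] .
  show "AE \<omega> in M. \<forall>t\<in>{a..T}. X t \<omega> = ?Y t \<omega>" by (rule stock_price_unique[OF a(1) \<sigma> X Y])
qed auto

text \<open>The exercise rule of the penalized solution, started at any time \<open>a\<close>, is optimal up to \<open>l * T\<close>.\<close>

lemma penalized_hitting_value:
  fixes r \<sigma> y a T K :: real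
  assumes u: "penalized_solution r \<sigma> K T l u" and l: "0 < l" and r: "0 < r" and K: "0 < K" and T: "0 < T"
    and a: "a \<in> {0..T}"
  defines "Y \<equiv> gbm W r \<sigma> a (exp y)"
  defines "\<tau> \<equiv> hitting_time a T (\<lambda>t \<omega>. u (ln (Y t \<omega>)) t - put_payoff K (Y t \<omega>))"
  shows "stopping_time F \<tau>" "\<And>\<omega>. \<omega> \<in> space M \<Longrightarrow> \<tau> \<omega> \<in> {a..T}"
    "u y a \<le> exercise_value M r K a Y \<tau> + l * T"
proof -
  have a0: "0 \<le> a" "a \<le> T" using a by auto
  have u_cont: "continuous_on (UNIV \<times> {0..T}) (\<lambda>(x, t). u x t)"
    and u_T: "\<And>x. u x T = put_payoff K (exp x)"
    using u unfolding penalized_solution_def by simp_all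
  let ?w = "\<lambda>t \<omega>. u (ln (Y t \<omega>)) t - put_payoff K (Y t \<omega>)"
  have F: "\<And>t. t \<in> {a..T} \<Longrightarrow> Y t \<in> borel_measurable (F t)" unfolding Y_def using a0 by (intro gbm_measurable) auto
  have c: "\<And>\<omega>. \<omega> \<in> space M \<Longrightarrow> continuous_on {a..T} (\<lambda>t. Y t \<omega>)" unfolding Y_def using a0 by (intro gbm_continuous) auto
  have p: "\<And>\<omega> t. 0 < Y t \<omega>" unfolding Y_def by (intro gbm_pos) auto
  have lnY: "ln (Y t \<omega>) = log_gbm r \<sigma> a y t \<omega>" for t \<omega> by (simp add: Y_def gbm_exp)
  have wc: "continuous_on {a..T} (\<lambda>t. ?w t \<omega>)" if "\<omega> \<in> space M" for \<omega>
    by (rule obstacle_process(1)[OF a0(1) u_cont F c p that])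
  have wF: "?w t \<in> borel_measurable (F t)" if "t \<in> {a..T}" for t
    by (rule obstacle_process(2)[OF a0(1) u_cont F c p that])
  note hit = hitting_time_properties[where w = ?w, OF a0(2), folded \<tau>_def]
  show st: "stopping_time F \<tau>"
    unfolding \<tau>_def using a0(2) wc wF by (rule hitting_time_stopping_time)
  show \<tau>_in: "\<tau> \<omega> \<in> {a..T}" if "\<omega> \<in> space M" for \<omega> using hit(1)[OF wc[OF that]] .
  show "u y a \<le> exercise_value M r K a Y \<tau> + l * T"
    unfolding Y_def
  proof (rule penalized_le_exercise_value[OF u l r K T a st \<tau>_in])
    fix \<omega> assume \<omega>: "\<omega> \<in> space M"
    show "put_payoff K (gbm W r \<sigma> a (exp y) s \<omega>) \<le> u (log_gbm r \<sigma> a y s \<omega>) s" if "s \<in> {a..<T}" "s < \<tau> \<omega>" for s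
      using hit(2)[OF wc[OF \<omega>], of s] that by (simp add: lnY) (simp add: Y_def)
    show "u (log_gbm r \<sigma> a y (\<tau> \<omega>) \<omega>) (\<tau> \<omega>) \<le> put_payoff K (gbm W r \<sigma> a (exp y) (\<tau> \<omega>) \<omega>)"
    proof (cases "\<tau> \<omega> = T")
      case True
      then show ?thesis using u_T by (simp add: gbm_exp)
    next
      case False
      then show ?thesis using hit(3)[OF wc[OF \<omega>]] by (simp add: lnY) (simp add: Y_def)
    qed
  qed
qed

text \<open>Both sides use that all solutions of the stochastic differential equation with the same initial value give the same
  exercise values; the lower bound also needs that a solution exists.\<close>

lemma u_star_penalized_bounds:
  assumes u: "penalized_solution r \<sigma> K T l u" and l: "0 < l" and r: "0 < r" and K: "0 < K" and T: "0 < T"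
    and \<sigma>: "\<sigma> \<noteq> 0" and c: "0 \<le> c" "r * K \<le> l * exp c" and a: "a \<in> {0..T}"
  shows "u_star M F W r \<sigma> K T y a \<le> u y a + l * c" "u y a - l * T \<le> u_star M F W r \<sigma> K T y a"
proof -
  have a0: "0 \<le> a" "a \<le> T" using a by auto
  let ?Y = "gbm W r \<sigma> a (exp y)"
  let ?A = "{exercise_value M r K a X \<tau> | X \<tau>. stock_price M F W r \<sigma> T a (exp y) X \<and>
       stopping_time F \<tau> \<and> (\<forall>\<omega>\<in>space M. \<tau> \<omega> \<in> {a..T})}"
  have upper: "z \<le> u y a + l * c" if "z \<in> ?A" for z
  proof -
    obtain X \<tau> where z: "z = exercise_value M r K a X \<tau>" and X: "stock_price M F W r \<sigma> T a (exp y) X"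
      and \<tau>: "stopping_time F \<tau>" "\<And>\<omega>. \<omega> \<in> space M \<Longrightarrow> \<tau> \<omega> \<in> {a..T}" using \<open>z \<in> ?A\<close> by blast
    show ?thesis
      using exercise_value_le_penalized[OF u l r K T c a \<tau>, where y = y]
        exercise_value_stock_price[OF a0 \<sigma> X \<tau>, where K = K]
      by (simp only: z)
  qed
  define \<tau> where "\<tau> = hitting_time a T (\<lambda>t \<omega>. u (ln (?Y t \<omega>)) t - put_payoff K (?Y t \<omega>))"
  note h = penalized_hitting_value[OF u l r K T a, where y = y, folded \<tau>_def]
  have "stock_price M F W r \<sigma> T a (exp y) ?Y" using a0(1) by (rule gbm_stock_price) simp
  then have mem: "exercise_value M r K a ?Y \<tau> \<in> ?A" using h(1,2) by blast
  show "u_star M F W r \<sigma> K T y a \<le> u y a + l * c"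
    unfolding u_star_def american_put_def using mem upper by (intro cSup_least) auto
  have "exercise_value M r K a ?Y \<tau> \<le> u_star M F W r \<sigma> K T y a"
    unfolding u_star_def american_put_def using upper by (intro cSup_upper mem bdd_aboveI) auto
  then show "u y a - l * T \<le> u_star M F W r \<sigma> K T y a" using h(3) by linarith
qed

lemma u_star_continuous:
  assumes u: "\<And>l. 0 < l \<Longrightarrow> penalized_solution r \<sigma> K T l (u l)"
    and r: "0 < r" and K: "0 < K" and T: "0 < T" and \<sigma>: "\<sigma> \<noteq> 0"
  shows "continuous_on (UNIV \<times> {0..T}) (\<lambda>(x, t). u_star M F W r \<sigma> K T x t)"
proof -
  \<comment> \<open>Any null sequence would do; for this one the logarithm is explicit.\<close>
  define l where "l n = exp (- real n)" for n
  have l: "0 < l n" for n by (simp add: l_def)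
  define c where "c n = max 0 (ln (r * K / l n))" for n
  have c: "0 \<le> c n" "r * K \<le> l n * exp (c n)" for n
    unfolding c_def using r K l by (auto intro!: penalty_constant(2))
  have c_le: "c n \<le> \<bar>ln (r * K)\<bar> + real n" for n
    unfolding c_def l_def using r K by (simp add: ln_div ln_mult)
  have lim: "(\<lambda>n. l n * (\<bar>ln (r * K)\<bar> + real n) + l n * T) \<longlonglongrightarrow> 0"
    unfolding l_def by real_asymp
  have "uniform_limit (UNIV \<times> {0..T}) (\<lambda>n (x, t). u (l n) x t) (\<lambda>(x, t). u_star M F W r \<sigma> K T x t) sequentially"
    unfolding uniform_limit_iff
  proof (intro allI impI)
    fix e :: real assume "0 < e"
    with lim have "\<forall>\<^sub>F n in sequentially. l n * (\<bar>ln (r * K)\<bar> + real n) + l n * T < e" by (rule order_tendstoD)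
    then show "\<forall>\<^sub>F n in sequentially. \<forall>z\<in>UNIV \<times> {0..T}. dist (case z of (x, t) \<Rightarrow> u (l n) x t) (case z of (x, t) \<Rightarrow> u_star M F W r \<sigma> K T x t) < e"
    proof eventually_elim
      case (elim n)
      have "\<bar>u (l n) x t - u_star M F W r \<sigma> K T x t\<bar> < e" if t: "t \<in> {0..T}" for x t
      proof -
        have "l n * c n \<le> l n * (\<bar>ln (r * K)\<bar> + real n)" using l[of n] c_le[of n] by (intro mult_left_mono) auto
        moreover have "0 \<le> l n * c n" "0 \<le> l n * T" using l[of n] c(1)[of n] T by auto
        ultimately show ?thesis
          using u_star_penalized_bounds[OF u[OF l[of n]] l[of n] r K T \<sigma> c(1)[of n] c(2)[of n] t, where y = x] elim unfolding abs_less_iff by linarith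
      qed
      then show ?case by (auto simp: dist_real_def)
    qed
  qed
  then show ?thesis
    by (rule uniform_limit_theorem[rotated]) (use u[OF l] in \<open>auto simp: penalized_solution_def\<close>)
qed

text \<open>The two exercise times agree almost surely because the two paths do.\<close>

lemma exercise_value_exercise_time:
  fixes r \<sigma> y :: real
  assumes T: "0 \<le> T" and \<sigma>: "\<sigma> \<noteq> 0" and X: "stock_price M F W r \<sigma> T 0 (exp y) X"
    and v: "continuous_on (UNIV \<times> {0..T}) (\<lambda>(x, t). v x t)"
  defines "Y \<equiv> gbm W r \<sigma> 0 (exp y)"
  shows "exercise_value M r K 0 X (exercise_time K T X v) = exercise_value M r K 0 Y (exercise_time K T Y v)"
proof (rule exercise_value_cong[OF T])
  have Y: "stock_price M F W r \<sigma> T 0 (exp y) Y" unfolding Y_def by (rule gbm_stock_price) auto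
  show XM: "X t \<in> borel_measurable M" "Y t \<in> borel_measurable M" if "t \<in> {0..T}" for t
    using measurable_F_M[OF stock_price_adapted[OF X \<sigma> that]] measurable_F_M[OF stock_price_adapted[OF Y \<sigma> that]] .
  show Xc: "continuous_on {0..T} (\<lambda>t. X t \<omega>)" "continuous_on {0..T} (\<lambda>t. Y t \<omega>)" if "\<omega> \<in> space M" for \<omega>
    using stock_price_continuous[OF X that] stock_price_continuous[OF Y that] .
  show eq: "AE \<omega> in M. \<forall>t\<in>{0..T}. X t \<omega> = Y t \<omega>" by (rule stock_price_unique[OF order_refl \<sigma> X Y])
  let ?w = "\<lambda>t \<omega>. v (ln (X t \<omega>)) t - put_payoff K (X t \<omega>)"
  have Xp: "\<And>\<omega> t. \<omega> \<in> space M \<Longrightarrow> t \<in> {0..T} \<Longrightarrow> 0 < X t \<omega>" using X by (auto simp: stock_price_def)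
  have XF: "\<And>t. t \<in> {0..T} \<Longrightarrow> X t \<in> borel_measurable (F t)" by (rule stock_price_adapted[OF X \<sigma>])
  have wc: "continuous_on {0..T} (\<lambda>t. ?w t \<omega>)" if "\<omega> \<in> space M" for \<omega>
    by (rule obstacle_process(1)[OF order_refl v XF Xc(1) Xp that])
  have wF: "?w t \<in> borel_measurable (F t)" if "t \<in> {0..T}" for t
    by (rule obstacle_process(2)[OF order_refl v XF Xc(1) Xp that])
  show "stopping_time F (exercise_time K T X v)"
    unfolding exercise_time_eq_hitting_time using T wc wF by (rule hitting_time_stopping_time)
  show "exercise_time K T X v \<omega> \<in> {0..T}" if "\<omega> \<in> space M" for \<omega>
    unfolding exercise_time_eq_hitting_time using T wc[OF that] by (rule hitting_time_properties(1))
  show "stopping_time F (exercise_time K T Y v)"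
    unfolding Y_def using T v by (rule exercise_time_gbm(1))
  show "exercise_time K T Y v \<omega> \<in> {0..T}" if "\<omega> \<in> space M" for \<omega>
    unfolding Y_def using T v that by (rule exercise_time_gbm(2))
  show "AE \<omega> in M. exercise_time K T X v \<omega> = exercise_time K T Y v \<omega>"
    using eq
  proof eventually_elim
    case (elim \<omega>)
    then have "{t \<in> {0..T}. v (ln (X t \<omega>)) t \<le> put_payoff K (X t \<omega>)} = {t \<in> {0..T}. v (ln (Y t \<omega>)) t \<le> put_payoff K (Y t \<omega>)}"
      by auto
    then show ?case by (simp only: exercise_time_def)
  qed
qed

end

theorem theorem3p8:
  fixes M :: "'a measure"
    and F :: "real \<Rightarrow> 'a measure"
    and W S :: "real \<Rightarrow> 'a \<Rightarrow> real"
    and u :: "real \<Rightarrow> real \<Rightarrow> real \<Rightarrow> real"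
    and T K r \<sigma> S0 :: real
  assumes "T > 0" and "K > 0" and "r > 0" and "\<sigma> > 0" and "S0 > 0"
    and "brownian_motion M F W"
    and "stock_price M F W r \<sigma> T 0 S0 S"
    and "\<And>l. l > 0 \<Longrightarrow> penalized_solution r \<sigma> K T l (u l)"
  shows "\<exists>C'>0. \<exists>l0\<in>{0<..<1}. \<forall>l. 0 < l \<and> l < l0 \<longrightarrow>
    exercise_value M r K 0 S (exercise_time K T S (u l))
      \<ge> exercise_value M r K 0 S (exercise_time K T S (u_star M F W r \<sigma> K T))
         - C' * l * ln (1 / l)"
proof -
  interpret brownian_motion M F W by fact
  note T = assms(1) and K = assms(2) and r = assms(3)
  have \<sigma>: "\<sigma> \<noteq> 0" and T0: "0 \<le> T" and zero: "0 \<in> {0..T}" using assms by auto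
  define y where "y = ln S0"
  have S: "stock_price M F W r \<sigma> T 0 (exp y) S" using assms(5,7) by (simp add: y_def)
  define Y where "Y = gbm W r \<sigma> 0 (exp y)"
  let ?u = "u_star M F W r \<sigma> K T"
  have us: "continuous_on (UNIV \<times> {0..T}) (\<lambda>(x, t). ?u x t)"
    by (rule u_star_continuous[OF assms(8) r K T \<sigma>])
  define C' where "C' = \<bar>ln (r * K)\<bar> + 1 + T"
  have "0 < C'" using T by (auto simp: C'_def)
  \<comment> \<open>For \<open>l < exp (- 1)\<close> the logarithm exceeds 1 and absorbs constants.\<close>
  moreover have "exercise_value M r K 0 S (exercise_time K T S ?u) - C' * l * ln (1 / l)
    \<le> exercise_value M r K 0 S (exercise_time K T S (u l))" if l: "0 < l" "l < exp (- 1)" for l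
  proof -
    have ul: "continuous_on (UNIV \<times> {0..T}) (\<lambda>(x, t). u l x t)"
      using assms(8)[OF l(1)] by (simp add: penalized_solution_def)
    define c where "c = max 0 (ln (r * K / l))"
    have c: "0 \<le> c" "r * K \<le> l * exp c"
      unfolding c_def using r K l(1) by (auto intro!: penalty_constant(2))
    have L: "1 \<le> ln (1 / l)"
    proof -
      have "ln l < ln (exp (- 1))" using l by (subst ln_less_cancel_iff) auto
      then show ?thesis using l by (simp add: ln_div)
    qed
    have "ln (r * K / l) = ln (r * K) + ln (1 / l)" using r K l by (simp add: ln_div ln_mult)
    also have "\<dots> \<le> \<bar>ln (r * K)\<bar> * 1 + ln (1 / l)" by simp
    also have "\<dots> \<le> \<bar>ln (r * K)\<bar> * ln (1 / l) + ln (1 / l)" using L by (intro add_right_mono mult_left_mono) auto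
    finally have "ln (r * K / l) \<le> (\<bar>ln (r * K)\<bar> + 1) * ln (1 / l)" by (simp add: distrib_right)
    then have "c \<le> (\<bar>ln (r * K)\<bar> + 1) * ln (1 / l)" unfolding c_def using L by simp
    moreover have "T \<le> T * ln (1 / l)" using T L by (simp add: mult_le_cancel_left1)
    ultimately have "c + T \<le> C' * ln (1 / l)" by (simp add: C'_def distrib_right)
    then have err: "l * (c + T) \<le> C' * l * ln (1 / l)"
      using mult_left_mono[of "c + T" "C' * ln (1 / l)" l] l by (simp add: mult_ac)
    have "exercise_value M r K 0 S (exercise_time K T S ?u) = exercise_value M r K 0 Y (exercise_time K T Y ?u)"
      unfolding Y_def by (rule exercise_value_exercise_time[OF T0 \<sigma> S us])
    also have "\<dots> \<le> u l y 0 + l * c"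
      unfolding Y_def
      by (rule exercise_value_le_penalized[OF assms(8)[OF l(1)] l(1) r K T c zero exercise_time_gbm[OF T0 us]])
    also have "u l y 0 \<le> exercise_value M r K 0 Y (exercise_time K T Y (u l)) + l * T"
      unfolding Y_def exercise_time_eq_hitting_time
      by (rule penalized_hitting_value(3)[OF assms(8)[OF l(1)] l(1) r K T zero])
    also have "exercise_value M r K 0 Y (exercise_time K T Y (u l)) = exercise_value M r K 0 S (exercise_time K T S (u l))"
      unfolding Y_def by (rule exercise_value_exercise_time[OF T0 \<sigma> S ul, symmetric])
    finally show ?thesis using err by (simp add: distrib_left)
  qed
  moreover have "exp (- 1) \<in> {0<..<1 :: real}" by simp
  ultimately show ?thesis by blast
qed

end
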